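(* There is an algorithm that, given an instance $\psi$ of \textsc{3-Partitioned-3-SAT} on $N$ variables, runs in $2^{\mathcal{O}(\sqrt{N})}$ time and constructs an equivalent instance $(G,k)$ of \textsc{Metric Dimension} (i.e., $\psi$ is satisfiable if and only if $G$ has a resolving set of size at most $k$) such that $\mathtt{vc}(G)+k=\mathcal{O}(\sqrt{N})$ and $|V(G)|=2^{\mathcal{O}(\sqrt{N})}$.
   Context: \textsc{3-Partitioned-3-SAT}: the input is a formula $\psi$ in 3-CNF together with a partition of its variable set into three disjoint sets $X^{\alpha},X^{\beta},X^{\gamma}$ with $|X^{\alpha}|=|X^{\beta}|=|X^{\gamma}|$, such that no clause contains more than one variable from each of $X^{\alpha},X^{\beta},X^{\gamma}$; the question is whether $\psi$ is satisfiable. \textsc{Metric Dimension}: given a graph $G$ and a positive integer $k$, decide whether there is $S\subseteq V(G)$ with $|S|\le k$ such that for every pair $u,v\in V(G)$ some $w\in S$ satisfies $d(w,u)\ne d(w,v)$, where $d$ is shortest-path distance (such $S$ is a resolving set). $\mathtt{vc}(G)$ is the minimum size of a vertex cover of $G$ (a set whose complement is independent). *)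

theory Defs
  imports Complex_Main "HOL-Library.Landau_Symbols" "HOL-Library.Extended_Nat"
begin

section \<open>3-Partitioned-3-SAT\<close>

datatype literal = Pos nat | Neg nat

fun var_of :: "literal \<Rightarrow> nat" where
  "var_of (Pos x) = x"
| "var_of (Neg x) = x"

fun lit_true :: "(nat \<Rightarrow> bool) \<Rightarrow> literal \<Rightarrow> bool" where
  "lit_true \<sigma> (Pos x) = \<sigma> x"
| "lit_true \<sigma> (Neg x) = (\<not> \<sigma> x)"

type_synonym clause = "literal set"

definition satisfiable :: "clause set \<Rightarrow> bool" where
  "satisfiable F \<longleftrightarrow> (\<exists>\<sigma>. \<forall>C\<in>F. \<exists>l\<in>C. lit_true \<sigma> l)"

definition is_3cnf :: "clause set \<Rightarrow> bool" where
  "is_3cnf F \<longleftrightarrow> finite F \<and> (\<forall>C\<in>F. finite C \<and> card C \<le> 3)"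

record psat =
  X_alpha :: "nat set"
  X_beta :: "nat set"
  X_gamma :: "nat set"
  clauses :: "clause set"

definition variables :: "psat \<Rightarrow> nat set" where
  "variables \<psi> = X_alpha \<psi> \<union> X_beta \<psi> \<union> X_gamma \<psi>"

text \<open>Variables in the three classes need not occur in a clause.\<close>

definition three_partitioned_3sat :: "psat \<Rightarrow> bool" where
  "three_partitioned_3sat \<psi> \<longleftrightarrow>
     is_3cnf (clauses \<psi>) \<and>
     finite (variables \<psi>) \<and>
     (\<forall>C\<in>clauses \<psi>. var_of ` C \<subseteq> variables \<psi>) \<and>
     X_alpha \<psi> \<inter> X_beta \<psi> = {} \<and> X_alpha \<psi> \<inter> X_gamma \<psi> = {} \<and> X_beta \<psi> \<inter> X_gamma \<psi> = {} \<and>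
     card (X_alpha \<psi>) = card (X_beta \<psi>) \<and> card (X_beta \<psi>) = card (X_gamma \<psi>) \<and>
     (\<forall>C\<in>clauses \<psi>. \<forall>X\<in>{X_alpha \<psi>, X_beta \<psi>, X_gamma \<psi>}. card (var_of ` C \<inter> X) \<le> 1)"

section \<open>Metric dimension and vertex cover\<close>

record 'a graph =
  verts :: "'a set"
  edges :: "'a set set"

definition simple_graph :: "'a graph \<Rightarrow> bool" where
  "simple_graph G \<longleftrightarrow> finite (verts G) \<and> (\<forall>e\<in>edges G. e \<subseteq> verts G \<and> card e = 2)"

definition walk_between :: "'a graph \<Rightarrow> 'a \<Rightarrow> 'a list \<Rightarrow> 'a \<Rightarrow> bool" where
  "walk_between G u p v \<longleftrightarrow>
     p \<noteq> [] \<and> hd p = u \<and> last p = v \<and> set p \<subseteq> verts G \<and>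
     successively (\<lambda>x y. {x, y} \<in> edges G) p"

text \<open>The distance of vertices in different components is \<open>\<infinity>\<close>, the infimum of the empty set.\<close>

definition graph_dist :: "'a graph \<Rightarrow> 'a \<Rightarrow> 'a \<Rightarrow> enat" where
  "graph_dist G u v = (INF p \<in> {p. walk_between G u p v}. enat (length p - 1))"

definition resolving_set :: "'a graph \<Rightarrow> 'a set \<Rightarrow> bool" where
  "resolving_set G S \<longleftrightarrow>
     S \<subseteq> verts G \<and>
     (\<forall>u\<in>verts G. \<forall>v\<in>verts G. u \<noteq> v \<longrightarrow> (\<exists>w\<in>S. graph_dist G w u \<noteq> graph_dist G w v))"

definition independent_set :: "'a graph \<Rightarrow> 'a set \<Rightarrow> bool" where
  "independent_set G A \<longleftrightarrow> A \<subseteq> verts G \<and> (\<forall>u\<in>A. \<forall>v\<in>A. {u, v} \<notin> edges G)"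

definition vertex_cover :: "'a graph \<Rightarrow> 'a set \<Rightarrow> bool" where
  "vertex_cover G C \<longleftrightarrow> C \<subseteq> verts G \<and> independent_set G (verts G - C)"

definition vc :: "'a graph \<Rightarrow> nat" where
  "vc G = (LEAST m. \<exists>C. vertex_cover G C \<and> card C = m)"

section \<open>Random access machines\<close>

text \<open>
  Programs of a random access machine in structured form. A state consists of registers and
  finitely many (per program) unbounded arrays, all holding natural numbers. Time is the number
  of elementary operations at unit cost. The only arithmetic is addition and truncated
  subtraction, so \<open>t\<close> steps produce numbers of at most \<open>O(t)\<close> more bits than those in the
  input and the program, and the model is polynomially equivalent to Turing machines.
\<close>

datatype exp =
  Const nat
| Reg nat
| Cell nat exp  \<comment> \<open>array and index\<close>
| Add exp exp
| Sub exp exp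

datatype com =
  SKIP
| Assign nat exp
| Store nat exp exp  \<comment> \<open>array, index and new value\<close>
| Seq com com
| IfNZ exp com com
| WhileNZ exp com

record state =
  regs :: "nat \<Rightarrow> nat"
  arrays :: "nat \<Rightarrow> nat \<Rightarrow> nat"

fun eval_exp :: "exp \<Rightarrow> state \<Rightarrow> nat" where
  "eval_exp (Const n) s = n"
| "eval_exp (Reg r) s = regs s r"
| "eval_exp (Cell a e) s = arrays s a (eval_exp e s)"
| "eval_exp (Add e1 e2) s = eval_exp e1 s + eval_exp e2 s"
| "eval_exp (Sub e1 e2) s = eval_exp e1 s - eval_exp e2 s"

fun exp_cost :: "exp \<Rightarrow> nat" where
  "exp_cost (Const n) = 1"
| "exp_cost (Reg r) = 1"
| "exp_cost (Cell a e) = exp_cost e + 1"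
| "exp_cost (Add e1 e2) = exp_cost e1 + exp_cost e2 + 1"
| "exp_cost (Sub e1 e2) = exp_cost e1 + exp_cost e2 + 1"

definition set_reg :: "nat \<Rightarrow> nat \<Rightarrow> state \<Rightarrow> state" where
  "set_reg r x s = s\<lparr>regs := (regs s)(r := x)\<rparr>"

definition set_cell :: "nat \<Rightarrow> nat \<Rightarrow> nat \<Rightarrow> state \<Rightarrow> state" where
  "set_cell a i x s = s\<lparr>arrays := (arrays s)(a := (arrays s a)(i := x))\<rparr>"

text \<open>\<open>exec c s t s'\<close>: started in \<open>s\<close>, the program \<open>c\<close> halts in \<open>s'\<close> after exactly \<open>t\<close> steps.\<close>

inductive exec :: "com \<Rightarrow> state \<Rightarrow> nat \<Rightarrow> state \<Rightarrow> bool" where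
  Skip: "exec SKIP s 1 s"
| Assign: "exec (Assign r e) s (exp_cost e + 1) (set_reg r (eval_exp e s) s)"
| Store: "exec (Store a i e) s (exp_cost i + exp_cost e + 1)
            (set_cell a (eval_exp i s) (eval_exp e s) s)"
| Seq: "exec c1 s t1 s' \<Longrightarrow> exec c2 s' t2 s'' \<Longrightarrow> exec (Seq c1 c2) s (t1 + t2) s''"
| IfTrue: "eval_exp b s \<noteq> 0 \<Longrightarrow> exec c1 s t s' \<Longrightarrow>
            exec (IfNZ b c1 c2) s (exp_cost b + 1 + t) s'"
| IfFalse: "eval_exp b s = 0 \<Longrightarrow> exec c2 s t s' \<Longrightarrow>
            exec (IfNZ b c1 c2) s (exp_cost b + 1 + t) s'"
| WhileFalse: "eval_exp b s = 0 \<Longrightarrow> exec (WhileNZ b c) s (exp_cost b + 1) s"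
| WhileTrue: "eval_exp b s \<noteq> 0 \<Longrightarrow> exec c s t1 s' \<Longrightarrow> exec (WhileNZ b c) s' t2 s'' \<Longrightarrow>
            exec (WhileNZ b c) s (exp_cost b + 1 + t1 + t2) s''"

inductive_cases SkipE: "exec SKIP s t s'"
inductive_cases AssignE: "exec (Assign r e) s t s'"
inductive_cases StoreE: "exec (Store a i e) s t s'"
inductive_cases SeqE: "exec (Seq c1 c2) s t s'"
inductive_cases IfE: "exec (IfNZ b c1 c2) s t s'"
inductive_cases WhileE: "exec (WhileNZ b c) s t s'"

lemma exec_deterministic:
  "exec c s t s' \<Longrightarrow> exec c s t' s'' \<Longrightarrow> t' = t \<and> s'' = s'"
proof (induction arbitrary: t' s'' rule: exec.induct)
  case Skip then show ?case by (auto elim: SkipE)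
next
  case Assign then show ?case by (auto elim: AssignE)
next
  case Store then show ?case by (auto elim: StoreE)
next
  case (Seq c1 s t1 s1 c2 t2 s2)
  from Seq.prems obtain u1 r u2 where "exec c1 s u1 r" "exec c2 r u2 s''" "t' = u1 + u2"
    by (rule SeqE)
  with Seq.IH show ?case by metis
next
  case (IfTrue b s c1 t s1 c2)
  from IfTrue.prems IfTrue.hyps(1) obtain u where "exec c1 s u s''" "t' = exp_cost b + 1 + u"
    by (auto elim: IfE)
  with IfTrue.IH show ?case by metis
next
  case (IfFalse b s c2 t s1 c1)
  from IfFalse.prems IfFalse.hyps(1) obtain u where "exec c2 s u s''" "t' = exp_cost b + 1 + u"
    by (auto elim: IfE)
  with IfFalse.IH show ?case by metis
next
  case (WhileFalse b s c)
  from WhileFalse.prems WhileFalse.hyps show ?case by (auto elim: WhileE)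
next
  case (WhileTrue b s c t1 s1 t2 s2)
  from WhileTrue.prems WhileTrue.hyps(1) obtain u1 r u2 where
    "exec c s u1 r" "exec (WhileNZ b c) r u2 s''" "t' = exp_cost b + 1 + u1 + u2"
    by (auto elim: WhileE)
  with WhileTrue.IH show ?case by metis
qed

section \<open>Input and output conventions\<close>

text \<open>
  With \<open>n\<close> the common size of the three classes, the variables are numbered from \<open>0\<close> to
  \<open>3 * n - 1\<close>, class by class and in any order within a class. The input consists of \<open>n\<close>, the
  number of clauses, and the clauses (in any order, each once), each given by its length and its
  literals.
\<close>

fun lit_code :: "(nat \<Rightarrow> nat) \<Rightarrow> literal \<Rightarrow> nat" where
  "lit_code num (Pos x) = 2 * num x"
| "lit_code num (Neg x) = 2 * num x + 1"

definition encodes_psat :: "psat \<Rightarrow> nat list \<Rightarrow> bool" where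
  "encodes_psat \<psi> ws \<longleftrightarrow>
     (\<exists>num cls. let n = card (X_alpha \<psi>) in
        bij_betw num (X_alpha \<psi>) {0..<n} \<and>
        bij_betw num (X_beta \<psi>) {n..<2 * n} \<and>
        bij_betw num (X_gamma \<psi>) {2 * n..<3 * n} \<and>
        distinct (map set cls) \<and> set (map set cls) = clauses \<psi> \<and> (\<forall>c\<in>set cls. distinct c) \<and>
        ws = n # length cls # concat (map (\<lambda>c. length c # map (lit_code num) c) cls))"

definition initial_state :: "nat list \<Rightarrow> state" where
  "initial_state ws =
     \<lparr>regs = (\<lambda>_. 0), arrays = (\<lambda>a i. if a = 0 \<and> i < length ws then ws ! i else 0)\<rparr>"

text \<open>
  The output in array 1 is the number of vertices, the number \<open>k\<close> and the adjacency matrix, row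
  by row.
\<close>

definition outputs_md :: "state \<Rightarrow> nat graph \<Rightarrow> nat \<Rightarrow> bool" where
  "outputs_md s G k \<longleftrightarrow>
     (let p = card (verts G); out = arrays s 1 in
        verts G = {0..<p} \<and> out 0 = p \<and> out 1 = k \<and>
        (\<forall>i<p. \<forall>j<p. out (2 + i * p + j) = (if {i, j} \<in> edges G then 1 else 0)))"

end

theory Submission
  imports Defs
begin

text \<open>
  Split each class of \<open>n\<close> variables into \<open>s\<close> buckets of \<open>s\<close>
  variables, where \<open>s\<close> is about \<open>sqrt n\<close>. There is one vertex \<open>AsgV
  b a\<close> for each bucket \<open>b\<close> and each of the \<open>2 ^ s\<close> assignments
  \<open>a\<close> of its variables. It is adjacent to \<open>BucketV b\<close> and to one of two
  \<open>LitV\<close> vertices (true, false) for each position in a bucket; these are shared by all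
  buckets of the class, so \<open>O(s)\<close> of them suffice. A clause gives two vertices, both
  adjacent to all buckets in which it has no variable; one of them is also adjacent to the positions
  of its literals, with their signs. Hence \<open>AsgV b a\<close> is at different distances (2 and
  3) from them if and only if \<open>b\<close> contains a variable of the clause and
  \<open>a\<close> satisfies its literal: as the clause has at most one variable in a class, the
  shared positions are harmless.

  A pair of \<open>Guard\<close> vertices for each bucket forces a resolving set to use a vertex
  belonging to that bucket, and a clique of \<open>O(s)\<close> vertices \<open>BitV\<close>, each
  with two pendant twins one of which must be taken, identifies all remaining vertices by binary
  codes. With the budget of one vertex per twin pair and per bucket, a resolving set is the same as
  a satisfying assignment. All distances are at most 3, and are therefore determined by equality,
  adjacency and the existence of a common neighbour. The vertices \<open>BitV\<close>,
  \<open>LitV\<close>, \<open>BucketV\<close> form a vertex cover.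
\<close>

section \<open>Distances and hitting sets\<close>

text \<open>The size \<open>s\<close> balances two costs: there are \<open>3 * s\<close> buckets,
  which enter the budget and the cover, and \<open>2 ^ s\<close> assignments per bucket, which enter
  only the number of vertices. Clauses stay outside the cover as well, so their number, at most
  cubic in \<open>n\<close>, matters only for the length \<open>M\<close> of the binary codes.

  Guards and clause vertices are all adjacent to \<open>BitV 0\<close>. Hence another neighbour of
  \<open>BitV 0\<close> is at distance at most 2 from both members of such a pair and can separate
  them only by being adjacent to exactly one. Separation by 2 against 3, on which the encoding of
  assignments rests, is reserved for vertices away from \<open>BitV 0\<close>. This is why
  \<open>AsgV\<close> vertices carry the flag \<open>BitV 1\<close> instead and use a second block
  of \<open>M\<close> bits, which gives \<open>m = 2 * M + 2\<close>.

  The budget is tight: the sets that a resolving set has to meet are pairwise disjoint and as many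
  as the vertices allowed. This also rules out \<open>LitV\<close> vertices, which would separate
  clause pairs without encoding any assignment.\<close>

lemma graph_dist_eqI:
  assumes "walk_between G u q v" "length q = Suc n"
    and "\<And>q'. walk_between G u q' v \<Longrightarrow> n < length q'"
  shows "graph_dist G u v = enat n"
  unfolding graph_dist_def
proof (rule antisym)
  show "(INF q \<in> {q. walk_between G u q v}. enat (length q - 1)) \<le> enat n"
    by (rule INF_lower2[of q]) (use assms(1,2) in auto)
  show "enat n \<le> (INF q \<in> {q. walk_between G u q v}. enat (length q - 1))"
    by (rule INF_greatest) (use assms(3) in fastforce)
qed

lemma walk_short_cases:
  assumes "walk_between G u q v" "length q \<le> 3"
  shows "u = v \<or> {u, v} \<in> edges G \<or> (\<exists>x\<in>verts G. {u, x} \<in> edges G \<and> {x, v} \<in> edges G)"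
proof -
  have "q \<noteq> []" using assms(1) by (simp add: walk_between_def)
  with assms(2) consider a where "q = [a]" | a b where "q = [a, b]" | a b c where "q = [a, b, c]"
    by (cases q rule: list.exhaust; cases "tl q"; cases "tl (tl q)") auto
  then show ?thesis
    using assms(1) by cases (auto simp: walk_between_def)
qed

lemma walk_length_2:
  assumes "walk_between G u q v" "u \<noteq> v" shows "1 < length q"
proof (rule ccontr)
  assume "\<not> 1 < length q"
  with assms have "length q = 1" by (cases q) (auto simp: walk_between_def)
  with assms show False by (auto simp: walk_between_def length_Suc_conv)
qed

lemma walk_length_3:
  assumes "walk_between G u q v" "u \<noteq> v" "{u, v} \<notin> edges G" shows "2 < length q"
proof (rule ccontr)
  assume "\<not> 2 < length q"
  with walk_length_2[OF assms(1,2)] have "length q = 2" by simp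
  then obtain a b where "q = [a, b]"
    by (metis One_nat_def Suc_1 length_0_conv length_Suc_conv)
  with assms show False by (auto simp: walk_between_def)
qed

lemma graph_dist_diameter_3:
  assumes uv: "u \<in> verts G" "v \<in> verts G"
    and walk3: "u \<noteq> v \<Longrightarrow> {u, v} \<notin> edges G \<Longrightarrow>
      \<not> (\<exists>x\<in>verts G. {u, x} \<in> edges G \<and> {x, v} \<in> edges G) \<Longrightarrow>
      \<exists>x\<in>verts G. \<exists>y\<in>verts G. {u, x} \<in> edges G \<and> {x, y} \<in> edges G \<and> {y, v} \<in> edges G"
  shows "graph_dist G u v = enat (if u = v then 0 else if {u, v} \<in> edges G then 1
     else if \<exists>x\<in>verts G. {u, x} \<in> edges G \<and> {x, v} \<in> edges G then 2 else 3)"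
proof -
  consider "u = v" | "u \<noteq> v" "{u, v} \<in> edges G"
    | "u \<noteq> v" "{u, v} \<notin> edges G" "\<exists>x\<in>verts G. {u, x} \<in> edges G \<and> {x, v} \<in> edges G"
    | "u \<noteq> v" "{u, v} \<notin> edges G" "\<not> (\<exists>x\<in>verts G. {u, x} \<in> edges G \<and> {x, v} \<in> edges G)"
    by blast
  then show ?thesis
  proof cases
    case 1
    have "graph_dist G u v = enat 0"
      by (rule graph_dist_eqI[of _ _ "[u]"]) (use 1 uv in \<open>auto simp: walk_between_def\<close>)
    with 1 show ?thesis by simp
  next
    case 2
    have "graph_dist G u v = enat 1"
      by (rule graph_dist_eqI[of _ _ "[u, v]"])
         (use 2 uv walk_length_2[OF _ 2(1)] in \<open>auto simp: walk_between_def\<close>)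
    with 2 show ?thesis by simp
  next
    case 3
    then obtain x where x: "x \<in> verts G" "{u, x} \<in> edges G" "{x, v} \<in> edges G" by blast
    have "graph_dist G u v = enat 2"
      by (rule graph_dist_eqI[of _ _ "[u, x, v]"])
         (use 3 uv x walk_length_3[OF _ 3(1,2)] in \<open>auto simp: walk_between_def\<close>)
    with 3 show ?thesis by simp
  next
    case 4
    then obtain x y where x: "x \<in> verts G" "y \<in> verts G" "{u, x} \<in> edges G" "{x, y} \<in> edges G"
      "{y, v} \<in> edges G" using walk3 by blast
    have "graph_dist G u v = enat 3"
    proof (rule graph_dist_eqI[of _ _ "[u, x, y, v]"])
      fix q assume q: "walk_between G u q v"
      show "3 < length q"
      proof (rule ccontr)
        assume "\<not> 3 < length q"
        with walk_short_cases[OF q] 4 show False by simp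
      qed
    qed (use uv x in \<open>auto simp: walk_between_def\<close>)
    with 4 show ?thesis by (simp add: Bex_def)
  qed
qed

text \<open>Choosing an element of \<open>S\<close> in each \<open>R j\<close> is injective by
  disjointness, so the chosen elements already exhaust \<open>S\<close>. A second element of some
  \<open>R j\<close> would be the choice for another index.\<close>

lemma hitting_set_exact:
  assumes "finite J" "finite S" "card S \<le> card J"
    and disj: "\<And>i j. i \<in> J \<Longrightarrow> j \<in> J \<Longrightarrow> i \<noteq> j \<Longrightarrow> R i \<inter> R j = {}"
    and hit: "\<And>j. j \<in> J \<Longrightarrow> S \<inter> R j \<noteq> {}"
  shows "S \<subseteq> \<Union> (R ` J)" and "\<And>j a b. j \<in> J \<Longrightarrow> a \<in> S \<inter> R j \<Longrightarrow> b \<in> S \<inter> R j \<Longrightarrow> a = b"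
proof -
  define f where "f j = (SOME a. a \<in> S \<inter> R j)" for j
  have f: "f j \<in> S \<inter> R j" if "j \<in> J" for j
    unfolding f_def by (rule someI_ex) (use hit[OF that] in blast)
  have "inj_on f J"
    using f disj by (fastforce simp: inj_on_def)
  then have "card (f ` J) = card J" by (rule card_image)
  then have img: "f ` J = S"
    using f assms(2,3) by (intro card_seteq) auto
  then show "S \<subseteq> \<Union> (R ` J)" using f by blast
  have uniq: "a = f j" if "j \<in> J" "a \<in> S \<inter> R j" for a j
  proof -
    from img that obtain i where i: "i \<in> J" "a = f i" by blast
    with f[OF i(1)] that disj[of i j] have "i = j" by auto
    with i show ?thesis by simp
  qed
  show "\<And>j a b. j \<in> J \<Longrightarrow> a \<in> S \<inter> R j \<Longrightarrow> b \<in> S \<inter> R j \<Longrightarrow> a = b"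
    using uniq by metis
qed

section \<open>The graph\<close>

datatype vtx =
  BitV nat
| Pendant nat bool
| Guard nat bool
| ClauseV nat bool
| LitV nat bool
| BucketV nat
| AsgV nat nat

text \<open>
  A clause is the list of its literal codes. \<open>s\<close> is both the number of buckets of a class and the
  size of a bucket, and \<open>d\<close> is the size of a class (1 if the classes are empty, to divide by).
\<close>

locale reduction =
  fixes d s M :: nat and cs :: "nat list list"
  assumes s_pos: "1 \<le> s" and d_pos: "1 \<le> d" and d_le: "d \<le> s * s"
    and lits_lt: "\<And>c l. c \<in> set cs \<Longrightarrow> l \<in> set c \<Longrightarrow> l < 6 * d"
    and class_unique: "\<And>c l l'. c \<in> set cs \<Longrightarrow> l \<in> set c \<Longrightarrow> l' \<in> set c \<Longrightarrow>
      (l div 2) div d = (l' div 2) div d \<Longrightarrow> l div 2 = l' div 2"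
    and size_lt: "6 * M + 6 + 15 * s + 2 * length cs + 3 * s * 2 ^ s < 2 ^ M"
begin

abbreviation K where "K \<equiv> length cs"

definition m where "m = 2 * M + 2"
definition oP where "oP = 3 * m"
definition oC where "oC = oP + 6 * s"
definition oL where "oL = oC + 2 * K"
definition oB where "oB = oL + 6 * s"
definition oA where "oA = oB + 3 * s"
definition p where "p = oA + 3 * s * 2 ^ s"

lemma p_less: "p < 2 ^ M"
  using size_lt by (simp add: p_def oA_def oB_def oL_def oC_def oP_def m_def)

text \<open>Class \<open>\<delta>\<close> owns the buckets and the literal positions \<open>\<delta> * s, \<dots>, \<delta> * s + s - 1\<close>.\<close>

definition bucket where "bucket l = (l div 2) div d * s + ((l div 2) mod d) div s"
definition pos where "pos l = (l div 2) div d * s + ((l div 2) mod d) mod s"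

primrec valid where
  "valid (BitV j) = (j < m)"
| "valid (Pendant j x) = (j < m)"
| "valid (Guard b x) = (b < 3 * s)"
| "valid (ClauseV c x) = (c < K)"
| "valid (LitV h x) = (h < 3 * s)"
| "valid (BucketV b) = (b < 3 * s)"
| "valid (AsgV b a) = (b < 3 * s \<and> a < 2 ^ s)"

primrec idx where
  "idx (BitV j) = j"
| "idx (Pendant j x) = m + 2 * j + of_bool x"
| "idx (Guard b x) = oP + 2 * b + of_bool x"
| "idx (ClauseV c x) = oC + 2 * c + of_bool x"
| "idx (LitV h x) = oL + 2 * h + of_bool x"
| "idx (BucketV b) = oB + b"
| "idx (AsgV b a) = oA + b * 2 ^ s + a"

text \<open>
  The code of a vertex other than \<open>BitV\<close> is its set of neighbours among the \<open>BitV\<close> vertices. It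
  identifies the vertex up to the twin pairs of \<open>Pendant\<close>, \<open>Guard\<close> and \<open>ClauseV\<close> vertices. The
  codes of \<open>AsgV\<close> vertices are disjoint from those of \<open>Guard\<close> and \<open>ClauseV\<close> vertices, so they
  do not create common neighbours.
\<close>

definition binary :: "nat \<Rightarrow> nat \<Rightarrow> nat set" where
  "binary off x = {off + j |j. j < M \<and> bit x j}"

primrec code :: "vtx \<Rightarrow> nat set" where
  "code (BitV j) = - {j}"
| "code (Pendant j x) = {j}"
| "code (Guard b x) = insert 0 (binary 2 (idx (Guard b False)))"
| "code (ClauseV c x) = insert 0 (binary 2 (idx (ClauseV c False)))"
| "code (LitV h x) = insert 0 (binary 2 (idx (LitV h x)))"
| "code (BucketV b) = insert 0 (binary 2 (idx (BucketV b)))"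
| "code (AsgV b a) = insert 1 (binary (2 + M) (idx (AsgV b a)))"

text \<open>Each edge is listed in one orientation, towards a \<open>BitV\<close>,
  \<open>BucketV\<close> or \<open>LitV\<close> vertex, which makes the vertex cover visible.
  \<open>LitV h False\<close> stands for the positive literal, in line with the even literal
  codes.\<close>

fun arc :: "vtx \<Rightarrow> vtx \<Rightarrow> bool" where
  "arc u (BitV j) = (j \<in> code u)"
| "arc (Guard b x) (BucketV b') = (x \<longrightarrow> b' \<noteq> b)"
| "arc (AsgV b a) (BucketV b') = (b' = b)"
| "arc (AsgV b a) (LitV h x) = (h div s = b div s \<and> x = (\<not> bit a (h mod s)))"
| "arc (ClauseV c x) (BucketV b) = (b \<notin> bucket ` set (cs ! c))"
| "arc (ClauseV c x) (LitV h y) = (\<not> x \<and> (\<exists>l\<in>set (cs ! c). h = pos l \<and> y = odd l))"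
| "arc _ _ = False"

definition adj where "adj u v \<longleftrightarrow> arc u v \<or> arc v u"

lemma adj_sym: "adj u v = adj v u" by (auto simp: adj_def)

lemma adj_irrefl: "\<not> adj u u" by (cases u) (auto simp: adj_def)

definition vdist :: "vtx \<Rightarrow> vtx \<Rightarrow> nat" where
  "vdist u v = (if u = v then 0 else if adj u v then 1
     else if \<exists>x. valid x \<and> adj u x \<and> adj x v then 2 else 3)"

definition G :: "nat graph" where
  "G = \<lparr>verts = idx ` Collect valid, edges = {{idx u, idx v} |u v. valid u \<and> valid v \<and> adj u v}\<rparr>"

section \<open>Numbering of the vertices\<close>

lemma idx_bounds:
  "valid u \<Longrightarrow> idx u \<in> (case u of BitV _ \<Rightarrow> {0..<m} | Pendant _ _ \<Rightarrow> {m..<oP}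
    | Guard _ _ \<Rightarrow> {oP..<oC} | ClauseV _ _ \<Rightarrow> {oC..<oL} | LitV _ _ \<Rightarrow> {oL..<oB}
    | BucketV _ \<Rightarrow> {oB..<oA} | AsgV _ _ \<Rightarrow> {oA..<p})"
proof (induction u)
  case (AsgV b a)
  then have "b * 2 ^ s + a < Suc b * 2 ^ s" by simp
  also have "\<dots> \<le> 3 * s * 2 ^ s" using AsgV by (intro mult_right_mono) auto
  finally show ?case by (simp add: p_def)
qed (auto simp: oA_def oB_def oL_def oC_def oP_def)

lemma offsets: "m \<le> oP" "oP \<le> oC" "oC \<le> oL" "oL \<le> oB" "oB \<le> oA" "oA \<le> p" "0 < m"
  by (auto simp: p_def oA_def oB_def oL_def oC_def oP_def m_def)

lemma twice_bool_eq: "2 * (a::nat) + of_bool x = 2 * b + of_bool y \<longleftrightarrow> a = b \<and> x = y"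
  by (cases x; cases y) (auto; presburger)+

text \<open>The seven kinds of vertices have disjoint index ranges. Within a range, parity recovers
  the Boolean, and division by \<open>2 ^ s\<close> the bucket and its assignment.\<close>

lemma inj_idx: "inj_on idx (Collect valid)"
proof (rule inj_onI)
  fix u v assume uv: "u \<in> Collect valid" "v \<in> Collect valid" "idx u = idx v"
  have A: "b = b' \<and> a = a'" if "b * 2 ^ s + a = b' * 2 ^ s + a'" "a < 2 ^ s" "a' < 2 ^ s"
    for a a' b b' :: nat
  proof -
    have "b = (b * 2 ^ s + a) div 2 ^ s" "a = (b * 2 ^ s + a) mod 2 ^ s"
      "b' = (b' * 2 ^ s + a') div 2 ^ s" "a' = (b' * 2 ^ s + a') mod 2 ^ s" using that(2,3) by auto
    with that(1) show ?thesis by metis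
  qed
  show "u = v"
    using uv idx_bounds[of u] idx_bounds[of v] offsets
    by (cases u; cases v) (auto simp: twice_bool_eq add.assoc dest: A)
qed

lemma idx_less: "valid u \<Longrightarrow> idx u < p"
  using idx_bounds[of u] offsets by (cases u) auto

lemma verts_G: "verts G = {0..<p}"
proof -
  have "x \<in> idx ` Collect valid" if "x < p" for x
  proof -
    have tw: "y = 2 * (y div 2) + of_bool (odd y)" for y :: nat by (cases "odd y") auto
    consider "x < m" | "m \<le> x" "x < oP" | "oP \<le> x" "x < oC" | "oC \<le> x" "x < oL"
      | "oL \<le> x" "x < oB" | "oB \<le> x" "x < oA" | "oA \<le> x" "x < p" using \<open>x < p\<close> by linarith
    then show ?thesis
    proof cases
      case 1 then show ?thesis by (intro image_eqI[of _ _ "BitV x"]) auto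
    next
      case 2 then show ?thesis
        using tw[of "x - m"] by (intro image_eqI[of _ _ "Pendant ((x - m) div 2) (odd (x - m))"]) (auto simp: oP_def)
    next
      case 3 then show ?thesis
        using tw[of "x - oP"] by (intro image_eqI[of _ _ "Guard ((x - oP) div 2) (odd (x - oP))"]) (auto simp: oC_def)
    next
      case 4 then show ?thesis
        using tw[of "x - oC"] by (intro image_eqI[of _ _ "ClauseV ((x - oC) div 2) (odd (x - oC))"]) (auto simp: oL_def)
    next
      case 5 then show ?thesis
        using tw[of "x - oL"] by (intro image_eqI[of _ _ "LitV ((x - oL) div 2) (odd (x - oL))"]) (auto simp: oB_def)
    next
      case 6 then show ?thesis by (intro image_eqI[of _ _ "BucketV (x - oB)"]) (auto simp: oA_def)
    next
      case 7
      then have "x = oA + ((x - oA) div 2 ^ s * 2 ^ s + (x - oA) mod 2 ^ s)"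
        by (subst div_mult_mod_eq) simp
      with 7 show ?thesis
        by (intro image_eqI[of _ _ "AsgV ((x - oA) div 2 ^ s) ((x - oA) mod 2 ^ s)"])
           (auto simp: p_def less_mult_imp_div_less)
    qed
  qed
  then show ?thesis by (auto simp: G_def idx_less)
qed

lemma edge_iff: "valid u \<Longrightarrow> valid v \<Longrightarrow> {idx u, idx v} \<in> edges G \<longleftrightarrow> adj u v"
  unfolding G_def using inj_idx
  by (auto simp: doubleton_eq_iff inj_on_def adj_sym) (metis adj_sym)+

lemma simple_G: "simple_graph G"
proof -
  have "card {idx u, idx v} = 2" if "valid u" "valid v" "adj u v" for u v
    using that inj_idx adj_irrefl[of u] by (auto simp: card_insert_if inj_on_def)
  moreover have "finite (verts G)" by (simp add: verts_G)
  ultimately show ?thesis by (auto simp: simple_graph_def G_def)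
qed

section \<open>Distances in the graph\<close>

lemma code_meets:
  assumes "valid u" shows "(\<exists>j. u = BitV j) \<or> (\<exists>j<m. adj u (BitV j))"
proof (cases u)
  case (AsgV b a) then show ?thesis
    by (intro disjI2 exI[of _ 1]) (auto simp: adj_def m_def)
next
  case (Pendant j x) with assms show ?thesis
    by (intro disjI2 exI[of _ j]) (auto simp: adj_def)
qed (auto intro!: exI[of _ 0] simp: adj_def m_def)

lemma adj_BitV: "i \<noteq> j \<Longrightarrow> adj (BitV i) (BitV j)" by (simp add: adj_def)

text \<open>The \<open>BitV\<close> vertices form a clique and every other vertex has a neighbour in
  it, so a walk through at most two clique vertices joins any two vertices.\<close>

lemma graph_dist_G:
  assumes "valid u" "valid v" shows "graph_dist G (idx u) (idx v) = enat (vdist u v)"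
proof -
  have common: "(\<exists>x\<in>verts G. {idx u, x} \<in> edges G \<and> {x, idx v} \<in> edges G)
      \<longleftrightarrow> (\<exists>x. valid x \<and> adj u x \<and> adj x v)"
  proof -
    have "(\<exists>x\<in>verts G. Q x) \<longleftrightarrow> (\<exists>x. valid x \<and> Q (idx x))" for Q by (auto simp: G_def)
    then show ?thesis using assms by (auto simp: edge_iff)
  qed
  have eq: "idx u = idx v \<longleftrightarrow> u = v" using inj_idx assms by (auto simp: inj_on_def)
  have "graph_dist G (idx u) (idx v) = enat (if idx u = idx v then 0
     else if {idx u, idx v} \<in> edges G then 1
     else if \<exists>x\<in>verts G. {idx u, x} \<in> edges G \<and> {x, idx v} \<in> edges G then 2 else 3)"
  proof (rule graph_dist_diameter_3)
    assume "idx u \<noteq> idx v" "{idx u, idx v} \<notin> edges G"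
      "\<not> (\<exists>x\<in>verts G. {idx u, x} \<in> edges G \<and> {x, idx v} \<in> edges G)"
    then have neq: "u \<noteq> v" and nadj: "\<not> adj u v" and nc: "\<not> (\<exists>x. valid x \<and> adj u x \<and> adj x v)"
      using common eq assms by (auto simp: edge_iff)
    have "\<exists>x y. valid x \<and> valid y \<and> adj u x \<and> adj x y \<and> adj y v"
    proof -
      \<comment> \<open>A clique vertex is within distance 2 of every vertex, but here there is
        neither an edge nor a common neighbour.\<close>
      have "\<not> (\<exists>j. u = BitV j)"
      proof
        assume "\<exists>j. u = BitV j"
        then obtain j where j: "u = BitV j" by blast
        from code_meets[OF assms(2)] show False
        proof
          assume "\<exists>i. v = BitV i"
          then show False using adj_BitV neq nadj j by blast
        next
          assume "\<exists>i<m. adj v (BitV i)"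
          then obtain i where "i < m" "adj v (BitV i)" by blast
          then show False using nc nadj j adj_BitV[of j i] adj_sym by (metis valid.simps(1))
        qed
      qed
      moreover have "\<not> (\<exists>j. v = BitV j)"
      proof
        assume "\<exists>j. v = BitV j"
        then obtain j where j: "v = BitV j" by blast
        from code_meets[OF assms(1)] show False
        proof
          assume "\<exists>i. u = BitV i"
          then show False using adj_BitV neq nadj j by blast
        next
          assume "\<exists>i<m. adj u (BitV i)"
          then obtain i where "i < m" "adj u (BitV i)" by blast
          then show False using nc nadj j adj_BitV[of i j] by (metis valid.simps(1))
        qed
      qed
      ultimately obtain i j where "i < m" "adj u (BitV i)" "j < m" "adj v (BitV j)"
        using code_meets assms by blast
      moreover from this have "i \<noteq> j" using nc adj_sym by (metis valid.simps(1))
      ultimately show ?thesis using adj_BitV adj_sym by (metis valid.simps(1))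
    qed
    then obtain x y where "valid x" "valid y" "adj u x" "adj x y" "adj y v" by blast
    then show "\<exists>x\<in>verts G. \<exists>y\<in>verts G.
        {idx u, x} \<in> edges G \<and> {x, y} \<in> edges G \<and> {y, idx v} \<in> edges G"
      using assms by (intro bexI[of _ "idx x"] bexI[of _ "idx y"]) (auto simp: edge_iff verts_G idx_less)
  qed (use assms in \<open>auto simp: G_def\<close>)
  then show ?thesis using common eq assms by (simp add: vdist_def edge_iff)
qed

definition resolving where
  "resolving S \<longleftrightarrow> S \<subseteq> Collect valid \<and>
     (\<forall>u v. valid u \<longrightarrow> valid v \<longrightarrow> u \<noteq> v \<longrightarrow> (\<exists>w\<in>S. vdist w u \<noteq> vdist w v))"

lemma finite_valid: "finite (Collect valid)"
  using finite_imageD[OF _ inj_idx] verts_G by (simp add: G_def)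

lemma resolving_set_image:
  assumes "S \<subseteq> Collect valid" shows "resolving_set G (idx ` S) \<longleftrightarrow> resolving S"
proof -
  have "(\<forall>x\<in>verts G. \<forall>y\<in>verts G. x \<noteq> y \<longrightarrow> (\<exists>w\<in>idx ` S. graph_dist G w x \<noteq> graph_dist G w y))
    \<longleftrightarrow> (\<forall>u v. valid u \<longrightarrow> valid v \<longrightarrow> idx u \<noteq> idx v \<longrightarrow> (\<exists>w\<in>S. graph_dist G (idx w) (idx u) \<noteq> graph_dist G (idx w) (idx v)))"
    by (auto simp: G_def)
  also have "\<dots> \<longleftrightarrow> (\<forall>u v. valid u \<longrightarrow> valid v \<longrightarrow> u \<noteq> v \<longrightarrow> (\<exists>w\<in>S. vdist w u \<noteq> vdist w v))"
    using assms inj_idx by (auto simp: graph_dist_G inj_on_def subset_iff) (metis enat.inject graph_dist_G)+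
  finally show ?thesis using assms by (auto simp: resolving_set_def resolving_def G_def)
qed

lemma resolving_set_iff:
  "(\<exists>S. resolving_set G S \<and> card S \<le> k) \<longleftrightarrow> (\<exists>S. resolving S \<and> card S \<le> k)"
proof
  assume "\<exists>S. resolving_set G S \<and> card S \<le> k"
  then obtain S where S: "resolving_set G S" "card S \<le> k" by blast
  then have "S \<subseteq> idx ` Collect valid" by (auto simp: resolving_set_def G_def)
  then obtain S' where S': "S' \<subseteq> Collect valid" "S = idx ` S'" by (auto simp: subset_image_iff)
  then have "card S' = card S" using inj_idx by (metis card_image inj_on_subset)
  with S S' resolving_set_image show "\<exists>S. resolving S \<and> card S \<le> k" by metis
next
  assume "\<exists>S. resolving S \<and> card S \<le> k"
  then obtain S where S: "resolving S" "card S \<le> k" by blast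
  then have "S \<subseteq> Collect valid" by (auto simp: resolving_def)
  moreover have "card (idx ` S) = card S"
    using inj_idx \<open>S \<subseteq> Collect valid\<close> by (metis card_image inj_on_subset)
  ultimately show "\<exists>S. resolving_set G S \<and> card S \<le> k" using S resolving_set_image by metis
qed

section \<open>Binary codes identify vertices up to twins\<close>

lemma binary_inj:
  assumes "binary off x = binary off y" "x < 2 ^ M" "y < 2 ^ M" shows "x = y"
proof (rule bit_eqI)
  fix j
  have "bit z j \<longleftrightarrow> off + j \<in> binary off z" if "z < 2 ^ M" for z
    using that bit_nat_def[of z j] by (auto simp: binary_def)
      (metis bit_take_bit_iff take_bit_nat_eq_self)
  with assms show "bit x j = bit y j" by blast
qed

lemma binary_nonempty:
  assumes "0 < x" "x < 2 ^ M" shows "binary off x \<noteq> {}"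
proof
  assume "binary off x = {}"
  then have "binary off x = binary off 0" by (simp add: binary_def)
  then have "x = 0" using assms by (intro binary_inj) auto
  with assms show False by simp
qed

lemma binary_bounds: "x \<in> binary off y \<Longrightarrow> off \<le> x \<and> x < off + M"
  by (auto simp: binary_def)

lemma code_bound: "valid u \<Longrightarrow> (\<And>j. u \<noteq> BitV j) \<Longrightarrow> code u \<subseteq> {..<m}"
  by (cases u) (auto simp: m_def dest: binary_bounds)

text \<open>The flag 0 or 1 tells \<open>AsgV\<close> from the rest, and the binary part then gives
  an index, namely that of the \<open>False\<close> twin for guards and clause vertices. The code of
  a \<open>Pendant\<close> is a singleton, whereas any other code has a flag and a nonempty binary
  part.\<close>

lemma code_eq_twins:
  assumes "valid u" "valid v" "code u = code v" "u \<noteq> v"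
    and "\<And>j. u \<noteq> BitV j" "\<And>j. v \<noteq> BitV j"
  shows "\<exists>i x. u = Pendant i x \<and> v = Pendant i (\<not> x) \<or> u = Guard i x \<and> v = Guard i (\<not> x)
    \<or> u = ClauseV i x \<and> v = ClauseV i (\<not> x)"
proof -
  define pend where "pend u = (\<exists>j x. u = Pendant j x)" for u
  define rep where "rep u = (case u of Guard b x \<Rightarrow> Guard b False | ClauseV c x \<Rightarrow> ClauseV c False | u \<Rightarrow> u)"
    for u
  define asg where "asg u = (\<exists>b a. u = AsgV b a)" for u
  have pendant: "code u = (if asg u then insert 1 (binary (2 + M) (idx (rep u)))
      else insert 0 (binary 2 (idx (rep u))))" if "\<not> pend u" "\<And>j. u \<noteq> BitV j" for u
    using that by (cases u) (auto simp: pend_def asg_def rep_def)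
  have valid_rep: "valid (rep u)" if "valid u" for u
    using that by (cases u) (auto simp: rep_def)
  have rep_less: "idx (rep u) < 2 ^ M" if "valid u" for u
    using idx_less[OF valid_rep[OF that]] p_less by simp
  \<comment> \<open>Index 0 belongs to \<open>BitV 0\<close>, so all other kinds have a positive
    index and hence a nonempty binary part.\<close>
  have rep_pos: "0 < idx (rep u)" if "valid u" "\<And>j. u \<noteq> BitV j" for u
    using that offsets by (cases u) (auto simp: rep_def)
  have two: False if u: "pend u" "\<not> pend v" "valid v" "code u = code v" "\<And>j. v \<noteq> BitV j" for u v
  proof -
    from u(1) obtain j where "code u = {j}" by (auto simp: pend_def)
    obtain n off where n: "code v = insert n (binary off (idx (rep v)))" "n < off"
      using pendant[OF u(2,5)] by (cases "asg v") auto
    obtain i where i: "i \<in> binary off (idx (rep v))"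
      using binary_nonempty[OF rep_pos[OF u(3,5)] rep_less[OF u(3)], of off] by blast
    with n(1) u(4) \<open>code u = {j}\<close> have "i = n" by auto
    with binary_bounds[OF i] n(2) show False by simp
  qed
  show ?thesis
  proof (cases "pend u \<or> pend v")
    case True
    with two[of u v] two[of v u] assms have "pend u" "pend v" by auto
    with assms(3,4) show ?thesis by (auto simp: pend_def)
  next
    case False
    have "asg u \<longleftrightarrow> 1 \<in> code u" if "\<not> pend u" "\<And>j. u \<noteq> BitV j" for u
      using pendant[OF that] by (auto dest: binary_bounds)
    then have "asg u = asg v" using False assms by blast
    moreover have "idx (rep u) = idx (rep v)"
    proof -
      \<comment> \<open>The flag lies below the offset, so deleting it leaves exactly the binary
        part.\<close>
      have *: "binary off x = insert o0 (binary off x) - {o0}" if "o0 < off" for off o0 x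
        using that by (auto dest: binary_bounds)
      show ?thesis
        using pendant[of u] pendant[of v] False assms \<open>asg u = asg v\<close>
          *[of 1 "2 + M" "idx (rep u)"] *[of 1 "2 + M" "idx (rep v)"]
          *[of 0 2 "idx (rep u)"] *[of 0 2 "idx (rep v)"]
        by (intro binary_inj[of "if asg u then 2 + M else 2"] rep_less) (auto split: if_splits)
    qed
    ultimately have "rep u = rep v"
      using inj_idx valid_rep assms by (auto simp: inj_on_def)
    with assms(4) show ?thesis by (auto simp: rep_def split: vtx.splits)
  qed
qed

lemma adj_Pendant: "adj (Pendant j x) y \<longleftrightarrow> y = BitV j"
  by (cases y) (auto simp: adj_def)

text \<open>A pendant sees the graph only through its clique vertex. In a resolving set it therefore
  reads one bit of the code of a vertex, as distance 2 or 3.\<close>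

lemma vdist_Pendant:
  assumes "j < m" "u \<noteq> Pendant j x"
  shows "vdist (Pendant j x) u = (if u = BitV j then 1 else if j \<in> code u then 2 else 3)"
proof -
  have "adj (BitV j) u \<longleftrightarrow> j \<in> code u" by (cases u) (auto simp: adj_def)
  moreover have "(\<exists>y. valid y \<and> adj (Pendant j x) y \<and> adj y u) \<longleftrightarrow> adj (BitV j) u"
    using assms(1) by (auto simp: adj_Pendant)
  ultimately show ?thesis using assms(2) by (simp add: vdist_def adj_Pendant)
qed

section \<open>Coordinates of a variable: class, bucket and position\<close>

lemma class_lt:
  assumes "l < 6 * d" shows "(l div 2) div d < 3"
  using assms by (simp add: less_mult_imp_div_less)

lemma block_lt: "(l div 2) mod d div s < s"
  using d_pos d_le by (metis less_le_trans less_mult_imp_div_less mod_less_divisor not_less_eq_eq One_nat_def not_gr_zero)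

lemma combine_lt:
  fixes a b :: nat assumes "a < 3" "b < s" shows "a * s + b < 3 * s"
proof -
  have "a * s + b < Suc a * s" using assms by simp
  also have "\<dots> \<le> 3 * s" using assms by (intro mult_right_mono) auto
  finally show ?thesis .
qed

lemma bucket_lt: "l < 6 * d \<Longrightarrow> bucket l < 3 * s"
  unfolding bucket_def by (intro combine_lt class_lt block_lt)

lemma pos_lt: "l < 6 * d \<Longrightarrow> pos l < 3 * s"
  unfolding pos_def using s_pos by (intro combine_lt class_lt) auto

lemma bucket_div: "bucket l div s = (l div 2) div d" "bucket l mod s = (l div 2) mod d div s"
  using s_pos block_lt[of l] by (auto simp: bucket_def)

lemma pos_div: "pos l div s = (l div 2) div d" "pos l mod s = (l div 2) mod d mod s"
  using s_pos by (auto simp: pos_def)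

text \<open>A mixed-radix expansion with digits class, block and place in the block. It locates the
  variable behind each bit of a bucket assignment.\<close>

lemma variable_eq: "l div 2 = (bucket l div s) * d + ((bucket l mod s) * s + pos l mod s)"
  by (simp add: bucket_div pos_div)

lemma exists_bits: "\<exists>a < 2 ^ s. \<forall>i<s. bit (a::nat) i = f i"
  by (rule exI[of _ "horner_sum of_bool 2 (map f [0..<s])"])
     (use horner_sum_of_bool_2_less[of "map f [0..<s]"] in \<open>auto simp: bit_horner_sum_bit_iff\<close>)

section \<open>Resolving sets and satisfying assignments\<close>

definition codes_satisfiable where
  "codes_satisfiable \<longleftrightarrow> (\<exists>\<tau>. \<forall>c\<in>set cs. \<exists>l\<in>set c. \<tau> (l div 2) = even l)"

text \<open>The only bucket neighbour of \<open>AsgV b a\<close> is \<open>BucketV b\<close>, which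
  \<open>Guard b True\<close> misses. Nothing else is common: guards have no \<open>LitV\<close>
  neighbours, and the two codes differ in flag and in block of bits.\<close>

lemma vdist_Guard_AsgV:
  assumes "b < 3 * s"
  shows "vdist (AsgV b a) (Guard b False) = 2" "vdist (AsgV b a) (Guard b True) = 3"
proof -
  have "valid (BucketV b)" "adj (AsgV b a) (BucketV b)" "adj (BucketV b) (Guard b False)"
    using assms by (auto simp: adj_def)
  then have "\<exists>y. valid y \<and> adj (AsgV b a) y \<and> adj y (Guard b False)" by blast
  moreover have "\<not> adj (AsgV b a) (Guard b False)" by (simp add: adj_def)
  ultimately show "vdist (AsgV b a) (Guard b False) = 2" by (simp add: vdist_def)
  have "\<not> (adj (AsgV b a) y \<and> adj y (Guard b True))" for y
    by (cases y) (auto simp: adj_def dest!: binary_bounds)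
  then show "vdist (AsgV b a) (Guard b True) = 3"
    by (auto simp: vdist_def adj_def)
qed

text \<open>A satisfied literal supplies a common \<open>LitV\<close> neighbour on the
  \<open>False\<close> side. The \<open>True\<close> side has no \<open>LitV\<close> neighbours at
  all, and \<open>BucketV (bucket l)\<close> is missing on both sides.\<close>

lemma vdist_ClauseV_AsgV:
  assumes c: "c < K" "l \<in> set (cs ! c)" and bit: "bit a (pos l mod s) = even l"
  shows "vdist (AsgV (bucket l) a) (ClauseV c False) = 2"
    "vdist (AsgV (bucket l) a) (ClauseV c True) = 3"
proof -
  have l: "l < 6 * d" using lits_lt[of "cs ! c" l] c by simp
  have "valid (LitV (pos l) (odd l))" "adj (AsgV (bucket l) a) (LitV (pos l) (odd l))"
    "adj (LitV (pos l) (odd l)) (ClauseV c False)"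
    using pos_lt[OF l] bit c by (auto simp: adj_def bucket_div pos_div)
  then have "\<exists>y. valid y \<and> adj (AsgV (bucket l) a) y \<and> adj y (ClauseV c False)" by blast
  moreover have "\<not> adj (AsgV (bucket l) a) (ClauseV c False)" by (simp add: adj_def)
  ultimately show "vdist (AsgV (bucket l) a) (ClauseV c False) = 2" by (simp add: vdist_def)
  have "\<not> (adj (AsgV (bucket l) a) y \<and> adj y (ClauseV c True))" for y
    using c by (cases y) (auto simp: adj_def dest!: binary_bounds)
  then show "vdist (AsgV (bucket l) a) (ClauseV c True) = 3"
    by (auto simp: vdist_def adj_def)
qed

lemma resolving_if_satisfiable:
  assumes codes_satisfiable shows "\<exists>S. resolving S \<and> card S \<le> m + 3 * s"
proof -
  from assms obtain \<tau> where \<tau>: "\<And>c. c \<in> set cs \<Longrightarrow> \<exists>l\<in>set c. \<tau> (l div 2) = even l"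
    by (auto simp: codes_satisfiable_def)
  \<comment> \<open>By \<open>variable_eq\<close>, this argument of \<open>\<tau>\<close> is the
    variable in bucket \<open>b\<close> at place \<open>i\<close>.\<close>
  have "\<forall>b. \<exists>a < 2 ^ s. \<forall>i<s. bit (a::nat) i = \<tau> ((b div s) * d + ((b mod s) * s + i))"
    by (intro allI exists_bits)
  then obtain asg :: "nat \<Rightarrow> nat" where asg: "\<And>b. asg b < 2 ^ s"
    "\<And>b i. i < s \<Longrightarrow> bit (asg b) i = \<tau> ((b div s) * d + ((b mod s) * s + i))" by metis
  define S where "S = (\<lambda>j. Pendant j False) ` {..<m} \<union> (\<lambda>b. AsgV b (asg b)) ` {..<3 * s}"
  have "card S \<le> m + 3 * s"
    unfolding S_def by (rule order_trans[OF card_Un_le add_mono]) (use card_image_le in fastforce)+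
  moreover have "resolving S"
    unfolding resolving_def
  proof (intro conjI allI impI)
    show "S \<subseteq> Collect valid" using asg(1) by (auto simp: S_def)
    fix u v assume uv: "valid u" "valid v" "u \<noteq> v"
    show "\<exists>w\<in>S. vdist w u \<noteq> vdist w v"
    proof (rule ccontr)
      assume "\<not> ?thesis"
      then have same: "vdist w u = vdist w v" if "w \<in> S" for w using that by blast
      \<comment> \<open>A chosen vertex is the only one at distance 0 from itself.\<close>
      have "u \<notin> S" "v \<notin> S" using same[of u] same[of v] uv by (auto simp: vdist_def split: if_splits)
      then have bits: "u = BitV j \<longleftrightarrow> v = BitV j" "u \<noteq> BitV j \<Longrightarrow> j \<in> code u \<longleftrightarrow> j \<in> code v" if "j < m" for j
      proof -
        have "Pendant j False \<in> S" using that by (simp add: S_def)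
        then have "u \<noteq> Pendant j False" "v \<noteq> Pendant j False"
          "vdist (Pendant j False) u = vdist (Pendant j False) v"
          using same \<open>u \<notin> S\<close> \<open>v \<notin> S\<close> by blast+
        then show "u = BitV j \<longleftrightarrow> v = BitV j" "u \<noteq> BitV j \<Longrightarrow> j \<in> code u \<longleftrightarrow> j \<in> code v"
          using that by (auto simp: vdist_Pendant split: if_splits)
      qed
      have nu: "u \<noteq> BitV j" for j using bits(1)[of j] uv by auto
      have nv: "v \<noteq> BitV j" for j using bits(1)[of j] uv by auto
      have "code u = code v" using bits(2) code_bound uv nu nv by blast
      from code_eq_twins[OF uv(1,2) this uv(3) nu nv] obtain i x where
        "u = Pendant i x \<and> v = Pendant i (\<not> x) \<or> u = Guard i x \<and> v = Guard i (\<not> x)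
          \<or> u = ClauseV i x \<and> v = ClauseV i (\<not> x)" by blast
      then consider "Pendant i False \<in> {u, v}" | "{u, v} = {Guard i False, Guard i True}"
        | "{u, v} = {ClauseV i False, ClauseV i True}" by (cases x) auto
      then show False
      proof cases
        case 1
        with \<open>u \<notin> S\<close> \<open>v \<notin> S\<close> uv show False by (auto simp: S_def)
      next
        case 2
        with uv have "i < 3 * s" by (auto simp: doubleton_eq_iff)
        then have "AsgV i (asg i) \<in> S" by (simp add: S_def)
        from same[OF this] 2 vdist_Guard_AsgV[OF \<open>i < 3 * s\<close>, of "asg i"]
        show False by (auto simp: doubleton_eq_iff)
      next
        case 3
        with uv have i: "i < K" by (auto simp: doubleton_eq_iff)
        with \<tau>[of "cs ! i"] obtain l where l: "l \<in> set (cs ! i)" "\<tau> (l div 2) = even l" by auto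
        have "AsgV (bucket l) (asg (bucket l)) \<in> S"
          using bucket_lt[OF lits_lt[of "cs ! i" l]] i l(1) by (simp add: S_def)
        note same[OF this]
        moreover have "bit (asg (bucket l)) (pos l mod s) = even l"
          using asg(2)[of "pos l mod s" "bucket l"] variable_eq[of l] l(2) s_pos by simp
        ultimately show False
          using 3 vdist_ClauseV_AsgV[OF i l(1), of "asg (bucket l)"] by (auto simp: doubleton_eq_iff)
      qed
    qed
  qed
  ultimately show ?thesis by blast
qed

text \<open>The budget leaves exactly one vertex for each pendant pair and each bucket. Only
  \<open>AsgV\<close> vertices among those allowed can separate a clause pair, and as a bucket
  contains at most one of them, they define an assignment without conflicts.\<close>

lemma satisfiable_if_resolving:
  assumes "resolving S" "card S \<le> m + 3 * s" shows codes_satisfiable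
proof -
  define J :: "(nat + nat) set" where "J = Inl ` {..<m} \<union> Inr ` {..<3 * s}"
  define R :: "nat + nat \<Rightarrow> vtx set" where
    "R j = (case j of Inl j \<Rightarrow> {Pendant j False, Pendant j True}
      | Inr b \<Rightarrow> {Guard b False, Guard b True, BucketV b} \<union> range (AsgV b))" for j
  have valid_S: "valid w" if "w \<in> S" for w using that assms(1) by (auto simp: resolving_def)
  have res: "\<exists>w\<in>S. vdist w u \<noteq> vdist w v" if "valid u" "valid v" "u \<noteq> v" for u v
    using that assms(1) by (auto simp: resolving_def)
  have fin: "finite S" using assms(1) finite_valid by (auto simp: resolving_def dest: finite_subset)
  have "card J = card (Inl ` {..<m} :: (nat + nat) set) + card (Inr ` {..<3 * s} :: (nat + nat) set)"
    unfolding J_def by (rule card_Un_disjoint) auto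
  then have cardJ: "card S \<le> card J" "finite J"
    using assms(2) by (auto simp: J_def card_image)
  have disj: "R i \<inter> R j = {}" if "i \<in> J" "j \<in> J" "i \<noteq> j" for i j
    using that by (auto simp: R_def split: sum.splits)
  have hit: "S \<inter> R j \<noteq> {}" if "j \<in> J" for j
  proof (cases j)
    case (Inl i)
    with that have i: "i < m" by (auto simp: J_def)
    with res[of "Pendant i False" "Pendant i True"] obtain w where
      w: "w \<in> S" "vdist w (Pendant i False) \<noteq> vdist w (Pendant i True)" by auto
    have "adj y (Pendant i x) \<longleftrightarrow> y = BitV i" for y x using adj_Pendant adj_sym by metis
    with w(2) have "w \<in> R j" by (auto simp: vdist_def R_def Inl split: if_splits)
    with w show ?thesis by blast
  next
    case (Inr b)
    with that have b: "b < 3 * s" by (auto simp: J_def)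
    with res[of "Guard b False" "Guard b True"] obtain w where
      w: "w \<in> S" "vdist w (Guard b False) \<noteq> vdist w (Guard b True)" by auto
    have "w \<in> R j"
    proof (rule ccontr)
      assume nw: "w \<notin> R j"
      have adj_eq: "adj y (Guard b False) = adj y (Guard b True)" if "y \<noteq> BucketV b" for y
        using that by (cases y) (auto simp: adj_def)
      have le: "adj y (Guard b True) \<Longrightarrow> adj y (Guard b False)" for y
        by (cases y) (auto simp: adj_def)
      \<comment> \<open>\<open>BucketV b\<close> is the only vertex adjacent to just one of the two
        guards. A path through it gives \<open>w\<close> no advantage: outside \<open>R j\<close>, a
        neighbour of \<open>BucketV b\<close> that is not adjacent to \<open>Guard b True\<close>
        reaches it through \<open>BitV 0\<close>.\<close>
      have "\<exists>y. valid y \<and> adj w y \<and> adj y (Guard b True)"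
        if "adj w (BucketV b)" "\<not> adj w (Guard b True)"
      proof -
        have "adj w (BitV 0)" using that nw by (cases w) (auto simp: adj_def R_def Inr)
        then show ?thesis by (intro exI[of _ "BitV 0"]) (auto simp: adj_def m_def)
      qed
      then have "(\<exists>y. valid y \<and> adj w y \<and> adj y (Guard b True)) =
          (\<exists>y. valid y \<and> adj w y \<and> adj y (Guard b False))"  if "\<not> adj w (Guard b True)"
        using that adj_eq le by metis
      moreover have "w \<noteq> BucketV b" "w \<noteq> Guard b False" "w \<noteq> Guard b True"
        using nw by (auto simp: R_def Inr)
      ultimately show False using w(2) adj_eq[of w] by (auto simp: vdist_def)
    qed
    with w show ?thesis by blast
  qed
  have sub: "S \<subseteq> \<Union> (R ` J)"
    by (rule hitting_set_exact(1)[OF cardJ(2) fin cardJ(1) disj hit])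
  have uniq: "a = a'" if "j \<in> J" "a \<in> S \<inter> R j" "a' \<in> S \<inter> R j" for j a a'
    by (rule hitting_set_exact(2)[where R = R, OF cardJ(2) fin cardJ(1) disj hit that])
  \<comment> \<open>\<open>2 * v\<close> is the code of the positive literal of \<open>v\<close>;
    bucket and position do not depend on the sign.\<close>
  define \<tau> where "\<tau> v = (\<exists>a. AsgV (bucket (2 * v)) a \<in> S \<and> bit a (pos (2 * v) mod s))" for v
  have "\<exists>l\<in>set (cs ! c). \<tau> (l div 2) = even l" if c: "c < K" for c
  proof -
    from c res[of "ClauseV c False" "ClauseV c True"] obtain w where
      w: "w \<in> S" "vdist w (ClauseV c False) \<noteq> vdist w (ClauseV c True)" by auto
    from w(1) sub obtain j where j: "j \<in> J" "w \<in> R j" by blast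
    have le: "adj y (ClauseV c True) \<Longrightarrow> adj y (ClauseV c False)" for y
      by (cases y) (auto simp: adj_def)
    \<comment> \<open>Only \<open>LitV\<close> vertices are adjacent to just one vertex of a clause
      pair, and they lie in no \<open>R j\<close>.\<close>
    have adj_eq: "adj w (ClauseV c False) = adj w (ClauseV c True)"
      using j by (auto simp: R_def adj_def split: sum.splits)
    have neq: "w \<noteq> ClauseV c x" for x using j by (auto simp: R_def split: sum.splits)
    \<comment> \<open>Neighbours of the \<open>True\<close> vertex are neighbours of the
      \<open>False\<close> one, so separation means distance 2 to the latter and 3 to the
      former.\<close>
    obtain y where y: "valid y" "adj w y" "adj y (ClauseV c False)"
      and no: "\<And>y. valid y \<Longrightarrow> adj w y \<Longrightarrow> \<not> adj y (ClauseV c True)"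
      using w(2) adj_eq neq le by (auto simp: vdist_def split: if_splits)
    have "\<not> adj y (ClauseV c True)" using no y by blast
    with y(3) obtain h z where yh: "y = LitV h z"
      by (cases y) (auto simp: adj_def)
    with y(3) obtain l where l: "l \<in> set (cs ! c)" "h = pos l" "z = odd l" by (auto simp: adj_def)
    \<comment> \<open>This discards guards and buckets; pendants drop out because they have no
      \<open>LitV\<close> neighbour.\<close>
    have "\<not> adj w (BitV 0)" using no[of "BitV 0"] by (auto simp: adj_def m_def)
    then obtain b a where wb: "w = AsgV b a" "j = Inr b"
      using j(2) y(2)[unfolded yh] by (cases j; cases w) (auto simp add: R_def adj_def)
    with j have b: "b < 3 * s" by (auto simp: J_def)
    have "b \<in> bucket ` set (cs ! c)"
      using no[of "BucketV b"] b wb by (auto simp: adj_def)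
    then obtain l' where l': "l' \<in> set (cs ! c)" "b = bucket l'" by blast
    have ab: "pos l div s = b div s" "odd l = (\<not> bit a (pos l mod s))"
      using y(2) by (auto simp: wb yh l adj_def)
    \<comment> \<open>Here sharing positions among buckets could do harm: \<open>l\<close> is only
      known to be in the class of \<open>b\<close>. As the clause has a single variable in that
      class, \<open>l\<close> lies in bucket \<open>b\<close> itself.\<close>
    then have "l' div 2 = l div 2"
      using class_unique[of "cs ! c" l' l] c l l' by (simp add: pos_div bucket_div)
    then have bl: "bucket (2 * (l div 2)) = b" and pl: "pos (2 * (l div 2)) = pos l"
      using l'(2) by (simp_all add: bucket_def pos_def)
    have only: "a' = a" if "AsgV b a' \<in> S" for a'
    proof -
      have "AsgV b a' \<in> S \<inter> R j" "AsgV b a \<in> S \<inter> R j"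
        using that w(1) unfolding wb by (simp_all add: R_def)
      from uniq[OF j(1) this] show ?thesis by simp
    qed
    have "\<tau> (l div 2) \<longleftrightarrow> (\<exists>a'. AsgV b a' \<in> S \<and> bit a' (pos l mod s))"
      unfolding \<tau>_def bl pl ..
    also have "\<dots> \<longleftrightarrow> bit a (pos l mod s)"
      using only w(1) unfolding wb by blast
    finally have "\<tau> (l div 2) = even l" using ab(2) by blast
    with l show ?thesis by blast
  qed
  then show ?thesis unfolding codes_satisfiable_def by (metis in_set_conv_nth)
qed

theorem resolving_iff_satisfiable:
  "(\<exists>S. resolving_set G S \<and> card S \<le> m + 3 * s) \<longleftrightarrow> codes_satisfiable"
  unfolding resolving_set_iff using resolving_if_satisfiable satisfiable_if_resolving by blast

lemma vc_bound: "vc G \<le> m + 9 * s"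
proof -
  define Y where "Y = BitV ` {..<m} \<union> (\<lambda>(h, x). LitV h x) ` ({..<3 * s} \<times> UNIV) \<union> BucketV ` {..<3 * s}"
  have Y: "Y \<subseteq> Collect valid" by (auto simp: Y_def)
  have nadj: "\<not> adj u v" if "valid u" "valid v" "u \<notin> Y" "v \<notin> Y" for u v
    using that by (cases u; cases v) (auto simp: Y_def adj_def)
  have "independent_set G (verts G - idx ` Y)"
    unfolding independent_set_def
  proof (intro conjI ballI)
    fix x y assume "x \<in> verts G - idx ` Y" "y \<in> verts G - idx ` Y"
    then obtain u v where "x = idx u" "y = idx v" "valid u" "valid v" "u \<notin> Y" "v \<notin> Y"
      by (auto simp: G_def)
    then show "{x, y} \<notin> edges G" using nadj by (simp add: edge_iff)
  qed auto
  then have "vertex_cover G (idx ` Y)" using Y by (auto simp: vertex_cover_def G_def)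
  then have "vc G \<le> card (idx ` Y)" unfolding vc_def by (intro Least_le) blast
  also have "\<dots> \<le> card Y" by (intro card_image_le) (simp add: Y_def)
  also have "\<dots> \<le> m + 3 * s * 2 + 3 * s"
  proof -
    have "card (BitV ` {..<m}) \<le> m" "card (BucketV ` {..<3 * s}) \<le> 3 * s"
      using card_image_le[of "{..<m}" BitV] card_image_le[of "{..<3 * s}" BucketV] by auto
    moreover have "card ((\<lambda>(h, x). LitV h x) ` ({..<3 * s} \<times> UNIV)) \<le> 3 * s * 2"
      using card_image_le[of "{..<3 * s} \<times> (UNIV :: bool set)" "\<lambda>(h, x). LitV h x"]
      by (simp add: card_cartesian_product)
    ultimately show ?thesis unfolding Y_def by (intro order_trans[OF card_Un_le] add_mono)
  qed
  finally show ?thesis by simp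
qed

end

section \<open>Running times\<close>

text \<open>
  \<open>tm V c\<close> bounds the running time of \<open>c\<close> when every execution of a loop makes at most \<open>V\<close>
  iterations. As it is polynomial in \<open>V\<close>, a bound \<open>V = 2 powr O(sqrt N)\<close> suffices.
\<close>

primrec tm :: "nat \<Rightarrow> com \<Rightarrow> nat" where
  "tm V SKIP = 1"
| "tm V (Assign r e) = exp_cost e + 1"
| "tm V (Store a i e) = exp_cost i + exp_cost e + 1"
| "tm V (Seq c1 c2) = tm V c1 + tm V c2"
| "tm V (IfNZ b c1 c2) = exp_cost b + 1 + tm V c1 + tm V c2"
| "tm V (WhileNZ b c) = Suc V * (exp_cost b + 1 + tm V c)"

text \<open>The base \<open>V + 2\<close> is at least 2, so constants and sums can be absorbed by
  raising the exponent. The exponent depends on the program alone.\<close>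

lemma tm_polynomial: "\<exists>k. \<forall>V. tm V c \<le> (V + 2) ^ k"
proof -
  have const: "\<exists>k. \<forall>V. n \<le> (V + 2) ^ k" for n :: nat
  proof (intro exI[of _ n] allI)
    fix V :: nat
    have "n \<le> 2 ^ n" by (rule less_imp_le[OF less_exp])
    also have "\<dots> \<le> (V + 2) ^ n" by (rule power_mono) auto
    finally show "n \<le> (V + 2) ^ n" .
  qed
  have add: "\<exists>k. \<forall>V. f V + g V \<le> (V + 2) ^ k"
    if "\<exists>k. \<forall>V. f V \<le> (V + 2) ^ k" "\<exists>k. \<forall>V. g V \<le> (V + 2) ^ k" for f g :: "nat \<Rightarrow> nat"
  proof -
    from that obtain k l where kl: "\<And>V. f V \<le> (V + 2) ^ k" "\<And>V. g V \<le> (V + 2) ^ l" by blast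
    have "f V + g V \<le> (V + 2) ^ (max k l + 1)" for V
    proof -
      have "f V + g V \<le> (V + 2) ^ max k l + (V + 2) ^ max k l"
        using kl[of V] power_increasing[of k "max k l" "V + 2"] power_increasing[of l "max k l" "V + 2"]
        by linarith
      also have "\<dots> \<le> (V + 2) * (V + 2) ^ max k l" by simp
      finally show ?thesis by simp
    qed
    then show ?thesis by blast
  qed
  show ?thesis
  proof (induction c)
    case (WhileNZ b c)
    obtain k where k: "\<And>V. exp_cost b + 1 + tm V c \<le> (V + 2) ^ k"
      using add[OF const[of "exp_cost b + 1"] WhileNZ.IH] by blast
    have "tm V (WhileNZ b c) \<le> (V + 2) ^ Suc k" for V
      using mult_mono[of "Suc V" "V + 2" _ "(V + 2) ^ k", OF _ k[of V]] by simp
    then show ?case by blast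
  next
    case (IfNZ b c1 c2)
    show ?case using add[OF add[OF const[of "exp_cost b + 1"] IfNZ.IH(1)] IfNZ.IH(2)] by simp
  next
    case (Seq c1 c2)
    show ?case using add[OF Seq.IH] by simp
  next
    case SKIP
    show ?case using const[of 1] by simp
  next
    case (Assign r e)
    show ?case using const[of "exp_cost e + 1"] by simp
  next
    case (Store a i e)
    show ?case using const[of "exp_cost i + exp_cost e + 1"] by simp
  qed
qed

section \<open>A program logic for total correctness with time bounds\<close>

text \<open>The time bound \<open>tm V c\<close> is built in, so that the rules below need not
  mention time.\<close>

definition wp :: "nat \<Rightarrow> com \<Rightarrow> (state \<Rightarrow> bool) \<Rightarrow> state \<Rightarrow> bool" where
  "wp V c Q s \<longleftrightarrow> (\<exists>t s'. exec c s t s' \<and> t \<le> tm V c \<and> Q s')"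

lemma wp_SKIP: "Q s \<Longrightarrow> wp V SKIP Q s"
  unfolding wp_def using exec.Skip by fastforce

lemma wp_Assign: "Q (set_reg r (eval_exp e s) s) \<Longrightarrow> wp V (Assign r e) Q s"
  unfolding wp_def using exec.Assign by fastforce

lemma wp_Assign_eq: "eval_exp e s = x \<Longrightarrow> Q (set_reg r x s) \<Longrightarrow> wp V (Assign r e) Q s"
  by (auto intro: wp_Assign)

lemma wp_Store: "Q (set_cell a (eval_exp i s) (eval_exp e s) s) \<Longrightarrow> wp V (Store a i e) Q s"
  unfolding wp_def using exec.Store by fastforce

lemma wp_Seq: "wp V c1 (wp V c2 Q) s \<Longrightarrow> wp V (Seq c1 c2) Q s"
  unfolding wp_def by (fastforce intro: exec.Seq)

lemma wp_IfNZ: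
  assumes "eval_exp b s \<noteq> 0 \<Longrightarrow> wp V c1 Q s" "eval_exp b s = 0 \<Longrightarrow> wp V c2 Q s"
  shows "wp V (IfNZ b c1 c2) Q s"
proof (cases "eval_exp b s = 0")
  case True
  with assms(2) obtain t s' where "exec c2 s t s'" "t \<le> tm V c2" "Q s'" by (auto simp: wp_def)
  then show ?thesis unfolding wp_def using exec.IfFalse[OF True] by fastforce
next
  case False
  with assms(1) obtain t s' where "exec c1 s t s'" "t \<le> tm V c1" "Q s'" by (auto simp: wp_def)
  then show ?thesis unfolding wp_def using exec.IfTrue[OF False] by fastforce
qed

lemma wp_mono: "wp V c Q s \<Longrightarrow> (\<And>s'. Q s' \<Longrightarrow> Q' s') \<Longrightarrow> wp V c Q' s"
  unfolding wp_def by blast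

text \<open>The variant \<open>f\<close> bounds the number of rounds; the \<open>Suc\<close> in
  \<open>tm\<close> pays for the final test, which fails.\<close>

lemma wp_WhileNZ:
  assumes I: "I s" and f: "f s \<le> V"
    and step: "\<And>s. I s \<Longrightarrow> eval_exp b s \<noteq> 0 \<Longrightarrow> wp V c (\<lambda>s'. I s' \<and> f s' < f s) s"
    and fin: "\<And>s. I s \<Longrightarrow> eval_exp b s = 0 \<Longrightarrow> Q s"
  shows "wp V (WhileNZ b c) Q s"
proof -
  have "\<exists>t s'. exec (WhileNZ b c) s t s' \<and> t \<le> Suc (f s) * (exp_cost b + 1 + tm V c) \<and> Q s'"
    using I
  proof (induction "f s" arbitrary: s rule: less_induct)
    case (less s)
    show ?case
    proof (cases "eval_exp b s = 0")
      case True
      have "exp_cost b + 1 \<le> Suc (f s) * (exp_cost b + 1 + tm V c)" by simp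
      then show ?thesis using exec.WhileFalse[OF True] fin[OF less.prems True] by blast
    next
      case False
      from step[OF less.prems False] obtain t s' where s': "exec c s t s'" "t \<le> tm V c" "I s'" "f s' < f s"
        by (auto simp: wp_def)
      from less.hyps[OF s'(4,3)] obtain t' s'' where
        s'': "exec (WhileNZ b c) s' t' s''" "t' \<le> Suc (f s') * (exp_cost b + 1 + tm V c)" "Q s''" by blast
      have "Suc (f s') * (exp_cost b + 1 + tm V c) \<le> f s * (exp_cost b + 1 + tm V c)"
        using s'(4) by (intro mult_right_mono) auto
      then have "exp_cost b + 1 + t + t' \<le> Suc (f s) * (exp_cost b + 1 + tm V c)"
        using s'(2) s''(2) by simp
      then show ?thesis using exec.WhileTrue[OF False s'(1) s''(1)] s''(3) by blast
    qed
  qed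
  moreover have "Suc (f s) * (exp_cost b + 1 + tm V c) \<le> tm V (WhileNZ b c)"
    unfolding tm.simps using f by (intro mult_right_mono) auto
  ultimately show ?thesis unfolding wp_def by (meson order_trans)
qed

text \<open>Truncated subtraction turns the test into the comparison of register \<open>r\<close>
  with \<open>e\<close>. As \<open>e\<close> is evaluated afresh in each round, its value has to be
  kept by the body.\<close>

definition FOR :: "nat \<Rightarrow> exp \<Rightarrow> com \<Rightarrow> com" where
  "FOR r e c = Seq (Assign r (Const 0))
     (WhileNZ (Sub e (Reg r)) (Seq c (Assign r (Add (Reg r) (Const 1)))))"

lemma wp_FOR:
  assumes n: "n \<le> V" and I0: "I 0 (set_reg r 0 s)"
    and e: "\<And>i s'. i \<le> n \<Longrightarrow> I i s' \<Longrightarrow> regs s' r = i \<Longrightarrow> eval_exp e s' = n"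
    and step: "\<And>i s'. i < n \<Longrightarrow> I i s' \<Longrightarrow> regs s' r = i \<Longrightarrow>
      wp V c (\<lambda>s''. regs s'' r = i \<and> I (Suc i) (set_reg r (Suc i) s'')) s'"
    and fin: "\<And>s'. I n s' \<Longrightarrow> regs s' r = n \<Longrightarrow> Q s'"
  shows "wp V (FOR r e c) Q s"
  unfolding FOR_def
proof (intro wp_Seq wp_Assign)
  let ?I = "\<lambda>s'. I (regs s' r) s' \<and> regs s' r \<le> n"
  show "wp V (WhileNZ (Sub e (Reg r)) (Seq c (Assign r (Add (Reg r) (Const 1))))) Q
      (set_reg r (eval_exp (Const 0) s) s)"
  proof (rule wp_WhileNZ[where I = ?I and f = "\<lambda>s'. n - regs s' r"])
    show "?I (set_reg r (eval_exp (Const 0) s) s)" using I0 by (simp add: set_reg_def)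
    show "n - regs (set_reg r (eval_exp (Const 0) s) s) r \<le> V" using n by (simp add: set_reg_def)
  next
    fix s' assume s': "?I s'" "eval_exp (Sub e (Reg r)) s' \<noteq> 0"
    then have lt: "regs s' r < n" using e[of "regs s' r" s'] by simp
    show "wp V (Seq c (Assign r (Add (Reg r) (Const 1)))) (\<lambda>s''. ?I s'' \<and> n - regs s'' r < n - regs s' r) s'"
      by (intro wp_Seq wp_mono[OF step[OF lt]] wp_Assign) (use s' lt in \<open>auto simp: set_reg_def\<close>)
  next
    fix s' assume s': "?I s'" "eval_exp (Sub e (Reg r)) s' = 0"
    then have "regs s' r = n" using e[of "regs s' r" s'] by simp
    with s' fin[of s'] show "Q s'" by simp
  qed
qed

section \<open>Frame conditions\<close>

primrec modr :: "com \<Rightarrow> nat set" where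
  "modr SKIP = {}"
| "modr (Assign r e) = {r}"
| "modr (Store a i e) = {}"
| "modr (Seq c1 c2) = modr c1 \<union> modr c2"
| "modr (IfNZ b c1 c2) = modr c1 \<union> modr c2"
| "modr (WhileNZ b c) = modr c"

lemma modr_FOR: "modr (FOR r e c) = insert r (modr c)"
  by (simp add: FOR_def)

lemma exec_modr: "exec c s t s' \<Longrightarrow> r \<notin> modr c \<Longrightarrow> regs s' r = regs s r"
  by (induction rule: exec.induct) (auto simp: set_reg_def set_cell_def)

lemma wp_modr: "wp V c Q s \<Longrightarrow> wp V c (\<lambda>s'. Q s' \<and> (\<forall>r. r \<notin> modr c \<longrightarrow> regs s' r = regs s r)) s"
  unfolding wp_def using exec_modr by blast

primrec reads :: "exp \<Rightarrow> nat set" where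
  "reads (Const n) = {}"
| "reads (Reg r) = {}"
| "reads (Cell a e) = insert a (reads e)"
| "reads (Add e1 e2) = reads e1 \<union> reads e2"
| "reads (Sub e1 e2) = reads e1 \<union> reads e2"

lemma eval_set_cell: "a \<notin> reads e \<Longrightarrow> eval_exp e (set_cell a i x s) = eval_exp e s"
  by (induction e) (auto simp: set_cell_def)

lemma regs_set_reg [simp]: "regs (set_reg r x s) r' = (if r' = r then x else regs s r')"
  by (simp add: set_reg_def)

lemma arrays_set_reg [simp]: "arrays (set_reg r x s) = arrays s"
  by (simp add: set_reg_def)

lemma regs_set_cell [simp]: "regs (set_cell a i x s) = regs s"
  by (simp add: set_cell_def)

lemma arrays_set_cell [simp]:
  "arrays (set_cell a i x s) a' = (if a' = a then (arrays s a)(i := x) else arrays s a')"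
  by (simp add: set_cell_def)

section \<open>The program\<close>

text \<open>
  Registers 2 to 19 hold, in this order, \<open>n\<close>, the number \<open>K\<close> of clauses, the bucket size \<open>s\<close>, \<open>s * s\<close>,
  \<open>2 ^ s\<close>, \<open>M\<close>, \<open>m\<close>, \<open>oP\<close>, \<open>oC\<close>, \<open>oL\<close>, \<open>oB\<close>, \<open>oA\<close>, \<open>p\<close>, \<open>p + 6 * d\<close>, \<open>3 * s\<close>, \<open>d\<close>, \<open>3 * s + K\<close>
  and \<open>9 * s\<close>; from 20 on they are scratch. Array 2 holds the first \<open>AsgV\<close> vertex of each bucket, array 3
  the positions of the rows of the matrix, array 4 the multiples of \<open>s\<close>, and arrays 5 to 10 are
  tables of \<open>div\<close> and \<open>mod\<close> for the divisors 2, \<open>s\<close> and \<open>d\<close>, as the machine cannot divide.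
\<close>

definition EDGE :: "exp \<Rightarrow> exp \<Rightarrow> com" where
  "EDGE e1 e2 = Seq (Store 1 (Add (Cell 3 e1) e2) (Const 1)) (Store 1 (Add (Cell 3 e2) e1) (Const 1))"

lemma modr_EDGE: "modr (EDGE e1 e2) = {}"
  by (simp add: EDGE_def)

text \<open>\<open>\<rho>\<close> and \<open>\<alpha>\<close> are the contents of the registers
  below 20 and of the arrays other than 1, frozen while the edges are written. Only the matrix and
  the scratch registers change in this phase.\<close>

locale edge_phase = reduction +
  fixes V :: nat and \<rho> :: "nat \<Rightarrow> nat" and \<alpha> :: "nat \<Rightarrow> nat \<Rightarrow> nat"
  assumes V: "p \<le> V" and len_le: "\<And>c. c \<in> set cs \<Longrightarrow> length c \<le> V"
    and \<rho>: "\<rho> 3 = length cs" "\<rho> 4 = s" "\<rho> 6 = 2 ^ s" "\<rho> 7 = M" "\<rho> 8 = m" "\<rho> 9 = oP" "\<rho> 10 = oC"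
      "\<rho> 11 = oL" "\<rho> 12 = oB" "\<rho> 13 = oA" "\<rho> 14 = p" "\<rho> 16 = 3 * s" "\<rho> 18 = 3 * s + length cs"
      "\<rho> 19 = 9 * s"
    and asg_row: "\<And>b. b \<le> 3 * s \<Longrightarrow> \<alpha> 2 b = oA + b * 2 ^ s"
    and row: "\<And>i. i \<le> p \<Longrightarrow> \<alpha> 3 i = 2 + i * p"
    and tables: "\<And>i. i \<le> p + 6 * d \<Longrightarrow> \<alpha> 4 i = i * s \<and> \<alpha> 5 i = i div 2 \<and> \<alpha> 6 i = i mod 2
      \<and> \<alpha> 7 i = i div s \<and> \<alpha> 8 i = i mod s \<and> \<alpha> 9 i = i div d \<and> \<alpha> 10 i = i mod d"
    and input: "\<And>i. i < length (concat (map (\<lambda>c. length c # c) cs)) \<Longrightarrow>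
      \<alpha> 0 (2 + i) = concat (map (\<lambda>c. length c # c) cs) ! i"
begin

definition Inv :: "(vtx \<times> vtx) set \<Rightarrow> state \<Rightarrow> bool" where
  "Inv F st \<longleftrightarrow> (\<forall>r<20. regs st r = \<rho> r) \<and> (\<forall>a. a \<noteq> 1 \<longrightarrow> arrays st a = \<alpha> a) \<and>
     (\<forall>u v. valid u \<longrightarrow> valid v \<longrightarrow>
        arrays st 1 (2 + idx u * p + idx v) = of_bool ((u, v) \<in> F \<or> (v, u) \<in> F))"

definition holds :: "(nat \<times> nat) list \<Rightarrow> state \<Rightarrow> bool" where
  "holds L st \<longleftrightarrow> (\<forall>(r, x)\<in>set L. regs st r = x)"

text \<open>
  \<open>adds c L F L'\<close>: if the registers have the values listed in \<open>L\<close>, then \<open>c\<close> adds the edges \<open>F\<close> to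
  the matrix and leaves the values listed in \<open>L'\<close>.
\<close>

definition adds :: "com \<Rightarrow> (nat \<times> nat) list \<Rightarrow> (vtx \<times> vtx) set \<Rightarrow> (nat \<times> nat) list \<Rightarrow> bool" where
  "adds c L F L' \<longleftrightarrow> (\<forall>E st. Inv E st \<longrightarrow> holds L st \<longrightarrow>
     wp V c (\<lambda>st'. Inv (E \<union> F) st' \<and> holds L' st') st)"

text \<open>Quantifying over \<open>E\<close> makes the value independent of the edges written so
  far.\<close>

definition evals :: "exp \<Rightarrow> (nat \<times> nat) list \<Rightarrow> nat \<Rightarrow> bool" where
  "evals e L x \<longleftrightarrow> (\<forall>E st. Inv E st \<longrightarrow> holds L st \<longrightarrow> eval_exp e st = x)"

lemma Inv_reg: "Inv E st \<Longrightarrow> r < 20 \<Longrightarrow> regs st r = \<rho> r"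
  by (simp add: Inv_def)

lemma Inv_array: "Inv E st \<Longrightarrow> a \<noteq> 1 \<Longrightarrow> arrays st a = \<alpha> a"
  by (simp add: Inv_def)

lemma Inv_set_reg: "Inv E st \<Longrightarrow> 20 \<le> r \<Longrightarrow> Inv E (set_reg r x st)"
  by (simp add: Inv_def)

lemma holds_set_reg: "(\<And>x. (r, x) \<notin> set L) \<Longrightarrow> holds L (set_reg r y st) = holds L st"
  unfolding holds_def by (rule ball_cong) auto

lemma row_col_eq:
  fixes i j i' j' :: nat
  assumes "j < p" "j' < p" shows "i * p + j = i' * p + j' \<longleftrightarrow> i = i' \<and> j = j'"
proof
  assume eq: "i * p + j = i' * p + j'"
  have "i = (i * p + j) div p" "i' = (i' * p + j') div p"
    "j = (i * p + j) mod p" "j' = (i' * p + j') mod p" using assms by auto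
  with eq show "i = i' \<and> j = j'" by metis
qed simp

lemma idx_eq: "valid u \<Longrightarrow> valid v \<Longrightarrow> idx u = idx v \<longleftrightarrow> u = v"
  using inj_idx by (auto simp: inj_on_def)

lemma adds_SKIP: "adds SKIP L {} []"
  by (auto simp: adds_def holds_def intro: wp_SKIP)

lemma adds_Assign:
  assumes "evals e L x" "20 \<le> r" shows "adds (Assign r e) L {} [(r, x)]"
  using assms by (auto simp: adds_def evals_def holds_def intro!: wp_Assign Inv_set_reg)

lemma adds_EDGE:
  assumes "evals e1 L (idx u)" "evals e2 L (idx v)" "1 \<notin> reads e1" "1 \<notin> reads e2" "valid u" "valid v"
  shows "adds (EDGE e1 e2) L {(u, v)} []"
proof -
  { fix E st assume st: "Inv E st" "holds L st"
    have e: "eval_exp e1 st = idx u" "eval_exp e2 st = idx v"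
      using assms(1,2) st by (auto simp: evals_def)
    have rows: "arrays st 3 (idx u) = 2 + idx u * p" "arrays st 3 (idx v) = 2 + idx v * p"
      using idx_less assms(5,6) by (auto simp: Inv_array[OF st(1)] row less_imp_le)
    have mat: "arrays st 1 (2 + idx a * p + idx b) = of_bool ((a, b) \<in> E \<or> (b, a) \<in> E)"
      if "valid a" "valid b" for a b using st(1) that by (simp add: Inv_def)
    have pos_eq: "2 + idx a * p + idx b = 2 + idx a' * p + idx b' \<longleftrightarrow> a = a' \<and> b = b'"
      if "valid a" "valid b" "valid a'" "valid b'" for a b a' b'
      using row_col_eq[of "idx b" "idx b'" "idx a" "idx a'"] that idx_less idx_eq by (simp add: add.assoc)
    have if_of_bool: "(if X then 1 else of_bool Y) = (of_bool (X \<or> Y) :: nat)" for X Y by simp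
    define i1 i2 where "i1 = 2 + idx u * p + idx v" and "i2 = 2 + idx v * p + idx u"
    have "Inv (E \<union> {(u, v)}) (set_cell 1 i2 1 (set_cell 1 i1 1 st))"
      unfolding Inv_def
    proof (intro conjI allI impI)
      fix a b assume ab: "valid a" "valid b"
      let ?i = "2 + idx a * p + idx b"
      have "arrays (set_cell 1 i2 1 (set_cell 1 i1 1 st)) 1 ?i
          = (if ?i = i2 \<or> ?i = i1 then 1 else arrays st 1 ?i)" by simp
      also have "\<dots> = of_bool ((a, b) \<in> E \<union> {(u, v)} \<or> (b, a) \<in> E \<union> {(u, v)})"
        unfolding mat[OF ab] i1_def i2_def pos_eq[OF ab assms(5,6)] pos_eq[OF ab assms(6,5)]
        by (rule trans[OF if_of_bool]) (rule arg_cong[where f = of_bool], blast)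
      finally show "arrays (set_cell 1 i2 1 (set_cell 1 i1 1 st)) 1 ?i
          = of_bool ((a, b) \<in> E \<union> {(u, v)} \<or> (b, a) \<in> E \<union> {(u, v)})" .
    qed (use st in \<open>auto simp: Inv_def\<close>)
    \<comment> \<open>The second store is evaluated after the first one; its value is unaffected
      because neither expression reads array 1.\<close>
    moreover have "eval_exp (Add (Cell 3 e1) e2) st = i1"
      "eval_exp (Add (Cell 3 e2) e1) (set_cell 1 i1 1 st) = i2"
      by (simp_all add: e rows i1_def i2_def eval_set_cell[OF assms(3)] eval_set_cell[OF assms(4)]
          del: One_nat_def)
    ultimately have "wp V (EDGE e1 e2) (\<lambda>st'. Inv (E \<union> {(u, v)}) st') st"
      unfolding EDGE_def by (intro wp_Seq wp_Store) (simp only: eval_exp.simps(1)) }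
  then show ?thesis by (auto simp: adds_def holds_def)
qed

text \<open>A fact about a register that \<open>c1\<close> never assigns passes to \<open>c2\<close>
  without being listed as a result of \<open>c1\<close>.\<close>

lemma adds_Seq:
  assumes c1: "adds c1 L F1 L1" and c2: "adds c2 L2 F2 L3"
    and L2: "\<And>r x. (r, x) \<in> set L2 \<Longrightarrow> (r, x) \<in> set L1 \<or> (r, x) \<in> set L \<and> r \<notin> modr c1"
  shows "adds (Seq c1 c2) L (F1 \<union> F2) L3"
  unfolding adds_def
proof (intro allI impI wp_Seq)
  fix E st assume st: "Inv E st" "holds L st"
  with c1 have "wp V c1 (\<lambda>st'. Inv (E \<union> F1) st' \<and> holds L1 st') st" by (simp add: adds_def)
  from wp_modr[OF this]
  show "wp V c1 (wp V c2 (\<lambda>st'. Inv (E \<union> (F1 \<union> F2)) st' \<and> holds L3 st')) st"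
  proof (rule wp_mono)
    fix st' assume *: "(Inv (E \<union> F1) st' \<and> holds L1 st') \<and> (\<forall>r. r \<notin> modr c1 \<longrightarrow> regs st' r = regs st r)"
    then have "holds L2 st'" using st(2) L2 by (fastforce simp: holds_def)
    with c2 * have "wp V c2 (\<lambda>st'. Inv (E \<union> F1 \<union> F2) st' \<and> holds L3 st') st'"
      unfolding adds_def by blast
    then show "wp V c2 (\<lambda>st'. Inv (E \<union> (F1 \<union> F2)) st' \<and> holds L3 st') st'"
      by (simp only: Un_assoc)
  qed
qed

lemma adds_IfNZ:
  assumes b: "evals b L x" and c1: "x \<noteq> 0 \<Longrightarrow> adds c1 L F L'" and c2: "x = 0 \<Longrightarrow> adds c2 L F L'"
  shows "adds (IfNZ b c1 c2) L F L'"
  using assms by (auto simp: adds_def evals_def intro!: wp_IfNZ)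

text \<open>\<open>H i\<close> lists the facts carried from round to round, \<open>L\<close> those
  about registers that the loop leaves alone.\<close>

lemma adds_FOR:
  assumes n: "n \<le> V" and e: "\<And>i. i \<le> n \<Longrightarrow> evals e ((r, i) # H i @ L) n"
    and c: "\<And>i. i < n \<Longrightarrow> adds c ((r, i) # H i @ L) (F i) (H (Suc i))"
    and r: "20 \<le> r" "r \<notin> modr c" "\<And>i x. (r, x) \<notin> set (H i)"
    and L: "\<And>r' x. (r', x) \<in> set L \<Longrightarrow> r' \<notin> insert r (modr c)"
  shows "adds (FOR r e c) (H 0 @ L) (\<Union>i<n. F i) (H n)"
  unfolding adds_def
proof (intro allI impI)
  fix E st assume st: "Inv E st" "holds (H 0 @ L) st"
  have fresh: "(r, x) \<notin> set (H i @ L)" for i x using r(3) L by auto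
  show "wp V (FOR r e c) (\<lambda>st'. Inv (E \<union> (\<Union>i<n. F i)) st' \<and> holds (H n) st') st"
  proof (rule wp_FOR[where I = "\<lambda>i st'. Inv (E \<union> (\<Union>j<i. F j)) st' \<and> holds (H i @ L) st'", OF n])
    show "Inv (E \<union> (\<Union>j<0. F j)) (set_reg r 0 st) \<and> holds (H 0 @ L) (set_reg r 0 st)"
      using st fresh[of _ 0] by (simp add: holds_set_reg Inv_set_reg r(1))
  next
    fix i st' assume "i \<le> n" "Inv (E \<union> (\<Union>j<i. F j)) st' \<and> holds (H i @ L) st'" "regs st' r = i"
    with e[of i] show "eval_exp e st' = n" by (auto simp: evals_def holds_def)
  next
    fix i st' assume i: "i < n" and st': "Inv (E \<union> (\<Union>j<i. F j)) st' \<and> holds (H i @ L) st'" "regs st' r = i"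
    then have "wp V c (\<lambda>st''. Inv (E \<union> (\<Union>j<i. F j) \<union> F i) st'' \<and> holds (H (Suc i)) st'') st'"
      using c[OF i] by (auto simp: adds_def holds_def)
    from wp_modr[OF this]
    show "wp V c (\<lambda>st''. regs st'' r = i \<and> Inv (E \<union> (\<Union>j<Suc i. F j)) (set_reg r (Suc i) st'')
        \<and> holds (H (Suc i) @ L) (set_reg r (Suc i) st'')) st'"
    proof (rule wp_mono)
      fix st'' assume *: "(Inv (E \<union> (\<Union>j<i. F j) \<union> F i) st'' \<and> holds (H (Suc i)) st'')
        \<and> (\<forall>r. r \<notin> modr c \<longrightarrow> regs st'' r = regs st' r)"
      have "E \<union> (\<Union>j<Suc i. F j) = E \<union> (\<Union>j<i. F j) \<union> F i" by (auto simp: lessThan_Suc)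
      with * have "Inv (E \<union> (\<Union>j<Suc i. F j)) (set_reg r (Suc i) st'')" using Inv_set_reg r(1) by simp
      moreover have "holds L st''"
        unfolding holds_def
      proof (intro ballI, clarify)
        fix r' x assume "(r', x) \<in> set L"
        then have "regs st' r' = x" using st'(1) by (force simp: holds_def)
        with L[OF \<open>(r', x) \<in> set L\<close>] * show "regs st'' r' = x" by auto
      qed
      then have "holds (H (Suc i) @ L) (set_reg r (Suc i) st'')"
        using * fresh[of _ "Suc i"] by (simp add: holds_set_reg) (auto simp: holds_def)
      ultimately show "regs st'' r = i \<and> Inv (E \<union> (\<Union>j<Suc i. F j)) (set_reg r (Suc i) st'')
        \<and> holds (H (Suc i) @ L) (set_reg r (Suc i) st'')" using * st'(2) r(2) by simp
    qed
  next
    fix st' assume "Inv (E \<union> (\<Union>j<n. F j)) st' \<and> holds (H n @ L) st'"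
    then show "Inv (E \<union> (\<Union>i<n. F i)) st' \<and> holds (H n) st'" by (auto simp: holds_def)
  qed
qed

lemma adds_weaken:
  assumes "adds c L F L1" "set L \<subseteq> set L'" "set L2 \<subseteq> set L1" "F = F'"
  shows "adds c L' F' L2"
  unfolding adds_def
proof (intro allI impI)
  fix E st assume "Inv E st" "holds L' st"
  with assms have "wp V c (\<lambda>st'. Inv (E \<union> F') st' \<and> holds L1 st') st"
    by (fastforce simp: adds_def holds_def)
  then show "wp V c (\<lambda>st'. Inv (E \<union> F') st' \<and> holds L2 st') st"
    by (rule wp_mono) (use assms(3) in \<open>auto simp: holds_def\<close>)
qed

lemma holds_simps [simp]:
  "holds [] st" "holds ((r, x) # L) st \<longleftrightarrow> regs st r = x \<and> holds L st"
  by (auto simp: holds_def)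

definition Env :: "state \<Rightarrow> bool" where
  "Env st \<longleftrightarrow> (\<forall>r<20. regs st r = \<rho> r) \<and> (\<forall>a. a \<noteq> 1 \<longrightarrow> arrays st a = \<alpha> a)"

lemma Env_reg: "Env st \<Longrightarrow> r < 20 \<Longrightarrow> regs st r = \<rho> r"
  by (simp add: Env_def)

lemma Env_array: "Env st \<Longrightarrow> a \<noteq> 1 \<Longrightarrow> arrays st a = \<alpha> a"
  by (simp add: Env_def)

lemma evalsI: "(\<And>st. Env st \<Longrightarrow> holds L st \<Longrightarrow> eval_exp e st = x) \<Longrightarrow> evals e L x"
  by (auto simp: evals_def Env_def Inv_def)

lemmas env = Env_reg Env_array \<rho>

text \<open>Apart from clause lengths, every loop bound of the edge phase is at most
  \<open>p\<close> and thus at most \<open>V\<close>.\<close>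

lemma bounds: "m \<le> p" "3 * s \<le> p" "9 * s \<le> p" "3 * s + K \<le> p" "s \<le> p" "M \<le> p" "K \<le> p" "2 ^ s \<le> p"
proof -
  have "(2::nat) ^ s \<le> 3 * s * 2 ^ s" using s_pos by simp
  then show "2 ^ s \<le> p" unfolding p_def by linarith
qed (auto simp: p_def oA_def oB_def oL_def oC_def oP_def m_def)

end

section \<open>Edges that do not depend on the clauses\<close>

definition CODE :: "exp \<Rightarrow> com" where
  "CODE off = FOR 32 (Reg 7) (Seq (IfNZ (Cell 6 (Reg 31)) (EDGE (Reg 30) (Add off (Reg 32))) SKIP)
     (Assign 31 (Cell 5 (Reg 31))))"

definition BITS :: com where
  "BITS = FOR 20 (Reg 8) (Seq (EDGE (Add (Reg 8) (Add (Reg 20) (Reg 20))) (Reg 20))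
     (Seq (EDGE (Add (Add (Reg 8) (Add (Reg 20) (Reg 20))) (Const 1)) (Reg 20))
       (FOR 21 (Reg 20) (EDGE (Reg 20) (Reg 21)))))"

text \<open>The only test of the machine is for a nonzero value; the sum of both truncated
  differences is nonzero just if the two registers differ.\<close>

definition GUARDS :: com where
  "GUARDS = FOR 20 (Reg 16) (FOR 21 (Reg 16)
     (Seq (EDGE (Add (Reg 9) (Add (Reg 20) (Reg 20))) (Add (Reg 12) (Reg 21)))
       (IfNZ (Add (Sub (Reg 20) (Reg 21)) (Sub (Reg 21) (Reg 20)))
         (EDGE (Add (Add (Reg 9) (Add (Reg 20) (Reg 20))) (Const 1)) (Add (Reg 12) (Reg 21))) SKIP)))"

context edge_phase
begin

lemma adds_SKIP_keeps: "adds SKIP L {} L"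
  by (auto simp: adds_def intro: wp_SKIP)

lemma adds_FOR0:
  assumes "n \<le> V" "\<And>i. evals e ((r, i) # L) n" "\<And>i. i < n \<Longrightarrow> adds c ((r, i) # L) (F i) []"
    "20 \<le> r" "r \<notin> modr c" "list_all (\<lambda>(r', x). r' \<notin> insert r (modr c)) L"
  shows "adds (FOR r e c) L (\<Union>i<n. F i) []"
  using adds_FOR[of n e r "\<lambda>_. []" L c F] assms by (force simp: list_all_iff)

lemma adds_Seq0:
  assumes "adds c1 L F1 []" "adds c2 L F2 L'" "list_all (\<lambda>(r, x). r \<notin> modr c1) L"
  shows "adds (Seq c1 c2) L (F1 \<union> F2) L'"
  using assms by (intro adds_Seq) (auto simp: list_all_iff)

lemma adds_Let:
  assumes "evals e L x" "adds c ((r, x) # L) F L'" "20 \<le> r" "list_all (\<lambda>(r', x). r' \<noteq> r) L"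
  shows "adds (Seq (Assign r e) c) L F L'"
  using adds_Seq[OF adds_Assign[OF assms(1,3)] assms(2)] assms(4) by (auto simp: list_all_iff)

lemma adds_CODE:
  assumes off: "\<And>st. Env st \<Longrightarrow> eval_exp off st = n" "1 \<notin> reads off" "n + M \<le> m" and u: "valid u" and x: "x \<le> p"
  shows "adds (CODE off) [(31, x), (30, idx u)] {(u, BitV j) |j. j \<in> binary n x} []"
proof -
  have half: "x div 2 ^ i \<le> p + 6 * d" for i using x by (meson div_le_dividend le_add1 order_trans)
  have *: "adds (FOR 32 (Reg 7) (Seq (IfNZ (Cell 6 (Reg 31)) (EDGE (Reg 30) (Add off (Reg 32))) SKIP)
     (Assign 31 (Cell 5 (Reg 31))))) ([(31, x div 2 ^ 0)] @ [(30, idx u)])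
     (\<Union>i<M. if bit x i then {(u, BitV (n + i))} else {}) [(31, x div 2 ^ M)]"
  proof (rule adds_FOR[where H = "\<lambda>i. [(31, x div 2 ^ i)]"])
    fix i assume i: "i < M"
    let ?L = "(32, i) # [(31, x div 2 ^ i)] @ [(30, idx u)]"
    have "adds (IfNZ (Cell 6 (Reg 31)) (EDGE (Reg 30) (Add off (Reg 32))) SKIP) ?L
        (if bit x i then {(u, BitV (n + i))} else {}) []"
    proof (rule adds_IfNZ)
      show "evals (Cell 6 (Reg 31)) ?L (x div 2 ^ i mod 2)"
        by (rule evalsI) (simp add: env tables half)
    next
      assume "x div 2 ^ i mod 2 \<noteq> 0"
      then have "bit x i" by (simp add: bit_iff_odd odd_iff_mod_2_eq_one)
      then show "adds (EDGE (Reg 30) (Add off (Reg 32))) ?L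
          (if bit x i then {(u, BitV (n + i))} else {}) []"
        using i off u by (simp, intro adds_EDGE evalsI) (auto simp: env)
    next
      assume "x div 2 ^ i mod 2 = 0"
      then have "\<not> bit x i" by (simp add: bit_iff_odd even_iff_mod_2_eq_zero)
      then show "adds SKIP ?L (if bit x i then {(u, BitV (n + i))} else {}) []"
        by (simp add: adds_SKIP)
    qed
    moreover have "adds (Assign 31 (Cell 5 (Reg 31))) ?L {} [(31, x div 2 ^ Suc i)]"
      by (rule adds_Assign evalsI)+ (simp_all add: env tables half power_Suc2 div_mult2_eq del: power_Suc)
    ultimately show "adds (Seq (IfNZ (Cell 6 (Reg 31)) (EDGE (Reg 30) (Add off (Reg 32))) SKIP)
        (Assign 31 (Cell 5 (Reg 31)))) ?L
        (if bit x i then {(u, BitV (n + i))} else {}) [(31, x div 2 ^ Suc i)]"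
      using adds_Seq[of _ ?L _ "[]" _ ?L "{}" ] by (simp add: modr_EDGE)
  qed (use bounds V in \<open>auto intro!: evalsI simp: env modr_EDGE\<close>)
  show ?thesis
    unfolding CODE_def by (rule adds_weaken[OF *]) (auto simp: binary_def split: if_splits)
qed

lemma adds_BITS:
  "adds BITS [] (\<Union>i<m. {(Pendant i False, BitV i)} \<union> ({(Pendant i True, BitV i)} \<union>
     (\<Union>j<i. {(BitV i, BitV j)}))) []"
  unfolding BITS_def
  by (intro adds_FOR0 adds_Seq0 adds_EDGE evalsI)
     (use bounds V in \<open>auto simp: env modr_FOR modr_EDGE\<close>)

lemma adds_GUARDS:
  "adds GUARDS [] (\<Union>b<3 * s. \<Union>b'<3 * s. {(Guard b False, BucketV b')} \<union>
     (if b \<noteq> b' then {(Guard b True, BucketV b')} else {})) []"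
  unfolding GUARDS_def
proof (intro adds_FOR0 adds_Seq0 adds_IfNZ)
  fix b b' assume "b < 3 * s" "b' < 3 * s"
  then show "evals (Add (Sub (Reg 20) (Reg 21)) (Sub (Reg 21) (Reg 20))) [(21, b'), (20, b)]
      (b - b' + (b' - b))"
    by (intro evalsI) auto
qed (use bounds V in \<open>auto simp: env modr_FOR modr_EDGE adds_SKIP split: if_splits intro!: evalsI adds_EDGE\<close>)

end

text \<open>Subtracting the bit from 1 negates it, since a true variable is joined to
  \<open>LitV h False\<close>.\<close>

definition ASGS :: com where
  "ASGS = FOR 20 (Reg 16) (FOR 21 (Reg 6) (Seq (Assign 30 (Add (Cell 2 (Reg 20)) (Reg 21)))
     (Seq (EDGE (Reg 30) (Add (Reg 12) (Reg 20)))
       (Seq (Seq (Assign 33 (Reg 21)) (FOR 22 (Reg 4)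
         (Seq (EDGE (Reg 30) (Add (Add (Reg 11) (Add (Add (Cell 4 (Cell 7 (Reg 20))) (Reg 22))
             (Add (Cell 4 (Cell 7 (Reg 20))) (Reg 22)))) (Sub (Const 1) (Cell 6 (Reg 33)))))
           (Assign 33 (Cell 5 (Reg 33))))))
         (Seq (EDGE (Reg 30) (Const 1)) (Seq (Assign 31 (Reg 30)) (CODE (Add (Const 2) (Reg 7)))))))))"

text \<open>Register 31 gets the index of the \<open>False\<close> vertex in both halves, so that
  twins receive the same code.\<close>

definition PAIRCODES :: com where
  "PAIRCODES = FOR 20 (Reg 18) (Seq
     (Seq (Assign 30 (Add (Reg 9) (Add (Reg 20) (Reg 20)))) (Seq (EDGE (Reg 30) (Const 0))
       (Seq (Assign 31 (Add (Reg 9) (Add (Reg 20) (Reg 20)))) (CODE (Const 2)))))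
     (Seq (Assign 30 (Add (Add (Reg 9) (Add (Reg 20) (Reg 20))) (Const 1))) (Seq (EDGE (Reg 30) (Const 0))
       (Seq (Assign 31 (Add (Reg 9) (Add (Reg 20) (Reg 20)))) (CODE (Const 2))))))"

definition SINGLECODES :: com where
  "SINGLECODES = FOR 20 (Reg 19) (Seq (Assign 30 (Add (Reg 11) (Reg 20))) (Seq (EDGE (Reg 30) (Const 0))
     (Seq (Assign 31 (Reg 30)) (CODE (Const 2)))))"

lemma modr_CODE: "modr (CODE off) = {31, 32}"
  by (auto simp: CODE_def modr_FOR modr_EDGE)

context edge_phase
begin

lemma adds_CODE_weaken:
  assumes "\<And>st. Env st \<Longrightarrow> eval_exp off st = n" "1 \<notin> reads off" "n + M \<le> m" "valid u" "x \<le> p"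
    and "(31, x) \<in> set L" "(30, idx u) \<in> set L"
  shows "adds (CODE off) L {(u, BitV j) |j. j \<in> binary n x} []"
  by (rule adds_weaken[OF adds_CODE[OF assms(1-5)]]) (use assms(6,7) in auto)

definition asg_edges :: "nat \<Rightarrow> nat \<Rightarrow> (vtx \<times> vtx) set" where
  "asg_edges b a = {(AsgV b a, BucketV b)} \<union>
     ((\<Union>i<s. {(AsgV b a, LitV (b div s * s + i) (\<not> bit a i))}) \<union>
     ({(AsgV b a, BitV 1)} \<union> {(AsgV b a, BitV j) |j. j \<in> binary (2 + M) (idx (AsgV b a))}))"

lemma adds_ASGS: "adds ASGS [] (\<Union>b<3 * s. \<Union>a<2 ^ s. asg_edges b a) []"
  unfolding ASGS_def
proof (intro adds_FOR0)
  fix b a :: nat assume b: "b < 3 * s" and a: "a < 2 ^ s"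
  let ?L = "[(30, idx (AsgV b a)), (21, a), (20, b)]"
  have half: "a div 2 ^ i \<le> p + 6 * d" for i using a bounds by (meson div_le_dividend le_add1 order_trans less_imp_le)
  have bs: "b div s < 3" using b by (simp add: less_mult_imp_div_less)
  have lit: "adds (FOR 22 (Reg 4)
      (Seq (EDGE (Reg 30) (Add (Add (Reg 11) (Add (Add (Cell 4 (Cell 7 (Reg 20))) (Reg 22))
             (Add (Cell 4 (Cell 7 (Reg 20))) (Reg 22)))) (Sub (Const 1) (Cell 6 (Reg 33)))))
           (Assign 33 (Cell 5 (Reg 33))))) ([(33, a div 2 ^ 0)] @ ?L)
      (\<Union>i<s. {(AsgV b a, LitV (b div s * s + i) (\<not> bit a i))}) [(33, a div 2 ^ s)]"
  proof (rule adds_FOR[where H = "\<lambda>i. [(33, a div 2 ^ i)]"])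
    fix i assume i: "i < s"
    let ?L' = "(22, i) # [(33, a div 2 ^ i)] @ ?L"
    have "adds (EDGE (Reg 30) (Add (Add (Reg 11) (Add (Add (Cell 4 (Cell 7 (Reg 20))) (Reg 22))
             (Add (Cell 4 (Cell 7 (Reg 20))) (Reg 22)))) (Sub (Const 1) (Cell 6 (Reg 33))))) ?L'
        {(AsgV b a, LitV (b div s * s + i) (\<not> bit a i))} []"
    proof (intro adds_EDGE evalsI)
      have "b \<le> p + 6 * d" "b div s \<le> p + 6 * d"
        using b bs bounds s_pos by auto
      moreover fix st assume "Env st" "holds ?L' st"
      ultimately show "eval_exp (Add (Add (Reg 11) (Add (Add (Cell 4 (Cell 7 (Reg 20))) (Reg 22))
             (Add (Cell 4 (Cell 7 (Reg 20))) (Reg 22)))) (Sub (Const 1) (Cell 6 (Reg 33)))) st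
          = idx (LitV (b div s * s + i) (\<not> bit a i))"
        by (simp add: env tables half) (simp add: bit_iff_odd odd_iff_mod_2_eq_one)
    qed (use b a i combine_lt[OF bs i] in auto)
    moreover have "adds (Assign 33 (Cell 5 (Reg 33))) ?L' {} [(33, a div 2 ^ Suc i)]"
      by (rule adds_Assign evalsI)+ (simp_all add: env tables half power_Suc2 div_mult2_eq del: power_Suc)
    ultimately show "adds (Seq (EDGE (Reg 30) (Add (Add (Reg 11) (Add (Add (Cell 4 (Cell 7 (Reg 20))) (Reg 22))
             (Add (Cell 4 (Cell 7 (Reg 20))) (Reg 22)))) (Sub (Const 1) (Cell 6 (Reg 33)))))
           (Assign 33 (Cell 5 (Reg 33)))) ?L'
        {(AsgV b a, LitV (b div s * s + i) (\<not> bit a i))} [(33, a div 2 ^ Suc i)]"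
      using adds_Seq[of _ ?L' _ "[]" _ ?L' "{}" ] by (simp add: modr_EDGE)
  qed (use bounds V in \<open>auto intro!: evalsI simp: env modr_EDGE\<close>)
  show "adds (Seq (Assign 30 (Add (Cell 2 (Reg 20)) (Reg 21)))
     (Seq (EDGE (Reg 30) (Add (Reg 12) (Reg 20)))
       (Seq (Seq (Assign 33 (Reg 21)) (FOR 22 (Reg 4)
         (Seq (EDGE (Reg 30) (Add (Add (Reg 11) (Add (Add (Cell 4 (Cell 7 (Reg 20))) (Reg 22))
             (Add (Cell 4 (Cell 7 (Reg 20))) (Reg 22)))) (Sub (Const 1) (Cell 6 (Reg 33)))))
           (Assign 33 (Cell 5 (Reg 33))))))
         (Seq (EDGE (Reg 30) (Const 1)) (Seq (Assign 31 (Reg 30)) (CODE (Add (Const 2) (Reg 7))))))))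
     [(21, a), (20, b)] (asg_edges b a) []"
    unfolding asg_edges_def
  proof (rule adds_Let[where x = "idx (AsgV b a)"], goal_cases)
    case 2
    have "adds (Seq (Assign 33 (Reg 21)) (FOR 22 (Reg 4)
         (Seq (EDGE (Reg 30) (Add (Add (Reg 11) (Add (Add (Cell 4 (Cell 7 (Reg 20))) (Reg 22))
             (Add (Cell 4 (Cell 7 (Reg 20))) (Reg 22)))) (Sub (Const 1) (Cell 6 (Reg 33)))))
           (Assign 33 (Cell 5 (Reg 33)))))) ?L (\<Union>i<s. {(AsgV b a, LitV (b div s * s + i) (\<not> bit a i))}) []"
      by (rule adds_Let[where x = a, OF _ adds_weaken[OF lit]]) (auto intro: evalsI)
    moreover have "adds (EDGE (Reg 30) (Add (Reg 12) (Reg 20))) ?L {(AsgV b a, BucketV b)} []"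
      using a b by (intro adds_EDGE evalsI) (auto simp: env)
    moreover have "adds (EDGE (Reg 30) (Const 1)) ?L {(AsgV b a, BitV 1)} []"
      using a b by (intro adds_EDGE evalsI) (auto simp: env m_def)
    moreover have "adds (Seq (Assign 31 (Reg 30)) (CODE (Add (Const 2) (Reg 7)))) ?L
        {(AsgV b a, BitV j) |j. j \<in> binary (2 + M) (idx (AsgV b a))} []"
      by (rule adds_Let[where x = "idx (AsgV b a)", OF _ adds_CODE_weaken])
         (use a b idx_less[of "AsgV b a"] in \<open>auto intro!: evalsI simp: env m_def\<close>)
    ultimately show ?case by (intro adds_Seq0) (auto simp: modr_EDGE modr_FOR)
  qed (use b in \<open>auto intro!: evalsI simp: env asg_row\<close>)
qed (use bounds V in \<open>auto simp: env modr_FOR modr_EDGE modr_CODE intro!: evalsI\<close>)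

text \<open>Guards and clause vertices have consecutive indices from \<open>oP\<close> on, so one
  loop writes the codes of both kinds. In the same way \<open>single\<close> joins
  \<open>LitV\<close> and \<open>BucketV\<close>, from \<open>oL\<close> on.\<close>

definition twin :: "nat \<Rightarrow> bool \<Rightarrow> vtx" where
  "twin i x = (if i < 3 * s then Guard i x else ClauseV (i - 3 * s) x)"

definition single :: "nat \<Rightarrow> vtx" where
  "single i = (if i < 6 * s then LitV (i div 2) (odd i) else BucketV (i - 6 * s))"

lemma twin: "i < 3 * s + K \<Longrightarrow> valid (twin i x)" "idx (twin i x) = oP + 2 * i + of_bool x"
  by (auto simp: twin_def oC_def)

lemma single:
  assumes "i < 9 * s" shows "valid (single i)" "idx (single i) = oL + i"
  using assms by (auto simp: single_def oB_def)

definition code_edges :: "vtx \<Rightarrow> nat \<Rightarrow> (vtx \<times> vtx) set" where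
  "code_edges u x = {(u, BitV 0)} \<union> {(u, BitV j) |j. j \<in> binary 2 x}"

lemma adds_code_edges:
  assumes "valid u" "x \<le> p" "evals e1 L (idx u)" "evals e2 ((30, idx u) # L) x"
    "list_all (\<lambda>(r, x). r < 30) L"
  shows "adds (Seq (Assign 30 e1) (Seq (EDGE (Reg 30) (Const 0)) (Seq (Assign 31 e2) (CODE (Const 2)))))
     L (code_edges u x) []"
  unfolding code_edges_def
proof (rule adds_Let[OF assms(3)], rule adds_Seq0)
  show "adds (EDGE (Reg 30) (Const 0)) ((30, idx u) # L) {(u, BitV 0)} []"
    using assms by (intro adds_EDGE evalsI) (auto simp: m_def)
  show "adds (Seq (Assign 31 e2) (CODE (Const 2))) ((30, idx u) # L)
     {(u, BitV j) |j. j \<in> binary 2 x} []"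
    by (rule adds_Let[OF assms(4) adds_CODE_weaken]) (use assms in \<open>auto simp: m_def list_all_iff\<close>)
qed (use assms in \<open>auto simp: modr_EDGE list_all_iff\<close>)

lemma adds_PAIRCODES:
  "adds PAIRCODES [] (\<Union>i<3 * s + K. code_edges (twin i False) (idx (twin i False)) \<union>
     code_edges (twin i True) (idx (twin i False))) []"
  unfolding PAIRCODES_def
proof (intro adds_FOR0 adds_Seq0 adds_code_edges evalsI)
  fix i assume "i < 3 * s + K"
  then show "idx (twin i False) \<le> p" by (intro less_imp_le idx_less twin)
  then show "idx (twin i False) \<le> p" .
qed (use bounds V in \<open>auto simp: env twin modr_FOR modr_EDGE modr_CODE\<close>)

lemma adds_SINGLECODES:
  "adds SINGLECODES [] (\<Union>i<9 * s. code_edges (single i) (idx (single i))) []"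
  unfolding SINGLECODES_def
proof (intro adds_FOR0 adds_code_edges evalsI)
  fix i assume "i < 9 * s"
  then show "idx (single i) \<le> p" by (intro less_imp_le idx_less single)
qed (use bounds V in \<open>auto simp: env single modr_FOR modr_EDGE modr_CODE\<close>)

end

section \<open>Edges of the clause vertices\<close>

definition variable_exp :: exp where
  "variable_exp = Cell 5 (Cell 0 (Add (Reg 34) (Reg 22)))"

definition bucket_exp :: exp where
  "bucket_exp = Add (Cell 4 (Cell 9 variable_exp)) (Cell 7 (Cell 10 variable_exp))"

definition pos_exp :: exp where
  "pos_exp = Add (Cell 4 (Cell 9 variable_exp)) (Cell 8 (Cell 10 variable_exp))"

text \<open>Register 36 is a flag that stays 1 as long as no literal of the clause lies in the
  bucket of register 21.\<close>

definition CLAUSE_BUCKETS :: com where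
  "CLAUSE_BUCKETS = FOR 21 (Reg 16) (Seq (Seq (Assign 36 (Const 1))
     (FOR 22 (Reg 35) (IfNZ (Add (Sub bucket_exp (Reg 21)) (Sub (Reg 21) bucket_exp)) SKIP
       (Assign 36 (Const 0)))))
     (IfNZ (Reg 36) (Seq (EDGE (Add (Reg 10) (Add (Reg 20) (Reg 20))) (Add (Reg 12) (Reg 21)))
       (EDGE (Add (Add (Reg 10) (Add (Reg 20) (Reg 20))) (Const 1)) (Add (Reg 12) (Reg 21)))) SKIP))"

definition CLAUSE_LITS :: com where
  "CLAUSE_LITS = FOR 22 (Reg 35) (EDGE (Add (Reg 10) (Add (Reg 20) (Reg 20)))
     (Add (Add (Reg 11) (Add pos_exp pos_exp)) (Cell 6 (Cell 0 (Add (Reg 34) (Reg 22))))))"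

definition CLAUSES :: com where
  "CLAUSES = Seq (Assign 34 (Const 2)) (FOR 20 (Reg 3) (Seq (Assign 35 (Cell 0 (Reg 34)))
     (Seq (Assign 34 (Add (Reg 34) (Const 1)))
     (Seq (Seq CLAUSE_BUCKETS CLAUSE_LITS) (Assign 34 (Add (Reg 34) (Reg 35)))))))"

context edge_phase
begin

text \<open>The address of the length field of clause \<open>c\<close> in the input; the 2 skips
  \<open>n\<close> and the number of clauses.\<close>

definition start :: "nat \<Rightarrow> nat" where
  "start c = 2 + length (concat (map (\<lambda>c. length c # c) (take c cs)))"

lemma start_Suc: "c < K \<Longrightarrow> start (Suc c) = start c + 1 + length (cs ! c)"
  by (simp add: start_def take_Suc_conv_app_nth)

lemma input_clause:
  assumes "c < K"
  shows "\<alpha> 0 (start c) = length (cs ! c)"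
    and "j < length (cs ! c) \<Longrightarrow> \<alpha> 0 (Suc (start c + j)) = cs ! c ! j"
proof -
  let ?f = "\<lambda>c. length c # c"
  let ?pre = "concat (map ?f (take c cs))"
  have cs: "cs = take c cs @ cs ! c # drop (Suc c) cs" using assms by (rule id_take_nth_drop)
  have in_cs: "concat (map ?f cs) = ?pre @ (?f (cs ! c) @ concat (map ?f (drop (Suc c) cs)))"
    by (subst cs) simp
  have get: "\<alpha> 0 (2 + (length ?pre + j)) = ?f (cs ! c) ! j" if "j < Suc (length (cs ! c))" for j
  proof -
    have "length ?pre + j < length (concat (map ?f cs))" unfolding in_cs using that by simp
    from input[OF this] show ?thesis
      unfolding in_cs nth_append_length_plus using that by (subst (asm) nth_append_left) simp_all
  qed
  show "\<alpha> 0 (start c) = length (cs ! c)" using get[of 0] by (simp add: start_def)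
  show "j < length (cs ! c) \<Longrightarrow> \<alpha> 0 (Suc (start c + j)) = cs ! c ! j"
    using get[of "Suc j"] by (simp add: start_def)
qed

text \<open>Literal codes are below \<open>6 * d\<close>, and so are the quotients and remainders
  formed from them; the tables extend to \<open>p + 6 * d\<close> to cover these arguments.\<close>

lemma lit_tables:
  assumes "l < 6 * d"
  shows "\<alpha> 4 (\<alpha> 9 (\<alpha> 5 l)) + \<alpha> 7 (\<alpha> 10 (\<alpha> 5 l)) = bucket l"
    "\<alpha> 4 (\<alpha> 9 (\<alpha> 5 l)) + \<alpha> 8 (\<alpha> 10 (\<alpha> 5 l)) = pos l" "\<alpha> 6 l = of_bool (odd l)"
proof -
  have "x \<le> p + 6 * d" if "x \<le> l" for x using assms that by simp
  moreover have "l div 2 \<le> l" "l div 2 div d \<le> l" "l div 2 mod d \<le> l"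
    by (meson div_le_dividend mod_less_eq_dividend order_trans)+
  ultimately have "l \<le> p + 6 * d" "l div 2 \<le> p + 6 * d" "l div 2 div d \<le> p + 6 * d"
    "l div 2 mod d \<le> p + 6 * d" by blast+
  then show "\<alpha> 4 (\<alpha> 9 (\<alpha> 5 l)) + \<alpha> 7 (\<alpha> 10 (\<alpha> 5 l)) = bucket l"
    "\<alpha> 4 (\<alpha> 9 (\<alpha> 5 l)) + \<alpha> 8 (\<alpha> 10 (\<alpha> 5 l)) = pos l" "\<alpha> 6 l = of_bool (odd l)"
    by (simp_all add: tables bucket_def pos_def of_bool_odd_eq_mod_2)
qed

lemma clause_lit: "c < K \<Longrightarrow> j < length (cs ! c) \<Longrightarrow> cs ! c ! j < 6 * d"
  using lits_lt[of "cs ! c" "cs ! c ! j"] by simp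

abbreviation clause_regs :: "nat \<Rightarrow> (nat \<times> nat) list" where
  "clause_regs c \<equiv> [(34, Suc (start c)), (35, length (cs ! c)), (20, c)]"

lemma eval_lit_exps:
  assumes "Env st" "regs st 34 = Suc (start c)" "regs st 22 = j" "c < K" "j < length (cs ! c)"
  shows "eval_exp bucket_exp st = bucket (cs ! c ! j)" "eval_exp pos_exp st = pos (cs ! c ! j)"
    "eval_exp (Cell 6 (Cell 0 (Add (Reg 34) (Reg 22)))) st = of_bool (odd (cs ! c ! j))"
  using lit_tables[OF clause_lit[OF assms(4,5)]] assms input_clause(2)[OF assms(4,5)]
  by (simp_all add: bucket_exp_def pos_exp_def variable_exp_def env)

lemma adds_CLAUSE_BUCKETS:
  assumes c: "c < K"
  shows "adds CLAUSE_BUCKETS (clause_regs c) (\<Union>b<3 * s. if b \<in> bucket ` set (cs ! c) then {}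
     else {(ClauseV c False, BucketV b)} \<union> {(ClauseV c True, BucketV b)}) []"
  unfolding CLAUSE_BUCKETS_def
proof (intro adds_FOR0)
  fix b assume b: "b < 3 * s"
  let ?L = "(21, b) # clause_regs c"
  define flag :: "nat \<Rightarrow> nat" where "flag i = of_bool (\<forall>j<i. bucket (cs ! c ! j) \<noteq> b)" for i
  have flag_end: "flag (length (cs ! c)) = of_bool (b \<notin> bucket ` set (cs ! c))"
  proof -
    have "b \<notin> bucket ` set (cs ! c) \<longleftrightarrow> (\<forall>l\<in>set (cs ! c). bucket l \<noteq> b)" by auto
    then show ?thesis by (simp add: flag_def all_set_conv_all_nth)
  qed
  have len: "length (cs ! c) \<le> V" using len_le c by simp
  have *: "adds (FOR 22 (Reg 35) (IfNZ (Add (Sub bucket_exp (Reg 21)) (Sub (Reg 21) bucket_exp)) SKIP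
       (Assign 36 (Const 0)))) ([(36, flag 0)] @ ?L) (\<Union>j<length (cs ! c). {})
       [(36, flag (length (cs ! c)))]"
  proof (rule adds_FOR[where H = "\<lambda>i. [(36, flag i)]"])
    fix i assume i: "i < length (cs ! c)"
    show "adds (IfNZ (Add (Sub bucket_exp (Reg 21)) (Sub (Reg 21) bucket_exp)) SKIP
       (Assign 36 (Const 0))) ((22, i) # [(36, flag i)] @ ?L) {} [(36, flag (Suc i))]"
    proof (rule adds_IfNZ)
      show "evals (Add (Sub bucket_exp (Reg 21)) (Sub (Reg 21) bucket_exp)) ((22, i) # [(36, flag i)] @ ?L)
          (bucket (cs ! c ! i) - b + (b - bucket (cs ! c ! i)))"
        by (rule evalsI) (simp add: eval_lit_exps(1)[OF _ _ _ c i])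
    next
      assume "bucket (cs ! c ! i) - b + (b - bucket (cs ! c ! i)) \<noteq> 0"
      then have "flag (Suc i) = flag i" by (auto simp: flag_def less_Suc_eq)
      then show "adds SKIP ((22, i) # [(36, flag i)] @ ?L) {} [(36, flag (Suc i))]"
        by (intro adds_weaken[OF adds_SKIP_keeps[of "[(36, flag i)]"]]) auto
    next
      assume "bucket (cs ! c ! i) - b + (b - bucket (cs ! c ! i)) = 0"
      then have "flag (Suc i) = 0" by (auto simp: flag_def)
      then show "adds (Assign 36 (Const 0)) ((22, i) # [(36, flag i)] @ ?L) {} [(36, flag (Suc i))]"
        by (intro adds_Assign evalsI) auto
    qed
  qed (use len in \<open>auto intro!: evalsI\<close>)
  let ?F = "if b \<in> bucket ` set (cs ! c) then {}
     else {(ClauseV c False, BucketV b)} \<union> {(ClauseV c True, BucketV b)}"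
  have "adds (Seq (Assign 36 (Const 1)) (FOR 22 (Reg 35)
      (IfNZ (Add (Sub bucket_exp (Reg 21)) (Sub (Reg 21) bucket_exp)) SKIP (Assign 36 (Const 0)))))
      ?L {} [(36, flag (length (cs ! c)))]"
    by (rule adds_Let[where x = "flag 0", OF _ adds_weaken[OF *]]) (auto intro: evalsI simp: flag_def)
  moreover have "adds (IfNZ (Reg 36) (Seq (EDGE (Add (Reg 10) (Add (Reg 20) (Reg 20))) (Add (Reg 12) (Reg 21)))
       (EDGE (Add (Add (Reg 10) (Add (Reg 20) (Reg 20))) (Const 1)) (Add (Reg 12) (Reg 21)))) SKIP)
      ((36, flag (length (cs ! c))) # ?L) ?F []"
  proof (rule adds_IfNZ)
    show "evals (Reg 36) ((36, flag (length (cs ! c))) # ?L) (flag (length (cs ! c)))"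
      by (rule evalsI) simp
  next
    assume "flag (length (cs ! c)) \<noteq> 0"
    then have "b \<notin> bucket ` set (cs ! c)" by (simp add: flag_end)
    then show "adds (Seq (EDGE (Add (Reg 10) (Add (Reg 20) (Reg 20))) (Add (Reg 12) (Reg 21)))
       (EDGE (Add (Add (Reg 10) (Add (Reg 20) (Reg 20))) (Const 1)) (Add (Reg 12) (Reg 21))))
       ((36, flag (length (cs ! c))) # ?L) ?F []"
      by (simp only: if_False, intro adds_Seq0 adds_EDGE evalsI) (use b c in \<open>auto simp: env modr_EDGE\<close>)
  next
    assume "flag (length (cs ! c)) = 0"
    then have "b \<in> bucket ` set (cs ! c)" by (simp add: flag_end)
    then show "adds SKIP ((36, flag (length (cs ! c))) # ?L) ?F []" by (simp only: if_True adds_SKIP)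
  qed
  ultimately show "adds (Seq (Seq (Assign 36 (Const 1))
     (FOR 22 (Reg 35) (IfNZ (Add (Sub bucket_exp (Reg 21)) (Sub (Reg 21) bucket_exp)) SKIP
       (Assign 36 (Const 0)))))
     (IfNZ (Reg 36) (Seq (EDGE (Add (Reg 10) (Add (Reg 20) (Reg 20))) (Add (Reg 12) (Reg 21)))
       (EDGE (Add (Add (Reg 10) (Add (Reg 20) (Reg 20))) (Const 1)) (Add (Reg 12) (Reg 21)))) SKIP)) ?L ?F []"
    using adds_Seq[where ?F1.0 = "{}" and ?L2.0 = "(36, flag (length (cs ! c))) # ?L"]
    by (fastforce simp: modr_FOR modr_EDGE)
qed (use bounds V in \<open>auto simp: env modr_FOR modr_EDGE intro!: evalsI\<close>)

lemma adds_CLAUSE_LITS: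
  assumes c: "c < K"
  shows "adds CLAUSE_LITS (clause_regs c)
     (\<Union>j<length (cs ! c). {(ClauseV c False, LitV (pos (cs ! c ! j)) (odd (cs ! c ! j)))}) []"
  unfolding CLAUSE_LITS_def
proof (intro adds_FOR0)
  fix j assume j: "j < length (cs ! c)"
  show "adds (EDGE (Add (Reg 10) (Add (Reg 20) (Reg 20)))
     (Add (Add (Reg 11) (Add pos_exp pos_exp)) (Cell 6 (Cell 0 (Add (Reg 34) (Reg 22))))))
     ((22, j) # clause_regs c) {(ClauseV c False, LitV (pos (cs ! c ! j)) (odd (cs ! c ! j)))} []"
  proof (intro adds_EDGE evalsI)
    fix st assume "Env st" "holds ((22, j) # clause_regs c) st"
    then show "eval_exp (Add (Add (Reg 11) (Add pos_exp pos_exp)) (Cell 6 (Cell 0 (Add (Reg 34) (Reg 22))))) st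
        = idx (LitV (pos (cs ! c ! j)) (odd (cs ! c ! j)))"
      using eval_lit_exps(2,3)[of st c j] c j by (simp add: env)
  qed (use c j pos_lt[OF clause_lit[OF c j]] in \<open>auto simp: env pos_exp_def variable_exp_def\<close>)
qed (use c len_le[of "cs ! c"] in \<open>auto simp: modr_EDGE intro!: evalsI\<close>)

definition clause_edges :: "nat \<Rightarrow> (vtx \<times> vtx) set" where
  "clause_edges c = (\<Union>b<3 * s. if b \<in> bucket ` set (cs ! c) then {}
     else {(ClauseV c False, BucketV b)} \<union> {(ClauseV c True, BucketV b)}) \<union>
     (\<Union>j<length (cs ! c). {(ClauseV c False, LitV (pos (cs ! c ! j)) (odd (cs ! c ! j)))})"

lemma modr_CLAUSE: "modr CLAUSE_BUCKETS = {21, 22, 36}" "modr CLAUSE_LITS = {22}"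
  by (auto simp: CLAUSE_BUCKETS_def CLAUSE_LITS_def modr_FOR modr_EDGE)

lemma adds_CLAUSES: "adds CLAUSES [] (\<Union>c<K. clause_edges c) []"
proof -
  have *: "adds (FOR 20 (Reg 3) (Seq (Assign 35 (Cell 0 (Reg 34))) (Seq (Assign 34 (Add (Reg 34) (Const 1)))
     (Seq (Seq CLAUSE_BUCKETS CLAUSE_LITS) (Assign 34 (Add (Reg 34) (Reg 35))))))) ([(34, start 0)] @ [])
     (\<Union>c<K. clause_edges c) [(34, start K)]"
  proof (rule adds_FOR[where H = "\<lambda>c. [(34, start c)]"])
    fix c assume c: "c < K"
    have "adds (Seq CLAUSE_BUCKETS CLAUSE_LITS) (clause_regs c) (clause_edges c) []"
      unfolding clause_edges_def using adds_CLAUSE_BUCKETS[OF c] adds_CLAUSE_LITS[OF c]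
      by (rule adds_Seq0) (simp add: modr_CLAUSE)
    moreover have "adds (Assign 34 (Add (Reg 34) (Reg 35))) (clause_regs c) {} [(34, start (Suc c))]"
      by (intro adds_Assign evalsI) (simp_all add: start_Suc[OF c])
    ultimately have rest: "adds (Seq (Seq CLAUSE_BUCKETS CLAUSE_LITS) (Assign 34 (Add (Reg 34) (Reg 35))))
        (clause_regs c) (clause_edges c \<union> {}) [(34, start (Suc c))]"
      by (rule adds_Seq0) (simp add: modr_CLAUSE)
    \<comment> \<open>Register 34 moves from the length field to the first literal, so the fact
      about its old value is dropped.\<close>
    have "adds (Assign 34 (Add (Reg 34) (Const 1)))
        [(35, length (cs ! c)), (20, c), (34, start c)] {} [(34, Suc (start c))]"
      by (intro adds_Assign evalsI) simp_all
    then have "adds (Seq (Assign 34 (Add (Reg 34) (Const 1)))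
        (Seq (Seq CLAUSE_BUCKETS CLAUSE_LITS) (Assign 34 (Add (Reg 34) (Reg 35)))))
        [(35, length (cs ! c)), (20, c), (34, start c)] ({} \<union> (clause_edges c \<union> {})) [(34, start (Suc c))]"
      using rest by (rule adds_Seq) auto
    then have rest: "adds (Seq (Assign 34 (Add (Reg 34) (Const 1)))
        (Seq (Seq CLAUSE_BUCKETS CLAUSE_LITS) (Assign 34 (Add (Reg 34) (Reg 35)))))
        [(35, length (cs ! c)), (20, c), (34, start c)] (clause_edges c) [(34, start (Suc c))]"
      by simp
    have "evals (Cell 0 (Reg 34)) [(20, c), (34, start c)] (length (cs ! c))"
      by (rule evalsI) (simp add: env input_clause(1)[OF c])
    from adds_Let[OF this rest]
    show "adds (Seq (Assign 35 (Cell 0 (Reg 34))) (Seq (Assign 34 (Add (Reg 34) (Const 1)))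
       (Seq (Seq CLAUSE_BUCKETS CLAUSE_LITS) (Assign 34 (Add (Reg 34) (Reg 35))))))
       ((20, c) # [(34, start c)] @ []) (clause_edges c) [(34, start (Suc c))]"
      by simp
  qed (use bounds V in \<open>auto simp: env modr_CLAUSE intro!: evalsI\<close>)
  show ?thesis
    unfolding CLAUSES_def
    by (rule adds_Let[where x = "start 0", OF _ adds_weaken[OF *]]) (auto intro: evalsI simp: start_def)
qed

end

section \<open>The edges written are those of the graph\<close>

definition EDGES :: com where
  "EDGES = Seq BITS (Seq GUARDS (Seq ASGS (Seq CLAUSES (Seq PAIRCODES SINGLECODES))))"

context edge_phase
begin

definition all_edges :: "(vtx \<times> vtx) set" where
  "all_edges = (\<Union>i<m. {(Pendant i False, BitV i)} \<union> ({(Pendant i True, BitV i)} \<union>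
       (\<Union>j<i. {(BitV i, BitV j)}))) \<union>
     ((\<Union>b<3 * s. \<Union>b'<3 * s. {(Guard b False, BucketV b')} \<union>
       (if b \<noteq> b' then {(Guard b True, BucketV b')} else {})) \<union>
     ((\<Union>b<3 * s. \<Union>a<2 ^ s. asg_edges b a) \<union> ((\<Union>c<K. clause_edges c) \<union>
     ((\<Union>i<3 * s + K. code_edges (twin i False) (idx (twin i False)) \<union>
       code_edges (twin i True) (idx (twin i False))) \<union>
     (\<Union>i<9 * s. code_edges (single i) (idx (single i)))))))"

lemma adds_EDGES: "adds EDGES [] all_edges []"
  unfolding EDGES_def all_edges_def
  by (intro adds_Seq0 adds_BITS adds_GUARDS adds_ASGS adds_CLAUSES adds_PAIRCODES adds_SINGLECODES)
     simp_all

lemma code_edges_twin: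
  "code_edges (twin i x) (idx (twin i False)) = {(twin i x, BitV j) |j. j \<in> code (twin i x)}"
  by (auto simp: code_edges_def twin_def)

lemma code_edges_single:
  "code_edges (single i) (idx (single i)) = {(single i, BitV j) |j. j \<in> code (single i)}"
  unfolding code_edges_def single_def by (cases "i < 6 * s") auto

lemma arc_cover: "arc x y \<Longrightarrow> (\<exists>j. y = BitV j) \<or> (\<exists>b. y = BucketV b) \<or> (\<exists>h z. y = LitV h z)"
  by (cases y; cases x) auto

lemma twin_code_edge:
  assumes "i < 3 * s + K" "j \<in> code (twin i x)" shows "(twin i x, BitV j) \<in> all_edges"
proof -
  have "(twin i x, BitV j) \<in> code_edges (twin i False) (idx (twin i False)) \<union>
      code_edges (twin i True) (idx (twin i False))"
    using assms(2) by (cases x) (simp_all add: code_edges_twin)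
  then have "(twin i x, BitV j) \<in> (\<Union>i<3 * s + K. code_edges (twin i False) (idx (twin i False)) \<union>
      code_edges (twin i True) (idx (twin i False)))"
    by (rule UN_I[rotated]) (use assms(1) in simp)
  then show ?thesis
    unfolding all_edges_def by (rule UnI2[OF UnI2[OF UnI2[OF UnI2[OF UnI1]]]])
qed

lemma single_code_edge:
  assumes "i < 9 * s" "j \<in> code (single i)" shows "(single i, BitV j) \<in> all_edges"
proof -
  have "(single i, BitV j) \<in> (\<Union>i<9 * s. code_edges (single i) (idx (single i)))"
    using assms by (auto simp: code_edges_single)
  then show ?thesis unfolding all_edges_def by blast
qed

lemma all_edges_adj:
  assumes "valid u" "valid v"
  shows "(u, v) \<in> all_edges \<or> (v, u) \<in> all_edges \<longleftrightarrow> adj u v"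
proof
  assume "(u, v) \<in> all_edges \<or> (v, u) \<in> all_edges"
  moreover have "adj x y" if "(x, y) \<in> all_edges" for x y
    using that unfolding all_edges_def
  proof (elim UnE)
    assume "(x, y) \<in> (\<Union>i<m. {(Pendant i False, BitV i)} \<union> ({(Pendant i True, BitV i)} \<union>
       (\<Union>j<i. {(BitV i, BitV j)})))"
    then show ?thesis by (auto simp: adj_def)
  next
    assume "(x, y) \<in> (\<Union>b<3 * s. \<Union>b'<3 * s. {(Guard b False, BucketV b')} \<union>
       (if b \<noteq> b' then {(Guard b True, BucketV b')} else {}))"
    then show ?thesis by (auto simp: adj_def split: if_splits)
  next
    assume "(x, y) \<in> (\<Union>b<3 * s. \<Union>a<2 ^ s. asg_edges b a)"
    then show ?thesis using s_pos by (auto simp: adj_def asg_edges_def)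
  next
    assume "(x, y) \<in> (\<Union>c<K. clause_edges c)"
    then show ?thesis
      by (auto simp: adj_def clause_edges_def split: if_splits) (metis nth_mem)+
  next
    assume "(x, y) \<in> (\<Union>i<3 * s + K. code_edges (twin i False) (idx (twin i False)) \<union>
       code_edges (twin i True) (idx (twin i False)))"
    then show ?thesis by (auto simp: adj_def code_edges_twin)
  next
    assume "(x, y) \<in> (\<Union>i<9 * s. code_edges (single i) (idx (single i)))"
    then show ?thesis by (auto simp: adj_def code_edges_single)
  qed
  ultimately show "adj u v" using adj_sym by blast
next
  \<comment> \<open>The target of an arc leaves three cases, and its source then determines the
    phase that writes the edge.\<close>
  have "(x, y) \<in> all_edges \<or> (y, x) \<in> all_edges" if xy: "arc x y" "valid x" "valid y" for x y
    using arc_cover[OF xy(1)]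
  proof (elim disjE exE)
    fix j assume BitV: "y = BitV j"
    show ?thesis
    proof (cases x)
      case x: (BitV i)
      \<comment> \<open>Clique edges are written only from the larger number to the smaller
        one.\<close>
      with xy BitV have "j < i \<or> i < j" by auto
      with xy show ?thesis by (auto simp: all_edges_def BitV x)
    next
      case x: (Pendant i z)
      with xy BitV show ?thesis by (cases z) (auto simp: all_edges_def)
    next
      case x: (Guard b z)
      then show ?thesis
        using xy BitV twin_code_edge[of b j z] by (simp add: twin_def)
    next
      case x: (ClauseV c z)
      then show ?thesis
        using xy BitV twin_code_edge[of "3 * s + c" j z] by (simp add: twin_def)
    next
      case x: (LitV h z)
      then have "x = single (2 * h + of_bool z)" "2 * h + of_bool z < 9 * s"
        using xy by (auto simp: single_def)
      then show ?thesis
        using xy BitV single_code_edge[of "2 * h + of_bool z" j] by simp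
    next
      case x: (BucketV b)
      then show ?thesis
        using xy BitV single_code_edge[of "6 * s + b" j] by (simp add: single_def)
    next
      case x: (AsgV b a)
      then have "(x, y) \<in> asg_edges b a" using xy BitV by (auto simp: asg_edges_def)
      with xy x show ?thesis by (auto simp: all_edges_def)
    qed
  next
    fix b' assume BucketV: "y = BucketV b'"
    show ?thesis
    proof (cases x)
      case x: (Guard b z)
      then have "(x, y) \<in> {(Guard b False, BucketV b')} \<union>
          (if b \<noteq> b' then {(Guard b True, BucketV b')} else {})" and "b \<in> {..<3 * s}" "b' \<in> {..<3 * s}"
        using xy BucketV by (cases z, auto)
      then have "(x, y) \<in> (\<Union>b<3 * s. \<Union>b'<3 * s. {(Guard b False, BucketV b')} \<union>
          (if b \<noteq> b' then {(Guard b True, BucketV b')} else {}))"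
        by (intro UN_I)
      then show ?thesis unfolding all_edges_def by (rule disjI1[OF UnI2[OF UnI1]])
    next
      case x: (AsgV b a)
      then have "(x, y) \<in> asg_edges b a" using xy BucketV by (auto simp: asg_edges_def)
      with xy x show ?thesis by (auto simp: all_edges_def)
    next
      case x: (ClauseV c z)
      then have "(x, y) \<in> clause_edges c"
        using xy BucketV by (cases z) (auto simp: clause_edges_def intro!: bexI[of _ b'])
      with xy x show ?thesis by (auto simp: all_edges_def)
    qed (use xy BucketV in auto)
  next
    fix h z assume LitV: "y = LitV h z"
    show ?thesis
    proof (cases x)
      case x: (AsgV b a)
      \<comment> \<open>The position is in the class of bucket \<open>b\<close>, so
        \<open>h mod s\<close> is the round of the loop that writes this edge.\<close>
      then have "h = b div s * s + h mod s" using xy LitV by (metis arc.simps(4) div_mult_mod_eq)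
      then have "(x, y) \<in> asg_edges b a" using xy x LitV s_pos
        by (auto simp: asg_edges_def intro!: bexI[of _ "h mod s"])
      with xy x show ?thesis by (auto simp: all_edges_def)
    next
      case x: (ClauseV c w)
      with xy LitV obtain l where l: "l \<in> set (cs ! c)" "h = pos l" "z = odd l" "\<not> w" by auto
      then obtain j where "j < length (cs ! c)" "l = cs ! c ! j" by (metis in_set_conv_nth)
      with l x LitV have "(x, y) \<in> clause_edges c" by (auto simp: clause_edges_def)
      with xy x show ?thesis by (auto simp: all_edges_def)
    qed (use xy LitV in auto)
  qed
  moreover assume "adj u v"
  ultimately show "(u, v) \<in> all_edges \<or> (v, u) \<in> all_edges"
    using assms unfolding adj_def by blast
qed

end

definition FINISH :: com where
  "FINISH = Seq (Store 1 (Const 0) (Reg 14)) (Store 1 (Const 1) (Add (Reg 8) (Reg 16)))"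

context edge_phase
begin

lemma wp_EDGES_FINISH:
  assumes "Inv {} st"
  shows "wp V (Seq EDGES FINISH) (\<lambda>st'. outputs_md st' G (m + 3 * s)) st"
proof (rule wp_Seq)
  have "wp V EDGES (\<lambda>st'. Inv ({} \<union> all_edges) st' \<and> holds [] st') st"
    using adds_EDGES assms unfolding adds_def by (metis holds_simps(1))
  then have "wp V EDGES (\<lambda>st'. Inv all_edges st') st" by simp
  then show "wp V EDGES (wp V FINISH (\<lambda>st'. outputs_md st' G (m + 3 * s))) st"
  proof (rule wp_mono)
    fix st' assume st': "Inv all_edges st'"
    then have regs: "regs st' 14 = p" "regs st' 8 = m" "regs st' 16 = 3 * s"
      by (simp_all add: Inv_reg \<rho>)
    have mat: "arrays st' 1 (2 + i * p + j) = (if {i, j} \<in> edges G then 1 else 0)" if ij: "i < p" "j < p" for i j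
    proof -
      have "i \<in> verts G" "j \<in> verts G" using ij by (simp_all add: verts_G)
      then obtain u v where "i = idx u" "j = idx v" "valid u" "valid v" by (auto simp: G_def)
      with st' show ?thesis by (simp add: Inv_def all_edges_adj edge_iff)
    qed
    have "outputs_md (set_cell 1 1 (m + 3 * s) (set_cell 1 0 p st')) G (m + 3 * s)"
      using mat by (simp add: outputs_md_def verts_G)
    with regs show "wp V FINISH (\<lambda>st'. outputs_md st' G (m + 3 * s)) st'"
      unfolding FINISH_def by (intro wp_Seq wp_Store) simp
  qed
qed

end

section \<open>Tables for multiplication and division\<close>

definition MULTAB :: "nat \<Rightarrow> exp \<Rightarrow> exp \<Rightarrow> exp \<Rightarrow> com" where
  "MULTAB a e0 ef en = Seq (Store a (Const 0) e0)
     (FOR 20 en (Store a (Add (Reg 20) (Const 1)) (Add (Cell a (Reg 20)) ef)))"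

text \<open>Quotient and remainder are counted up together: the remainder returns to 0 after
  \<open>e - 1\<close>, which is when the quotient grows.\<close>

definition DIVTAB :: "nat \<Rightarrow> nat \<Rightarrow> exp \<Rightarrow> exp \<Rightarrow> com" where
  "DIVTAB a b e en = Seq (Store a (Const 0) (Const 0)) (Seq (Store b (Const 0) (Const 0))
     (FOR 20 en (IfNZ (Sub (Sub e (Const 1)) (Cell b (Reg 20)))
       (Seq (Store a (Add (Reg 20) (Const 1)) (Cell a (Reg 20)))
         (Store b (Add (Reg 20) (Const 1)) (Add (Cell b (Reg 20)) (Const 1))))
       (Seq (Store a (Add (Reg 20) (Const 1)) (Add (Cell a (Reg 20)) (Const 1)))
         (Store b (Add (Reg 20) (Const 1)) (Const 0))))))"

definition same_except :: "nat set \<Rightarrow> nat set \<Rightarrow> state \<Rightarrow> state \<Rightarrow> bool" where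
  "same_except R A st st' \<longleftrightarrow> (\<forall>r. r \<notin> R \<longrightarrow> regs st' r = regs st r) \<and>
     (\<forall>a. a \<notin> A \<longrightarrow> arrays st' a = arrays st a)"

lemma wp_MULTAB:
  assumes N: "N \<le> V"
    and ev: "\<And>st'. same_except {20} {a} st st' \<Longrightarrow> eval_exp ef st' = f \<and> eval_exp en st' = N"
    and Q: "\<And>st'. same_except {20} {a} st st' \<Longrightarrow>
      (\<forall>i\<le>N. arrays st' a i = eval_exp e0 st + i * f) \<Longrightarrow> Q st'"
  shows "wp V (MULTAB a e0 ef en) Q st"
  unfolding MULTAB_def
proof (intro wp_Seq wp_Store)
  let ?I = "\<lambda>n st'. same_except {20} {a} st st' \<and> (\<forall>i\<le>n. arrays st' a i = eval_exp e0 st + i * f)"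
  show "wp V (FOR 20 en (Store a (Add (Reg 20) (Const 1)) (Add (Cell a (Reg 20)) ef))) Q
     (set_cell a (eval_exp (Const 0) st) (eval_exp e0 st) st)"
  proof (rule wp_FOR[where I = ?I, OF N])
    fix i st' assume "i < N" and I: "?I i st'" and r: "regs st' 20 = i"
    have "eval_exp ef st' = f" using ev I by blast
    then show "wp V (Store a (Add (Reg 20) (Const 1)) (Add (Cell a (Reg 20)) ef))
        (\<lambda>st''. regs st'' 20 = i \<and> ?I (Suc i) (set_reg 20 (Suc i) st'')) st'"
      using I r by (intro wp_Store) (auto simp: same_except_def le_Suc_eq)
  qed (use ev Q in \<open>auto simp: same_except_def\<close>)
qed

lemma wp_DIVTAB:
  assumes N: "N \<le> V" and "a \<noteq> b" and d: "0 < d"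
    and ev: "\<And>st'. same_except {20} {a, b} st st' \<Longrightarrow> eval_exp e st' = d \<and> eval_exp en st' = N"
    and Q: "\<And>st'. same_except {20} {a, b} st st' \<Longrightarrow>
      (\<forall>i\<le>N. arrays st' a i = i div d \<and> arrays st' b i = i mod d) \<Longrightarrow> Q st'"
  shows "wp V (DIVTAB a b e en) Q st"
  unfolding DIVTAB_def
proof (intro wp_Seq wp_Store)
  let ?I = "\<lambda>n st'. same_except {20} {a, b} st st' \<and>
     (\<forall>i\<le>n. arrays st' a i = i div d \<and> arrays st' b i = i mod d)"
  let ?st = "set_cell a (eval_exp (Const 0) st) (eval_exp (Const 0) st) st"
  show "wp V (FOR 20 en (IfNZ (Sub (Sub e (Const 1)) (Cell b (Reg 20)))
       (Seq (Store a (Add (Reg 20) (Const 1)) (Cell a (Reg 20)))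
         (Store b (Add (Reg 20) (Const 1)) (Add (Cell b (Reg 20)) (Const 1))))
       (Seq (Store a (Add (Reg 20) (Const 1)) (Add (Cell a (Reg 20)) (Const 1)))
         (Store b (Add (Reg 20) (Const 1)) (Const 0))))) Q
     (set_cell b (eval_exp (Const 0) ?st) (eval_exp (Const 0) ?st) ?st)"
  proof (rule wp_FOR[where I = ?I, OF N])
    fix i st' assume "i < N" and I: "?I i st'" and r: "regs st' 20 = i"
    have ei: "eval_exp e st' = d" using ev I by blast
    have ai: "arrays st' a i = i div d" "arrays st' b i = i mod d" using I by auto
    show "wp V (IfNZ (Sub (Sub e (Const 1)) (Cell b (Reg 20)))
       (Seq (Store a (Add (Reg 20) (Const 1)) (Cell a (Reg 20)))
         (Store b (Add (Reg 20) (Const 1)) (Add (Cell b (Reg 20)) (Const 1))))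
       (Seq (Store a (Add (Reg 20) (Const 1)) (Add (Cell a (Reg 20)) (Const 1)))
         (Store b (Add (Reg 20) (Const 1)) (Const 0))))
        (\<lambda>st''. regs st'' 20 = i \<and> ?I (Suc i) (set_reg 20 (Suc i) st'')) st'"
    proof (intro wp_IfNZ wp_Seq wp_Store, goal_cases)
      case 1
      then have "Suc (i mod d) \<noteq> d" using r ei ai by simp
      then show ?case using I r ai assms(2)
        by (auto simp: same_except_def le_Suc_eq mod_Suc div_Suc)
    next
      case 2
      then have "Suc (i mod d) = d" using r ei ai d mod_less_divisor[OF d, of i] by simp
      then show ?case using I r ai assms(2)
        by (auto simp: same_except_def le_Suc_eq mod_Suc div_Suc)
    qed
  qed (use ev Q assms(2) in \<open>auto simp: same_except_def\<close>)
qed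

section \<open>Parameters and the whole program\<close>

text \<open>Register 5 is kept equal to the square of register 4 by adding twice the root plus 1,
  until it exceeds \<open>n\<close>; this computes the root without multiplication.\<close>

definition SIZES :: com where
  "SIZES = Seq (Assign 2 (Cell 0 (Const 0))) (Seq (Assign 3 (Cell 0 (Const 1)))
     (Seq (WhileNZ (Sub (Add (Reg 2) (Const 1)) (Reg 5))
       (Seq (Assign 5 (Add (Add (Reg 5) (Add (Reg 4) (Reg 4))) (Const 1)))
         (Assign 4 (Add (Reg 4) (Const 1)))))
     (Seq (Assign 6 (Const 1)) (FOR 20 (Reg 4) (Assign 6 (Add (Reg 6) (Reg 6)))))))"

text \<open>With truncated subtraction, \<open>n + (1 - n)\<close> is the maximum of
  \<open>n\<close> and 1, as required for the divisor \<open>d\<close>.\<close>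

definition OFFSETS :: com where
  "OFFSETS = Seq (Assign 17 (Add (Reg 2) (Sub (Const 1) (Reg 2))))
     (Seq (Assign 16 (Add (Reg 4) (Add (Reg 4) (Reg 4))))
     (Seq (Assign 7 (Add (Add (Reg 16) (Reg 16)) (Const 12)))
     (Seq (Assign 8 (Add (Add (Reg 7) (Reg 7)) (Const 2)))
     (Seq (Assign 9 (Add (Reg 8) (Add (Reg 8) (Reg 8))))
     (Seq (Assign 10 (Add (Reg 9) (Add (Reg 16) (Reg 16))))
     (Seq (Assign 11 (Add (Reg 10) (Add (Reg 3) (Reg 3))))
     (Seq (Assign 12 (Add (Reg 11) (Add (Reg 16) (Reg 16))))
     (Seq (Assign 13 (Add (Reg 12) (Reg 16)))
     (Seq (Assign 18 (Add (Reg 16) (Reg 3)))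
       (Assign 19 (Add (Reg 16) (Add (Reg 16) (Reg 16)))))))))))))"

text \<open>Array 2 runs one entry past the last bucket, and this entry is \<open>p\<close>; the
  product \<open>3 * s * 2 ^ s\<close> is thus obtained by repeated addition.\<close>

definition TABLES :: com where
  "TABLES = Seq (MULTAB 2 (Reg 13) (Reg 6) (Reg 16)) (Seq (Assign 14 (Cell 2 (Reg 16)))
     (Seq (Assign 15 (Add (Reg 14) (Add (Add (Reg 17) (Add (Reg 17) (Reg 17)))
       (Add (Reg 17) (Add (Reg 17) (Reg 17))))))
     (Seq (MULTAB 3 (Const 2) (Reg 14) (Reg 15)) (Seq (MULTAB 4 (Const 0) (Reg 4) (Reg 15))
     (Seq (DIVTAB 5 6 (Const 2) (Reg 15)) (Seq (DIVTAB 7 8 (Reg 4) (Reg 15))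
       (DIVTAB 9 10 (Reg 17) (Reg 15))))))))"

definition PROG :: com where
  "PROG = Seq SIZES (Seq OFFSETS (Seq TABLES (Seq EDGES FINISH)))"

lemma wp_SIZES:
  assumes s: "(s - 1) * (s - 1) \<le> n" "n < s * s" and V: "n + 1 \<le> V" "s \<le> V"
    and Q: "\<And>st. regs st 2 = n \<Longrightarrow> regs st 3 = K \<Longrightarrow> regs st 4 = s \<Longrightarrow> regs st 6 = 2 ^ s \<Longrightarrow>
      arrays st = arrays (initial_state (n # K # xs)) \<Longrightarrow> Q st"
  shows "wp V SIZES Q (initial_state (n # K # xs))"
  unfolding SIZES_def
proof (intro wp_Seq wp_Assign)
  let ?ar = "arrays (initial_state (n # K # xs))"
  let ?I = "\<lambda>st. regs st 2 = n \<and> regs st 3 = K \<and> regs st 5 = regs st 4 * regs st 4 \<and> regs st 4 \<le> s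
      \<and> arrays st = ?ar"
  let ?st = "set_reg 2 (eval_exp (Cell 0 (Const 0)) (initial_state (n # K # xs))) (initial_state (n # K # xs))"
  show "wp V (WhileNZ (Sub (Add (Reg 2) (Const 1)) (Reg 5))
       (Seq (Assign 5 (Add (Add (Reg 5) (Add (Reg 4) (Reg 4))) (Const 1)))
         (Assign 4 (Add (Reg 4) (Const 1)))))
     (wp V (Seq (Assign 6 (Const 1)) (FOR 20 (Reg 4) (Assign 6 (Add (Reg 6) (Reg 6))))) Q)
     (set_reg 3 (eval_exp (Cell 0 (Const 1)) ?st) ?st)"
  proof (rule wp_WhileNZ[where I = ?I and f = "\<lambda>st. n + 1 - regs st 5"])
    fix st assume I: "?I st" and nz: "eval_exp (Sub (Add (Reg 2) (Const 1)) (Reg 5)) st \<noteq> 0"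
    then have "regs st 4 * regs st 4 \<le> n" by simp
    then have "regs st 4 < s"
      using s(2) mult_le_mono[of s "regs st 4" s "regs st 4"] by (meson leD leI le_less_trans)
    then show "wp V (Seq (Assign 5 (Add (Add (Reg 5) (Add (Reg 4) (Reg 4))) (Const 1)))
         (Assign 4 (Add (Reg 4) (Const 1)))) (\<lambda>st'. ?I st' \<and> n + 1 - regs st' 5 < n + 1 - regs st 5) st"
      using I nz by (intro wp_Seq wp_Assign) auto
  next
    fix st assume I: "?I st" and z: "eval_exp (Sub (Add (Reg 2) (Const 1)) (Reg 5)) st = 0"
    then have "n < regs st 4 * regs st 4" by simp
    then have "\<not> regs st 4 \<le> s - 1"
      using s(1) mult_le_mono[of "regs st 4" "s - 1" "regs st 4" "s - 1"] by (meson leD order_trans)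
    with I have r4: "regs st 4 = s" by linarith
    show "wp V (Seq (Assign 6 (Const 1)) (FOR 20 (Reg 4) (Assign 6 (Add (Reg 6) (Reg 6))))) Q st"
    proof (intro wp_Seq wp_Assign wp_FOR[where n = s and I = "\<lambda>i st. regs st 2 = n \<and> regs st 3 = K \<and>
        regs st 4 = s \<and> regs st 6 = 2 ^ i \<and> arrays st = ?ar"])
    qed (use I r4 V Q in \<open>auto intro!: wp_Assign\<close>)
  qed (use V in \<open>auto simp: initial_state_def\<close>)
qed

context reduction
begin

definition sizes_set :: "state \<Rightarrow> bool" where
  "sizes_set st \<longleftrightarrow> regs st 3 = K \<and> regs st 4 = s \<and> regs st 6 = 2 ^ s \<and> regs st 7 = M \<and> regs st 8 = m
     \<and> regs st 9 = oP \<and> regs st 10 = oC \<and> regs st 11 = oL \<and> regs st 12 = oB \<and> regs st 13 = oA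
     \<and> regs st 16 = 3 * s \<and> regs st 17 = d \<and> regs st 18 = 3 * s + K \<and> regs st 19 = 9 * s"

lemma wp_OFFSETS:
  assumes "M = 6 * s + 12" "d = max n 1"
    and "regs st 2 = n" "regs st 3 = K" "regs st 4 = s" "regs st 6 = 2 ^ s"
  shows "wp V OFFSETS (\<lambda>st'. sizes_set st' \<and> arrays st' = arrays st) st"
proof -
  have d: "d = n + (1 - n)" using assms(2) by simp
  show ?thesis
    unfolding OFFSETS_def
    apply (rule wp_Seq, rule wp_Assign_eq[where x = d], simp add: assms(3) d)
    apply (rule wp_Seq, rule wp_Assign_eq[where x = "3 * s"], simp add: assms(5))
    apply (rule wp_Seq, rule wp_Assign_eq[where x = M], simp add: assms(1))
    apply (rule wp_Seq, rule wp_Assign_eq[where x = m], simp add: m_def)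
    apply (rule wp_Seq, rule wp_Assign_eq[where x = oP], simp add: oP_def)
    apply (rule wp_Seq, rule wp_Assign_eq[where x = oC], simp add: oC_def)
    apply (rule wp_Seq, rule wp_Assign_eq[where x = oL], simp add: assms(4) oL_def)
    apply (rule wp_Seq, rule wp_Assign_eq[where x = oB], simp add: oB_def)
    apply (rule wp_Seq, rule wp_Assign_eq[where x = oA], simp add: oA_def)
    apply (rule wp_Seq, rule wp_Assign_eq[where x = "3 * s + K"], simp add: assms(4))
    apply (rule wp_Assign_eq[where x = "9 * s"], simp)
    apply (simp add: sizes_set_def assms(4-6))
    done
qed

text \<open>The stage \<open>k\<close> counts the table-building steps after array 2, so that each
  step only adds one conjunct.\<close>

definition tables_upto :: "nat \<Rightarrow> (nat \<Rightarrow> nat \<Rightarrow> nat) \<Rightarrow> state \<Rightarrow> bool" where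
  "tables_upto k \<alpha> st \<longleftrightarrow> sizes_set st \<and> regs st 14 = p \<and> regs st 15 = p + 6 * d
     \<and> arrays st 0 = \<alpha> 0 \<and> arrays st 1 = \<alpha> 1
     \<and> (\<forall>i\<le>3 * s. arrays st 2 i = oA + i * 2 ^ s)
     \<and> (1 \<le> k \<longrightarrow> (\<forall>i\<le>p + 6 * d. arrays st 3 i = 2 + i * p))
     \<and> (2 \<le> k \<longrightarrow> (\<forall>i\<le>p + 6 * d. arrays st 4 i = i * s))
     \<and> (3 \<le> k \<longrightarrow> (\<forall>i\<le>p + 6 * d. arrays st 5 i = i div 2 \<and> arrays st 6 i = i mod 2))
     \<and> (4 \<le> k \<longrightarrow> (\<forall>i\<le>p + 6 * d. arrays st 7 i = i div s \<and> arrays st 8 i = i mod s))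
     \<and> (5 \<le> k \<longrightarrow> (\<forall>i\<le>p + 6 * d. arrays st 9 i = i div d \<and> arrays st 10 i = i mod d))"

lemma wp_TABLES:
  assumes V: "p + 6 * d \<le> V" and st: "sizes_set st"
  shows "wp V TABLES (tables_upto 5 (arrays st)) st"
proof -
  have step0: "wp V (MULTAB 2 (Reg 13) (Reg 6) (Reg 16)) (\<lambda>st'. sizes_set st' \<and> arrays st' 0 = arrays st 0
      \<and> arrays st' 1 = arrays st 1 \<and> (\<forall>i\<le>3 * s. arrays st' 2 i = oA + i * 2 ^ s)) st"
    by (rule wp_MULTAB[where N = "3 * s" and f = "2 ^ s"])
       (use V st in \<open>auto simp: sizes_set_def same_except_def p_def oA_def\<close>)
  have step1: "wp V (MULTAB 3 (Const 2) (Reg 14) (Reg 15)) (tables_upto 1 \<alpha>) st"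
    if "tables_upto 0 \<alpha> st" for st \<alpha>
    by (rule wp_MULTAB[where N = "p + 6 * d" and f = p])
       (use V that in \<open>auto simp: tables_upto_def sizes_set_def same_except_def\<close>)
  have step2: "wp V (MULTAB 4 (Const 0) (Reg 4) (Reg 15)) (tables_upto 2 \<alpha>) st"
    if "tables_upto 1 \<alpha> st" for st \<alpha>
    by (rule wp_MULTAB[where N = "p + 6 * d" and f = s])
       (use V that in \<open>auto simp: tables_upto_def sizes_set_def same_except_def\<close>)
  have step3: "wp V (DIVTAB 5 6 (Const 2) (Reg 15)) (tables_upto 3 \<alpha>) st"
    if "tables_upto 2 \<alpha> st" for st \<alpha>
    by (rule wp_DIVTAB[where N = "p + 6 * d" and d = 2])
       (use V that in \<open>auto simp: tables_upto_def sizes_set_def same_except_def\<close>)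
  have step4: "wp V (DIVTAB 7 8 (Reg 4) (Reg 15)) (tables_upto 4 \<alpha>) st"
    if "tables_upto 3 \<alpha> st" for st \<alpha>
    by (rule wp_DIVTAB[where N = "p + 6 * d" and d = s])
       (use V s_pos that in \<open>auto simp: tables_upto_def sizes_set_def same_except_def\<close>)
  have step5: "wp V (DIVTAB 9 10 (Reg 17) (Reg 15)) (tables_upto 5 \<alpha>) st"
    if "tables_upto 4 \<alpha> st" for st \<alpha>
    by (rule wp_DIVTAB[where N = "p + 6 * d" and d = d])
       (use V d_pos that in \<open>auto simp: tables_upto_def sizes_set_def same_except_def\<close>)
  have rest: "wp V (Seq (MULTAB 4 (Const 0) (Reg 4) (Reg 15)) (Seq (DIVTAB 5 6 (Const 2) (Reg 15))
      (Seq (DIVTAB 7 8 (Reg 4) (Reg 15)) (DIVTAB 9 10 (Reg 17) (Reg 15))))) (tables_upto 5 \<alpha>) st"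
    if "tables_upto 1 \<alpha> st" for st \<alpha>
    by (intro wp_Seq wp_mono[OF step2[OF that]] wp_mono[OF step3] wp_mono[OF step4] step5)
  show ?thesis
    unfolding TABLES_def
  proof (rule wp_Seq, rule wp_mono[OF step0], intro wp_Seq wp_Assign)
    fix st' assume *: "sizes_set st' \<and> arrays st' 0 = arrays st 0
      \<and> arrays st' 1 = arrays st 1 \<and> (\<forall>i\<le>3 * s. arrays st' 2 i = oA + i * 2 ^ s)"
    let ?st = "set_reg 14 (eval_exp (Cell 2 (Reg 16)) st') st'"
    let ?e = "Add (Reg 14) (Add (Add (Reg 17) (Add (Reg 17) (Reg 17))) (Add (Reg 17) (Add (Reg 17) (Reg 17))))"
    have "tables_upto 0 (arrays st) (set_reg 15 (eval_exp ?e ?st) ?st)"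
      using * by (simp add: tables_upto_def sizes_set_def p_def)
    then show "wp V (MULTAB 3 (Const 2) (Reg 14) (Reg 15)) (wp V (Seq (MULTAB 4 (Const 0) (Reg 4) (Reg 15))
        (Seq (DIVTAB 5 6 (Const 2) (Reg 15)) (Seq (DIVTAB 7 8 (Reg 4) (Reg 15))
        (DIVTAB 9 10 (Reg 17) (Reg 15))))) (tables_upto 5 (arrays st)))
        (set_reg 15 (eval_exp ?e ?st) ?st)"
      by (rule wp_mono[OF step1 rest])
  qed
qed

lemma wp_PROG:
  assumes M: "M = 6 * s + 12" and d: "d = max n 1" and V: "V = p + 6 * d"
    and s: "(s - 1) * (s - 1) \<le> n" "n < s * s"
    and len: "\<And>c. c \<in> set cs \<Longrightarrow> length c \<le> 3"
  shows "wp V PROG (\<lambda>st. outputs_md st G (m + 3 * s))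
    (initial_state (n # K # concat (map (\<lambda>c. length c # c) cs)))"
proof -
  let ?f = "\<lambda>c. length c # c"
  let ?st0 = "initial_state (n # K # concat (map ?f cs))"
  have s_le: "3 * s \<le> p" by (simp add: p_def oA_def oB_def)
  have step: "wp V (Seq EDGES FINISH) (\<lambda>st. outputs_md st G (m + 3 * s)) st"
    if "tables_upto 5 (arrays ?st0) st" for st
  proof -
    \<comment> \<open>The state reached after building the tables itself supplies
      \<open>\<rho>\<close> and \<open>\<alpha>\<close>.\<close>
    interpret edge_phase d s M cs V "regs st" "arrays st"
    proof unfold_locales
      show "p \<le> V" using V by simp
      show "length c \<le> V" if "c \<in> set cs" for c using len[OF that] s_le s_pos V by linarith
      show "arrays st 0 (2 + i) = concat (map ?f cs) ! i" if "i < length (concat (map ?f cs))" for i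
        using \<open>tables_upto 5 (arrays ?st0) st\<close> that by (simp add: tables_upto_def initial_state_def)
    qed (use that in \<open>auto simp: tables_upto_def sizes_set_def\<close>)
    have "Inv {} st"
      using that by (auto simp: Inv_def tables_upto_def initial_state_def)
    then show ?thesis by (rule wp_EDGES_FINISH)
  qed
  show ?thesis
    unfolding PROG_def
  proof (rule wp_Seq, rule wp_SIZES[OF s])
    show "n + 1 \<le> V" "s \<le> V" using V d s_le by auto
    fix st :: state
    assume st: "regs st 2 = n" "regs st 3 = K" "regs st 4 = s" "regs st 6 = 2 ^ s" "arrays st = arrays ?st0"
    show "wp V (Seq OFFSETS (Seq TABLES (Seq EDGES FINISH))) (\<lambda>st. outputs_md st G (m + 3 * s)) st"
    proof (rule wp_Seq, rule wp_mono[OF wp_OFFSETS[OF M d st(1-4)]], rule wp_Seq)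
      fix st' assume "sizes_set st' \<and> arrays st' = arrays st"
      then have "wp V TABLES (tables_upto 5 (arrays ?st0)) st'"
        using wp_TABLES[of V st'] V st(5) by simp
      then show "wp V TABLES (wp V (Seq EDGES FINISH) (\<lambda>st. outputs_md st G (m + 3 * s))) st'"
        by (rule wp_mono) (rule step)
    qed
  qed
qed

end

section \<open>Size estimates\<close>

text \<open>A set of at most three literals is a union of three optional ones. Since the clauses
  form a set, their number is polynomial in the number of variables.\<close>

lemma card_clauses_le:
  assumes "finite L" "\<And>C. C \<in> F \<Longrightarrow> C \<subseteq> L \<and> card C \<le> 3"
  shows "card F \<le> (card L + 1) ^ 3"
proof -
  let ?O = "insert None (Some ` L)"
  let ?f = "\<lambda>(a, b, c). set_option a \<union> set_option b \<union> set_option c"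
  have "C \<in> ?f ` (?O \<times> ?O \<times> ?O)" if "C \<in> F" for C
  proof -
    from assms that have C: "C \<subseteq> L" "card C \<le> 3" "finite C" by (auto dest: finite_subset)
    obtain xs where xs: "set xs = C" "length xs = card C" using C(3)
      by (metis finite_distinct_list distinct_card)
    have "length xs \<le> 3" using xs(2) C(2) by simp
    with xs(1) consider "C = {}" | a where "C = {a}" | a b where "C = {a, b}" | a b c where "C = {a, b, c}"
      by (cases xs; cases "tl xs"; cases "tl (tl xs)") auto
    then show ?thesis
    proof cases
      case 1 then show ?thesis by (intro image_eqI[of _ _ "(None, None, None)"]) auto
    next
      case (2 a) then show ?thesis using C by (intro image_eqI[of _ _ "(Some a, None, None)"]) auto
    next
      case (3 a b) then show ?thesis using C by (intro image_eqI[of _ _ "(Some a, Some b, None)"]) auto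
    next
      case (4 a b c) then show ?thesis using C by (intro image_eqI[of _ _ "(Some a, Some b, Some c)"]) auto
    qed
  qed
  then have "F \<subseteq> ?f ` (?O \<times> ?O \<times> ?O)" by blast
  then have "card F \<le> card (?f ` (?O \<times> ?O \<times> ?O))" using assms(1) by (intro card_mono) auto
  also have "\<dots> \<le> card (?O \<times> ?O \<times> ?O)" using assms(1) by (intro card_image_le) auto
  also have "\<dots> = (card L + 1) ^ 3"
  proof -
    have "card ?O = card L + 1" using assms(1) by (simp add: card_image)
    then show ?thesis by (simp only: card_cartesian_product power3_eq_cube mult.assoc)
  qed
  finally show ?thesis .
qed

text \<open>With \<open>x = 2 ^ s\<close> one has \<open>n < x ^ 2\<close>, so the cubic bound on
  \<open>K\<close> becomes \<open>216 * x ^ 6\<close>; this dictates the summand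
  \<open>6 * s\<close> of \<open>M\<close>. The summand 12 gives the factor 4096, which covers the
  constants.\<close>

lemma instance_size:
  assumes "1 \<le> s" "n < s * s" "K \<le> (6 * n + 1) ^ 3" "M = 6 * s + 12"
  shows "6 * M + 6 + 15 * s + 2 * K + 3 * s * 2 ^ s < (2::nat) ^ M"
proof -
  define x where "x = (2::nat) ^ s"
  have sx: "s < x" by (simp add: x_def)
  have x1: "1 \<le> x" by (simp add: x_def)
  have "s * s \<le> x * x" using sx by (intro mult_le_mono) auto
  then have "6 * n + 1 \<le> 6 * (x * x)" using assms(2) by linarith
  then have "K \<le> (6 * (x * x)) ^ 3" using assms(3) power_mono[of "6 * n + 1" "6 * (x * x)" 3] by linarith
  also have "\<dots> = 216 * x ^ 6" by (simp add: power_mult_distrib power2_eq_square[symmetric] power_mult[symmetric])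
  finally have K: "K \<le> 216 * x ^ 6" .
  have p1: "x \<le> x ^ 6" "1 \<le> x ^ 6" using x1 by (auto intro: self_le_power)
  have "s * 2 ^ s \<le> x * x" using sx by (auto simp: x_def)
  also have "\<dots> \<le> x ^ 6" using power_increasing[of 2 6 x] x1 by (simp add: power2_eq_square)
  finally have sp: "s * 2 ^ s \<le> x ^ 6" .
  have "(2::nat) ^ M = 4096 * x ^ 6" by (simp add: assms(4) x_def power_add power_mult[symmetric] mult.commute)
  moreover have "6 * M + 6 + 15 * s + 2 * K + 3 * s * 2 ^ s < 4096 * x ^ 6"
    using K p1 sp sx assms(4) by simp
  ultimately show ?thesis by simp
qed

lemma exists_bucket_size: "\<exists>s\<ge>1. (s - 1) * (s - 1) \<le> n \<and> n < s * (s::nat)"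
proof -
  define s where "s = (LEAST s. n < s * s)"
  have "n < Suc n * Suc n" by simp
  then have s: "n < s * s" unfolding s_def by (rule LeastI)
  then have "1 \<le> s" by (cases s) auto
  then have "\<not> n < (s - 1) * (s - 1)" unfolding s_def[symmetric]
    using not_less_Least[of "s - 1" "\<lambda>s. n < s * s"] by (simp add: s_def[symmetric])
  with s \<open>1 \<le> s\<close> show ?thesis by auto
qed

section \<open>Instances of 3-Partitioned-3-SAT\<close>

lemma var_of_lit_code: "lit_code num l div 2 = num (var_of l)"
  by (cases l) auto

lemma even_lit_code: "even (lit_code num l) \<longleftrightarrow> (\<exists>x. l = Pos x)"
  by (cases l) auto

lemma lit_true_iff: "lit_true \<sigma> l \<longleftrightarrow> \<sigma> (var_of l) = (\<exists>x. l = Pos x)"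
  by (cases l) auto

text \<open>The classes are numbered in consecutive blocks of length \<open>n\<close>, so division
  by \<open>n\<close> recovers the class, and the partition condition becomes a condition on
  numbers.\<close>

lemma psat_codes:
  assumes psat: "three_partitioned_3sat \<psi>" and enc: "encodes_psat \<psi> ws"
  obtains n cs where "card (variables \<psi>) = 3 * n"
    and "ws = n # length cs # concat (map (\<lambda>c. length c # c) cs)"
    and "length cs \<le> (6 * n + 1) ^ 3"
    and "\<forall>c\<in>set cs. length c \<le> 3"
    and "\<forall>c\<in>set cs. \<forall>l\<in>set c. l < 6 * n"
    and "\<forall>c\<in>set cs. \<forall>l\<in>set c. \<forall>l'\<in>set c.
      (l div 2) div n = (l' div 2) div n \<longrightarrow> l div 2 = l' div 2"
    and "satisfiable (clauses \<psi>) \<longleftrightarrow> (\<exists>\<tau>. \<forall>c\<in>set cs. \<exists>l\<in>set c. \<tau> (l div 2) = even l)"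
proof -
  define n where "n = card (X_alpha \<psi>)"
  from enc obtain num cls where
    bij: "bij_betw num (X_alpha \<psi>) {0..<n}" "bij_betw num (X_beta \<psi>) {n..<2 * n}"
      "bij_betw num (X_gamma \<psi>) {2 * n..<3 * n}"
    and cls: "distinct (map set cls)" "set (map set cls) = clauses \<psi>" "\<And>c. c \<in> set cls \<Longrightarrow> distinct c"
    and ws: "ws = n # length cls # concat (map (\<lambda>c. length c # map (lit_code num) c) cls)"
    unfolding encodes_psat_def n_def Let_def by blast
  define cs where "cs = map (map (lit_code num)) cls"
  have fin: "finite (variables \<psi>)"
    and disj: "X_alpha \<psi> \<inter> X_beta \<psi> = {}" "X_alpha \<psi> \<inter> X_gamma \<psi> = {}" "X_beta \<psi> \<inter> X_gamma \<psi> = {}"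
    and cnf: "\<And>C. C \<in> clauses \<psi> \<Longrightarrow> finite C \<and> card C \<le> 3"
    and vars: "\<And>C. C \<in> clauses \<psi> \<Longrightarrow> var_of ` C \<subseteq> variables \<psi>"
    and one: "\<And>C X. C \<in> clauses \<psi> \<Longrightarrow> X \<in> {X_alpha \<psi>, X_beta \<psi>, X_gamma \<psi>} \<Longrightarrow> card (var_of ` C \<inter> X) \<le> 1"
    using psat unfolding three_partitioned_3sat_def is_3cnf_def by blast+
  have "bij_betw num (X_alpha \<psi> \<union> X_beta \<psi> \<union> X_gamma \<psi>) ({0..<n} \<union> {n..<2 * n} \<union> {2 * n..<3 * n})"
    by (intro bij_betw_combine bij) auto
  moreover have "{0..<n} \<union> {n..<2 * n} \<union> {2 * n..<3 * n} = {0..<3 * n}" by auto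
  ultimately have num: "bij_betw num (variables \<psi>) {0..<3 * n}" by (simp add: variables_def)
  then have card: "card (variables \<psi>) = 3 * n" by (simp add: bij_betw_same_card)
  have cls_clause: "set c \<in> clauses \<psi>" if "c \<in> set cls" for c using cls(2) that by auto
  have num_lt: "num (var_of l) < 3 * n" if "c \<in> set cls" "l \<in> set c" for c l
    using vars[OF cls_clause[OF that(1)]] that(2) num by (fastforce simp: bij_betw_def)
  have input: "ws = n # length cs # concat (map (\<lambda>c. length c # c) cs)"
    by (simp add: ws cs_def o_def)
  have len: "length c \<le> 3" if "c \<in> set cs" for c
  proof -
    from that obtain c' where c': "c' \<in> set cls" "c = map (lit_code num) c'" by (auto simp: cs_def)
    then show ?thesis using cnf[OF cls_clause[OF c'(1)]] distinct_card[OF cls(3)[OF c'(1)]] by simp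
  qed
  have lits: "l < 6 * n" if "c \<in> set cs" "l \<in> set c" for c l
  proof -
    from that obtain c' l' where "c' \<in> set cls" "l' \<in> set c'" "l = lit_code num l'" by (auto simp: cs_def)
    then show ?thesis using num_lt[of c' l'] by (cases l') auto
  qed
  have unique: "l div 2 = l' div 2"
    if c: "c \<in> set cs" and l: "l \<in> set c" "l' \<in> set c" and cl: "(l div 2) div n = (l' div 2) div n" for c l l'
  proof -
    from c l obtain c' k k' where c': "c' \<in> set cls" "k \<in> set c'" "l = lit_code num k"
      "k' \<in> set c'" "l' = lit_code num k'" by (auto simp: cs_def)
    define v v' where "v = var_of k" and "v' = var_of k'"
    have v: "v \<in> variables \<psi>" "v' \<in> variables \<psi>"
      using vars[OF cls_clause[OF c'(1)]] c' by (auto simp: v_def v'_def)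
    have eq: "num v div n = num v' div n" using cl by (simp add: c' var_of_lit_code v_def v'_def)
    have num_class: "w \<in> X_alpha \<psi> \<Longrightarrow> num w div n = 0" "w \<in> X_beta \<psi> \<Longrightarrow> num w div n = 1"
      "w \<in> X_gamma \<psi> \<Longrightarrow> num w div n = 2" for w
      using bij_betw_apply[OF bij(1), of w] bij_betw_apply[OF bij(2), of w] bij_betw_apply[OF bij(3), of w]
      by (auto intro!: div_nat_eqI)
    have class_cases: "w \<in> X_alpha \<psi> \<and> num w div n = 0 \<or> w \<in> X_beta \<psi> \<and> num w div n = 1
        \<or> w \<in> X_gamma \<psi> \<and> num w div n = 2" if "w \<in> variables \<psi>" for w
      using that num_class[of w] unfolding variables_def by blast
    have "\<exists>X\<in>{X_alpha \<psi>, X_beta \<psi>, X_gamma \<psi>}. v \<in> X \<and> v' \<in> X"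
      using class_cases[OF v(1)] class_cases[OF v(2)] eq by (elim disjE conjE) simp_all
    then obtain X where "X \<in> {X_alpha \<psi>, X_beta \<psi>, X_gamma \<psi>}" "v \<in> X" "v' \<in> X" by blast
    then have "card (var_of ` set c' \<inter> X) \<le> 1" "v \<in> var_of ` set c' \<inter> X" "v' \<in> var_of ` set c' \<inter> X"
      using one[OF cls_clause[OF c'(1)]] c' by (auto simp: v_def v'_def)
    then have "v = v'" by (auto simp: card_le_Suc0_iff_eq)
    then show ?thesis by (simp add: c' var_of_lit_code v_def v'_def)
  qed
  have K: "length cs \<le> (6 * n + 1) ^ 3"
  proof -
    let ?L = "Pos ` variables \<psi> \<union> Neg ` variables \<psi>"
    have "length cs = card (clauses \<psi>)"
      using distinct_card[OF cls(1)] cls(2) by (simp add: cs_def)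
    also have "\<dots> \<le> (card ?L + 1) ^ 3"
    proof (rule card_clauses_le)
      show "C \<subseteq> ?L \<and> card C \<le> 3" if "C \<in> clauses \<psi>" for C
      proof (intro conjI subsetI)
        fix l assume "l \<in> C"
        with vars[OF that] have "var_of l \<in> variables \<psi>" by blast
        then show "l \<in> ?L" by (cases l) auto
      qed (use cnf[OF that] in blast)
    qed (use fin in simp)
    also have "card ?L \<le> 6 * n"
      using card_Un_le[of "Pos ` variables \<psi>" "Neg ` variables \<psi>"]
        card_image_le[OF fin, of Pos] card_image_le[OF fin, of Neg] card by linarith
    then have "(card ?L + 1) ^ 3 \<le> (6 * n + 1) ^ 3" by (intro power_mono) auto
    finally show ?thesis .
  qed
  have sat: "satisfiable (clauses \<psi>) \<longleftrightarrow> (\<exists>\<tau>. \<forall>c\<in>set cs. \<exists>l\<in>set c. \<tau> (l div 2) = even l)"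
  proof
    assume "satisfiable (clauses \<psi>)"
    then obtain \<sigma> where \<sigma>: "\<And>C. C \<in> clauses \<psi> \<Longrightarrow> \<exists>l\<in>C. lit_true \<sigma> l" by (auto simp: satisfiable_def)
    let ?\<tau> = "\<lambda>v. \<sigma> (inv_into (variables \<psi>) num v)"
    have "\<exists>l\<in>set (map (lit_code num) c). ?\<tau> (l div 2) = even l" if c: "c \<in> set cls" for c
    proof -
      from \<sigma>[OF cls_clause[OF c]] obtain l where l: "l \<in> set c" "lit_true \<sigma> l" by blast
      have "var_of l \<in> variables \<psi>" using vars[OF cls_clause[OF c]] l by blast
      then have "inv_into (variables \<psi>) num (num (var_of l)) = var_of l"
        using num by (simp add: bij_betw_def)
      then show ?thesis
        using l by (intro bexI[of _ "lit_code num l"]) (auto simp: var_of_lit_code even_lit_code lit_true_iff)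
    qed
    then show "\<exists>\<tau>. \<forall>c\<in>set cs. \<exists>l\<in>set c. \<tau> (l div 2) = even l"
      unfolding cs_def by (intro exI[of _ ?\<tau>]) auto
  next
    assume "\<exists>\<tau>. \<forall>c\<in>set cs. \<exists>l\<in>set c. \<tau> (l div 2) = even l"
    then obtain \<tau> where \<tau>: "\<And>c. c \<in> set cs \<Longrightarrow> \<exists>l\<in>set c. \<tau> (l div 2) = even l" by blast
    have "\<exists>l\<in>C. lit_true (\<tau> \<circ> num) l" if C: "C \<in> clauses \<psi>" for C
    proof -
      from C cls(2) obtain c where c: "c \<in> set cls" "C = set c" by auto
      then have "map (lit_code num) c \<in> set cs" by (simp add: cs_def)
      from \<tau>[OF this] c show ?thesis
        by (auto simp: var_of_lit_code even_lit_code lit_true_iff)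
    qed
    then show "satisfiable (clauses \<psi>)" unfolding satisfiable_def by blast
  qed
  show ?thesis
    by (rule that[OF card input K], use len in blast, use lits in blast, use unique in blast, rule sat)
qed

text \<open>From \<open>N = 1\<close> on the square root is at least 1 and absorbs the additive
  constants.\<close>

lemma affine_sqrt_bigo: "(\<lambda>N. a * (b * (sqrt (real N) + 1) + c)) \<in> O(\<lambda>N. sqrt (real N))"
proof (rule bigoI[where c = "\<bar>a\<bar> * (\<bar>b\<bar> * 2 + \<bar>c\<bar>)"], rule eventually_sequentiallyI[of 1])
  fix N :: nat assume "1 \<le> N"
  then have r: "1 \<le> sqrt (real N)" by simp
  have "\<bar>b * (sqrt (real N) + 1) + c\<bar> \<le> \<bar>b\<bar> * (sqrt (real N) + 1) + \<bar>c\<bar> * 1"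
    using r by (intro order_trans[OF abs_triangle_ineq]) (simp add: abs_mult)
  also have "\<dots> \<le> \<bar>b\<bar> * (sqrt (real N) + sqrt (real N)) + \<bar>c\<bar> * sqrt (real N)"
    using r by (intro add_mono mult_left_mono) auto
  also have "\<dots> = (\<bar>b\<bar> * 2 + \<bar>c\<bar>) * sqrt (real N)" by (simp add: algebra_simps)
  finally show "norm (a * (b * (sqrt (real N) + 1) + c)) \<le> \<bar>a\<bar> * (\<bar>b\<bar> * 2 + \<bar>c\<bar>) * norm (sqrt (real N))"
    using mult_left_mono[of "\<bar>b * (sqrt (real N) + 1) + c\<bar>" _ "\<bar>a\<bar>"] by (simp add: abs_mult mult.assoc)
qed

lemma reduction_correct:
  assumes psat: "three_partitioned_3sat \<psi>" and N: "card (variables \<psi>) = N" and enc: "encodes_psat \<psi> ws"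
  obtains s V t st G k where "real s \<le> sqrt N + 1" "V + 2 \<le> 2 ^ (6 * s + 13)"
    "exec PROG (initial_state ws) t st" "t \<le> tm V PROG" "outputs_md st G k" "simple_graph G" "0 < k"
    "satisfiable (clauses \<psi>) \<longleftrightarrow> (\<exists>S. resolving_set G S \<and> card S \<le> k)"
    "vc G + k \<le> 36 * s + 52" "card (verts G) \<le> 2 ^ (6 * s + 12)"
proof -
  obtain n cs where n: "card (variables \<psi>) = 3 * n"
    and ws: "ws = n # length cs # concat (map (\<lambda>c. length c # c) cs)"
    and K: "length cs \<le> (6 * n + 1) ^ 3"
    and len: "\<forall>c\<in>set cs. length c \<le> 3"
    and lits: "\<forall>c\<in>set cs. \<forall>l\<in>set c. l < 6 * n"
    and unique: "\<forall>c\<in>set cs. \<forall>l\<in>set c. \<forall>l'\<in>set c.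
      (l div 2) div n = (l' div 2) div n \<longrightarrow> l div 2 = l' div 2"
    and sat: "satisfiable (clauses \<psi>) \<longleftrightarrow> (\<exists>\<tau>. \<forall>c\<in>set cs. \<exists>l\<in>set c. \<tau> (l div 2) = even l)"
    by (rule psat_codes[OF psat enc])
  obtain s where s: "1 \<le> s" "(s - 1) * (s - 1) \<le> n" "n < s * s" using exists_bucket_size by blast
  define d where "d = max n 1"
  define M where "M = 6 * s + 12"
  interpret reduction d s M cs
  proof
    show "1 \<le> s" "1 \<le> d" "d \<le> s * s" using s by (auto simp: d_def)
    show "l < 6 * d" if "c \<in> set cs" "l \<in> set c" for c l
    proof -
      have "l < 6 * n" using lits that by blast
      then show ?thesis by (simp add: d_def)
    qed
    show "l div 2 = l' div 2" if "c \<in> set cs" "l \<in> set c" "l' \<in> set c"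
      "(l div 2) div d = (l' div 2) div d" for c l l'
    proof -
      \<comment> \<open>A literal exists, so \<open>n\<close> is positive and the maximum with 1
        changes nothing.\<close>
      have "d = n" using lits that(1,2) by (fastforce simp: d_def)
      with unique that show ?thesis by blast
    qed
    show "6 * M + 6 + 15 * s + 2 * length cs + 3 * s * 2 ^ s < 2 ^ M"
      using instance_size[OF s(1,3) K M_def] .
  qed
  define V where "V = p + 6 * d"
  have "wp V PROG (\<lambda>st. outputs_md st G (m + 3 * s)) (initial_state ws)"
    unfolding ws by (rule wp_PROG[OF M_def d_def V_def s(2,3)]) (use len in blast)
  then obtain t st where run: "exec PROG (initial_state ws) t st" "t \<le> tm V PROG"
    "outputs_md st G (m + 3 * s)" by (auto simp: wp_def)
  show ?thesis
  proof (rule that[OF _ _ run simple_G])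
    \<comment> \<open>From \<open>(s - 1) * (s - 1) <= n\<close> and
      \<open>N = 3 * n\<close>.\<close>
    have "real (s - 1) ^ 2 \<le> real N"
      using s(2) n N by (simp add: power2_eq_square flip: of_nat_mult)
    then have "real (s - 1) \<le> sqrt N" by (rule real_le_rsqrt)
    then show "real s \<le> sqrt N + 1" using s(1) by simp
    \<comment> \<open>The tables exceed \<open>p\<close> by \<open>6 * d\<close>. Bounding this part
      by another \<open>2 ^ M\<close> raises the exponent from \<open>6 * s + 12\<close> to
      \<open>6 * s + 13\<close>.\<close>
    have "s < 2 ^ s" by simp
    then have "s * s \<le> 2 ^ s * 2 ^ s" by (intro mult_le_mono) auto
    also have "\<dots> = 2 ^ (2 * s)" by (simp add: mult_2 power_add)
    finally have "6 * d + 2 \<le> 2 ^ 3 * 2 ^ (2 * s)" using s d_pos d_le by simp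
    also have "\<dots> \<le> 2 ^ M" unfolding M_def power_add[symmetric] by (intro power_increasing) auto
    finally have "V + 2 \<le> 2 ^ M + 2 ^ M" using p_less by (simp add: V_def)
    also have "\<dots> = 2 ^ (6 * s + 13)" by (simp add: M_def power_add)
    finally show "V + 2 \<le> 2 ^ (6 * s + 13)" .
    show "0 < m + 3 * s" by (simp add: m_def)
    show "satisfiable (clauses \<psi>) \<longleftrightarrow> (\<exists>S. resolving_set G S \<and> card S \<le> m + 3 * s)"
      using sat resolving_iff_satisfiable by (simp add: codes_satisfiable_def)
    \<comment> \<open>The bound \<open>m + 9 * s\<close> on the cover and the budget
      \<open>m + 3 * s\<close> add up to \<open>2 * m + 12 * s\<close>.\<close>
    have "m = 12 * s + 26" unfolding m_def by (simp add: M_def)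
    then show "vc G + (m + 3 * s) \<le> 36 * s + 52" using vc_bound by linarith
    show "card (verts G) \<le> 2 ^ (6 * s + 12)" using p_less unfolding M_def[symmetric] by (simp add: verts_G)
  qed
qed

theorem theorem3:
  "\<exists>(prog :: com) (T :: nat \<Rightarrow> real) (p :: nat \<Rightarrow> real) (q :: nat \<Rightarrow> real).
     T \<in> O(\<lambda>N. sqrt (real N)) \<and> p \<in> O(\<lambda>N. sqrt (real N)) \<and> q \<in> O(\<lambda>N. sqrt (real N)) \<and>
     (\<forall>(\<psi> :: psat) (ws :: nat list) (N :: nat).
        three_partitioned_3sat \<psi> \<and> card (variables \<psi>) = N \<and> encodes_psat \<psi> ws \<longrightarrow>
        (\<exists>(t :: nat) (s :: state) (G :: nat graph) (k :: nat).
           exec prog (initial_state ws) t s \<and> real t \<le> 2 powr T N \<and>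
           outputs_md s G k \<and> simple_graph G \<and> k > 0 \<and>
           (satisfiable (clauses \<psi>) \<longleftrightarrow> (\<exists>S. resolving_set G S \<and> card S \<le> k)) \<and>
           real (vc G + k) \<le> p N \<and>
           real (card (verts G)) \<le> 2 powr q N))"
proof -
  \<comment> \<open>The program is the same for all instances, so \<open>e\<close> is a constant and
    remains a mere factor in the exponent of the running time.\<close>
  obtain e where e: "\<And>V. tm V PROG \<le> (V + 2) ^ e" using tm_polynomial by blast
  let ?T = "\<lambda>N. real e * (6 * (sqrt (real N) + 1) + 13)"
  let ?p = "\<lambda>N. 1 * (36 * (sqrt (real N) + 1) + 52)"
  let ?q = "\<lambda>N. 1 * (6 * (sqrt (real N) + 1) + 12)"
  have "\<exists>t st G k. exec PROG (initial_state ws) t st \<and> real t \<le> 2 powr ?T N \<and>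
      outputs_md st G k \<and> simple_graph G \<and> k > 0 \<and>
      (satisfiable (clauses \<psi>) \<longleftrightarrow> (\<exists>S. resolving_set G S \<and> card S \<le> k)) \<and>
      real (vc G + k) \<le> ?p N \<and> real (card (verts G)) \<le> 2 powr ?q N"
    if inst: "three_partitioned_3sat \<psi>" "card (variables \<psi>) = N" "encodes_psat \<psi> ws" for \<psi> ws N
  proof -
    from reduction_correct[OF inst] obtain s V t st G k where
      s: "real s \<le> sqrt N + 1" and V: "V + 2 \<le> 2 ^ (6 * s + 13)"
      and t: "exec PROG (initial_state ws) t st" "t \<le> tm V PROG"
      and G: "outputs_md st G k" "simple_graph G" "0 < k"
        "satisfiable (clauses \<psi>) \<longleftrightarrow> (\<exists>S. resolving_set G S \<and> card S \<le> k)"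
      and vc: "vc G + k \<le> 36 * s + 52" and verts: "card (verts G) \<le> 2 ^ (6 * s + 12)" by metis
    have pow: "real (2 ^ i) = 2 powr real i" for i :: nat by (simp add: powr_realpow)
    have "t \<le> (2 ^ (6 * s + 13)) ^ e"
      using t(2) e[of V] power_mono[OF V, of e] by linarith
    then have "t \<le> 2 ^ (e * (6 * s + 13))" by (simp add: power_mult[symmetric] mult.commute)
    then have "real t \<le> 2 powr real (e * (6 * s + 13))" unfolding pow[symmetric] by (rule of_nat_mono)
    also have "\<dots> \<le> 2 powr ?T N"
      using s by (intro powr_mono) (auto intro!: mult_left_mono)
    finally have "real t \<le> 2 powr ?T N" .
    moreover have "real (vc G + k) \<le> ?p N" using vc s by simp
    moreover have "real (card (verts G)) \<le> 2 powr ?q N"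
    proof -
      have "real (card (verts G)) \<le> 2 powr real (6 * s + 12)"
        using verts unfolding pow[symmetric] by (rule of_nat_mono)
      also have "\<dots> \<le> 2 powr ?q N" using s by (intro powr_mono) auto
      finally show ?thesis .
    qed
    ultimately show ?thesis using t(1) G by blast
  qed
  then show ?thesis
    by (intro exI[of _ PROG] exI[of _ ?T] exI[of _ ?p] exI[of _ ?q] conjI affine_sqrt_bigo) blast
qed

end
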